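(* Consider a state-dependent discrete memoryless channel $W_{Y,Z|X,S}$ with finite alphabets, i.i.d. state distribution $Q_S$, innocent symbol $x_0$, and causal channel state information available only at the transmitter (encoder $X_i=f_i(M,S^i)$, decoder $Y^n\mapsto\hat M$). Let $\mathcal D$ be the set of joint pmfs $$P_{U,V,S,X,Y,Z}=P_UP_VP_{S|V}\mathbb 1_{\{X=x(U,S)\}}W_{Y,Z|X,S},$$ where $U,V$ are auxiliary random variables on finite alphabets with $|\mathcal U|\le|\mathcal X|+2$, $|\mathcal V|\le|\mathcal X|+3$, $x:\mathcal U\times\mathcal S\to\mathcal X$ is deterministic, such that $Q_S(s)=\sum_vP_V(v)P_{S|V}(s|v)$, $P_Z=Q_0$, and $\mathbb I(V;Y|U)>\max\{\mathbb I(V;Z),\ \mathbb I(U,V;Z)-\mathbb I(U;Y)\}$. Let $$\mathcal S=\{R\ge0:\exists P\in\mathcal D\text{ with }R\le\mathbb I(U;Y)+\min\{0,\ \mathbb I(V;Y|U)-\mathbb I(V;S)\}\}.$$ Then the covert capacity satisfies $C_{\mathrm{C\text{-}T}}\ge\max\{x:x\in\mathcal S\}$.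
   Context: Finite alphabets $\mathcal S,\mathcal X,\mathcal Y,\mathcal Z$. The channel has transition pmf $W_{Y,Z|X,S}$: input $X$, state $S$, output $Y$ at the legitimate receiver and output $Z$ at an adversary (warden). The state sequence $S^n$ is i.i.d. with pmf $Q_S$ and independent of the message; neither the legitimate receiver nor the warden knows the state. $x_0\in\mathcal X$ is a fixed innocent symbol, and $Q_0(z)=\sum_{s}Q_S(s)W_{Z|X,S}(z|x_0,s)$, assumed to have full support on $\mathcal Z$. A $(2^{nR},n)$ code consists of a message $M$ uniform on $\{1,\dots,2^{nR}\}$, an encoder and a decoder of the type specified. $P_{Z^n}$ denotes the distribution of the warden's output induced by the code. A rate $R$ is achievable if there is a sequence of $(2^{nR},n)$ codes with $\mathbb P(\hat M\ne M)\to 0$ and $\mathbb D(P_{Z^n}\|Q_0^{\otimes n})\to 0$ as $n\to\infty$; the covert capacity is the supremum of achievable rates. Mutual informations are computed under the indicated joint pmf. *)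

theory Defs
  imports "HOL-Probability.Probability"
begin

definition mutual_info :: "('a \<times> 'b) pmf \<Rightarrow> real" where
  "mutual_info p = (\<Sum>ab\<in>set_pmf p.
      pmf p ab * log 2 (pmf p ab /
        (pmf (map_pmf fst p) (fst ab) * pmf (map_pmf snd p) (snd ab))))"

definition cond_mutual_info :: "('a \<times> 'b \<times> 'c) pmf \<Rightarrow> real" where
  "cond_mutual_info p = (\<Sum>abc\<in>set_pmf p.
      (case abc of (a, b, c) \<Rightarrow>
        pmf p (a, b, c) * log 2 (pmf p (a, b, c) * pmf (map_pmf (\<lambda>(a,b,c). c) p) c /
          (pmf (map_pmf (\<lambda>(a,b,c). (a,c)) p) (a, c) * pmf (map_pmf (\<lambda>(a,b,c). (b,c)) p) (b, c)))))"

definition WY :: "('x \<Rightarrow> 's \<Rightarrow> ('y \<times> 'z) pmf) \<Rightarrow> 'x \<Rightarrow> 's \<Rightarrow> 'y pmf" where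
  "WY W x s = map_pmf fst (W x s)"

definition WZ :: "('x \<Rightarrow> 's \<Rightarrow> ('y \<times> 'z) pmf) \<Rightarrow> 'x \<Rightarrow> 's \<Rightarrow> 'z pmf" where
  "WZ W x s = map_pmf snd (W x s)"

definition Q0 :: "'s pmf \<Rightarrow> ('x \<Rightarrow> 's \<Rightarrow> ('y \<times> 'z) pmf) \<Rightarrow> 'x \<Rightarrow> 'z pmf" where
  "Q0 QS W x0 = bind_pmf QS (\<lambda>s. WZ W x0 s)"

definition lists_len :: "nat \<Rightarrow> 'a list set" where
  "lists_len n = {xs. length xs = n}"

definition num_msgs :: "real \<Rightarrow> nat \<Rightarrow> nat" where
  "num_msgs R n = nat \<lceil>2 powr (real n * R)\<rceil>"

text \<open>Causal encoder: enc i m s^i gives X_{i+1}; the i-th input (0-indexed) only sees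
  the first i+1 states.  Messages are 0, ..., num_msgs - 1.\<close>
definition code_inputs :: "(nat \<Rightarrow> nat \<Rightarrow> 's list \<Rightarrow> 'x) \<Rightarrow> nat \<Rightarrow> nat \<Rightarrow> 's list \<Rightarrow> 'x list" where
  "code_inputs enc n m ss = map (\<lambda>i. enc i m (take (Suc i) ss)) [0..<n]"

definition iid_prob :: "'a pmf \<Rightarrow> nat \<Rightarrow> 'a list \<Rightarrow> real" where
  "iid_prob Q n xs = (\<Prod>i<n. pmf Q (xs ! i))"

definition chan_prob :: "('x \<Rightarrow> 's \<Rightarrow> 'b pmf) \<Rightarrow> nat \<Rightarrow> 'x list \<Rightarrow> 's list \<Rightarrow> 'b list \<Rightarrow> real" where
  "chan_prob V n xs ss bs = (\<Prod>i<n. pmf (V (xs ! i) (ss ! i)) (bs ! i))"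

definition error_prob ::
  "'s pmf \<Rightarrow> ('x \<Rightarrow> 's \<Rightarrow> ('y \<times> 'z) pmf) \<Rightarrow> nat \<Rightarrow> nat \<Rightarrow>
   (nat \<Rightarrow> nat \<Rightarrow> 's list \<Rightarrow> 'x) \<Rightarrow> ('y list \<Rightarrow> nat) \<Rightarrow> real" where
  "error_prob QS W n Mn enc dec =
     (1 / real Mn) * (\<Sum>m<Mn. \<Sum>ss\<in>lists_len n. iid_prob QS n ss *
        (\<Sum>ys\<in>lists_len n. chan_prob (WY W) n (code_inputs enc n m ss) ss ys *
           (if dec ys \<noteq> m then 1 else 0)))"

definition warden_dist ::
  "'s pmf \<Rightarrow> ('x \<Rightarrow> 's \<Rightarrow> ('y \<times> 'z) pmf) \<Rightarrow> nat \<Rightarrow> nat \<Rightarrow>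
   (nat \<Rightarrow> nat \<Rightarrow> 's list \<Rightarrow> 'x) \<Rightarrow> 'z list \<Rightarrow> real" where
  "warden_dist QS W n Mn enc zs =
     (1 / real Mn) * (\<Sum>m<Mn. \<Sum>ss\<in>lists_len n. iid_prob QS n ss *
        chan_prob (WZ W) n (code_inputs enc n m ss) ss zs)"

definition warden_divergence ::
  "'s pmf \<Rightarrow> ('x \<Rightarrow> 's \<Rightarrow> ('y \<times> 'z) pmf) \<Rightarrow> 'x \<Rightarrow> nat \<Rightarrow> nat \<Rightarrow>
   (nat \<Rightarrow> nat \<Rightarrow> 's list \<Rightarrow> 'x) \<Rightarrow> real" where
  "warden_divergence QS W x0 n Mn enc =
     (\<Sum>zs\<in>lists_len n.
        (let p = warden_dist QS W n Mn enc zs in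
         if p = 0 then 0 else p * log 2 (p / iid_prob (Q0 QS W x0) n zs)))"

definition covert_achievable ::
  "'s pmf \<Rightarrow> ('x \<Rightarrow> 's \<Rightarrow> ('y \<times> 'z) pmf) \<Rightarrow> 'x \<Rightarrow> real \<Rightarrow> bool" where
  "covert_achievable QS W x0 R \<longleftrightarrow>
     (\<exists>(enc :: nat \<Rightarrow> nat \<Rightarrow> nat \<Rightarrow> 's list \<Rightarrow> 'x) (dec :: nat \<Rightarrow> 'y list \<Rightarrow> nat).
        (\<lambda>n. error_prob QS W n (num_msgs R n) (enc n) (dec n)) \<longlonglongrightarrow> 0 \<and>
        (\<lambda>n. warden_divergence QS W x0 n (num_msgs R n) (enc n)) \<longlonglongrightarrow> 0)"

definition covert_capacity_CT ::
  "'s pmf \<Rightarrow> ('x \<Rightarrow> 's \<Rightarrow> ('y \<times> 'z) pmf) \<Rightarrow> 'x \<Rightarrow> ereal" where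
  "covert_capacity_CT QS W x0 = Sup (ereal ` {R. covert_achievable QS W x0 R})"

definition aux_joint ::
  "nat pmf \<Rightarrow> nat pmf \<Rightarrow> (nat \<Rightarrow> 's pmf) \<Rightarrow> (nat \<Rightarrow> 's \<Rightarrow> 'x) \<Rightarrow>
   ('x \<Rightarrow> 's \<Rightarrow> ('y \<times> 'z) pmf) \<Rightarrow> (nat \<times> nat \<times> 's \<times> 'x \<times> 'y \<times> 'z) pmf" where
  "aux_joint PU PV PSV xf W =
     bind_pmf PU (\<lambda>u. bind_pmf PV (\<lambda>v. bind_pmf (PSV v) (\<lambda>s.
       map_pmf (\<lambda>(y, z). (u, v, s, xf u s, y, z)) (W (xf u s) s))))"

definition in_D ::
  "'s pmf \<Rightarrow> ('x \<Rightarrow> 's \<Rightarrow> ('y \<times> 'z) pmf) \<Rightarrow> 'x \<Rightarrow>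
   nat pmf \<Rightarrow> nat pmf \<Rightarrow> (nat \<Rightarrow> 's pmf) \<Rightarrow> (nat \<Rightarrow> 's \<Rightarrow> 'x) \<Rightarrow> bool" where
  "in_D QS W x0 PU PV PSV xf \<longleftrightarrow>
     (let P = aux_joint PU PV PSV xf W in
      set_pmf PU \<subseteq> {..<CARD('x) + 2} \<and>
      set_pmf PV \<subseteq> {..<CARD('x) + 3} \<and>
      bind_pmf PV PSV = QS \<and>
      map_pmf (\<lambda>(u,v,s,x,y,z). z) P = Q0 QS W x0 \<and>
      cond_mutual_info (map_pmf (\<lambda>(u,v,s,x,y,z). (v, y, u)) P) >
        max (mutual_info (map_pmf (\<lambda>(u,v,s,x,y,z). (v, z)) P))
            (mutual_info (map_pmf (\<lambda>(u,v,s,x,y,z). ((u, v), z)) P)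
             - mutual_info (map_pmf (\<lambda>(u,v,s,x,y,z). (u, y)) P)))"

definition rate_bound ::
  "('x \<Rightarrow> 's \<Rightarrow> ('y \<times> 'z) pmf) \<Rightarrow>
   nat pmf \<Rightarrow> nat pmf \<Rightarrow> (nat \<Rightarrow> 's pmf) \<Rightarrow> (nat \<Rightarrow> 's \<Rightarrow> 'x) \<Rightarrow> real" where
  "rate_bound W PU PV PSV xf =
     (let P = aux_joint PU PV PSV xf W in
      mutual_info (map_pmf (\<lambda>(u,v,s,x,y,z). (u, y)) P) +
      min 0 (cond_mutual_info (map_pmf (\<lambda>(u,v,s,x,y,z). (v, y, u)) P)
             - mutual_info (map_pmf (\<lambda>(u,v,s,x,y,z). (v, s)) P)))"

definition region_S :: "'s pmf \<Rightarrow> ('x \<Rightarrow> 's \<Rightarrow> ('y \<times> 'z) pmf) \<Rightarrow> 'x \<Rightarrow> real set" where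
  "region_S QS W x0 = {R. R \<ge> 0 \<and>
     (\<exists>PU PV PSV xf. in_D QS W x0 PU PV PSV xf \<and> R \<le> rate_bound W PU PV PSV xf)}"

end

(* The region forces R <= I(U,V;Y) - I(V;S) and I(U,V;Z) < I(U,V;Y), and rates just below
   I(U,V;Y) - I(V;S) are achieved by a random tree code. A constant number L of blocks of
   length n is used. In every block the encoder sends a codeword of U^n indexed by the whole
   message and by the V-indices of all earlier blocks; at the end of the block it quantises the
   block's state sequence to the index of a V^n codeword. All codewords attached to different
   histories are independent.

   The quantiser is deterministic, but it only picks pairs whose information density is at least
   n (I(V;S) - eps). Hence the law of (index, states) exceeds that of a uniform index followed by
   the memoryless channel P_{S|V} by at most a factor of about 2^{3 n eps}, which the exponentially small
   atypicality probabilities absorb.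

   Reliability: all codewords of a wrong message are independent of the output, and there are about
   2^{L n (R + I(V;S))} of them against an information density of L n I(U,V;Y).
   Covertness: conditioned on the warden's past outputs, the history that selects the next codeword
   remains so spread out (this uses I(U,V;Z) < I(U,V;Y), R > 0 and L large) that soft covering makes
   the next block of outputs nearly i.i.d. No separate key initialisation is needed, because the
   whole message already enters the first block. *)
theory Submission
  imports Defs
begin

text \<open>Soft covering needs a pointwise bound on the warden's posterior weight of each single
  history. The law of the code has no such bound, so it is truncated: \<open>G\<close> keeps the
  transitions where the quantiser succeeds and the output is typical, and the mass given up is
  charged to \<open>bad\<close>. On \<open>G\<close> each block multiplies the likelihood relative
  to the target output law by at most \<eta>/\<gamma>, about 2^{n(I(U,V;Z) - I(V;S))}, starting from
  1/M. The variance of the next output is controlled if D (\<eta>/\<gamma>)^j / M is exponentially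
  small for every j < L, where D = 2^{nd} bounds the density ratio of a whole block. Since M is
  about 2^{LnR} and R exceeds both 0 and I(U,V;Z) - I(V;S) by a margin c, the exponent has slack L n
  c. Hence L c >= d + 2 is all that L must satisfy.

  Divergence is recovered from L1 distance at the cost of a factor linear in the total length. The
  two criteria are therefore added with this factor as weight before a codebook is fixed, and
  exponential decay absorbs it. The constants are chosen in the order \<delta>, atypicality rates,
  \<epsilon>, covering rate.\<close>

definition fexp :: "'a pmf \<Rightarrow> ('a \<Rightarrow> real) \<Rightarrow> real" where
  "fexp p f = (\<Sum>x\<in>set_pmf p. pmf p x * f x)"

lemma fexp_eq_expectation:
  assumes "finite (set_pmf p)"
  shows "fexp p f = measure_pmf.expectation p f"
  unfolding fexp_def using assms
  by (subst integral_measure_pmf_real[of "set_pmf p"]) (auto simp: mult.commute)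

lemma fexp_add: "fexp p (\<lambda>x. f x + g x) = fexp p f + fexp p g"
  by (simp add: fexp_def algebra_simps sum.distrib)

lemma fexp_diff: "fexp p (\<lambda>x. f x - g x) = fexp p f - fexp p g"
  by (simp add: fexp_def algebra_simps sum_subtractf)

lemma fexp_cmult: "fexp p (\<lambda>x. c * f x) = c * fexp p f"
  by (simp add: fexp_def sum_distrib_left algebra_simps)

lemma fexp_multc: "fexp p (\<lambda>x. f x * c) = fexp p f * c"
  by (simp add: fexp_def sum_distrib_left sum_distrib_right algebra_simps)

lemma fexp_divide: "fexp p (\<lambda>x. f x / c) = fexp p f / c"
  by (simp add: fexp_def sum_divide_distrib)

lemma fexp_sum: "fexp p (\<lambda>x. \<Sum>i\<in>I. f i x) = (\<Sum>i\<in>I. fexp p (f i))"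
  unfolding fexp_def sum_distrib_left by (rule sum.swap)

lemma fexp_mono: "(\<And>x. x \<in> set_pmf p \<Longrightarrow> f x \<le> g x) \<Longrightarrow> fexp p f \<le> fexp p g"
  unfolding fexp_def by (intro sum_mono mult_left_mono) auto

lemma fexp_cong: "(\<And>x. x \<in> set_pmf p \<Longrightarrow> f x = g x) \<Longrightarrow> fexp p f = fexp p g"
  unfolding fexp_def by (intro sum.cong) auto

lemma fexp_nonneg: "(\<And>x. x \<in> set_pmf p \<Longrightarrow> 0 \<le> f x) \<Longrightarrow> 0 \<le> fexp p f"
  unfolding fexp_def by (intro sum_nonneg mult_nonneg_nonneg) auto

lemma fexp_const: "finite (set_pmf p) \<Longrightarrow> fexp p (\<lambda>_. c) = c"
  by (simp add: fexp_eq_expectation)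

text \<open>This is how random coding yields a deterministic code: a cost averaged over codebooks is
  met by at least one of them.\<close>

lemma fexp_attained:
  assumes "finite (set_pmf p)"
  shows "\<exists>x\<in>set_pmf p. f x \<le> fexp p f"
proof (rule ccontr)
  assume "\<not> ?thesis"
  then have *: "\<forall>x\<in>set_pmf p. fexp p f < f x" by auto
  define c where "c = fexp p f"
  have "fexp p (\<lambda>_. c) < fexp p f"
    unfolding fexp_def
    using assms * set_pmf_not_empty[of p]
    by (intro sum_strict_mono) (auto simp: pmf_positive c_def)
  then show False using assms by (simp add: fexp_const c_def)
qed

lemma fexp_pair:
  "fexp (pair_pmf p q) f = fexp p (\<lambda>x. fexp q (\<lambda>y. f (x, y)))"
  unfolding fexp_def
  by (auto simp: sum.cartesian_product sum_distrib_left pmf_pair mult.assoc intro!: sum.cong)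

lemma finite_set_Pi_pmf:
  assumes "finite A" "\<And>x. x \<in> A \<Longrightarrow> finite (set_pmf (p x))"
  shows "finite (set_pmf (Pi_pmf A d p))"
  using assms by (auto simp: set_Pi_pmf intro!: finite_PiE_dflt)

lemma fexp_map:
  assumes "finite (set_pmf p)"
  shows "fexp (map_pmf g p) f = fexp p (\<lambda>x. f (g x))"
  using assms by (simp add: fexp_eq_expectation)

lemma fexp_Pi_pmf_prod:
  assumes "finite A" "finite (set_pmf p)"
  shows "fexp (Pi_pmf A d (\<lambda>_. p)) (\<lambda>f. \<Prod>x\<in>A. g x (f x)) = (\<Prod>x\<in>A. fexp p (g x))"
  using assms(1)
proof induction
  case empty
  then show ?case by (simp add: fexp_def)
next
  case (insert a A)
  have "(\<Prod>x\<in>A. g x (if x = a then y else f x)) = (\<Prod>x\<in>A. g x (f x))" for y f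
    using insert by (intro prod.cong) auto
  then have "fexp (Pi_pmf (insert a A) d (\<lambda>_. p)) (\<lambda>f. \<Prod>x\<in>insert a A. g x (f x))
     = fexp p (\<lambda>y. fexp (Pi_pmf A d (\<lambda>_. p)) (\<lambda>f. g a y * (\<Prod>x\<in>A. g x (f x))))"
    using insert assms(2)
    by (simp add: Pi_pmf_insert fexp_map finite_set_Pi_pmf fexp_pair)
  then show ?case
    using insert by (simp add: fexp_cmult fexp_multc)
qed

lemma fexp_Pi_pmf_prod_subset:
  assumes "finite A" "finite (set_pmf p)" "B \<subseteq> A"
  shows "fexp (Pi_pmf A d (\<lambda>_. p)) (\<lambda>f. \<Prod>x\<in>B. g x (f x)) = (\<Prod>x\<in>B. fexp p (g x))"
proof -
  have "(\<Prod>x\<in>B. h x) = (\<Prod>x\<in>A. if x \<in> B then h x else 1)" for h :: "'a \<Rightarrow> real"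
    using assms by (simp add: prod.If_cases Int_absorb1)
  moreover have "fexp p (\<lambda>v. if x \<in> B then g x v else 1) = (if x \<in> B then fexp p (g x) else 1)" for x
    using assms by (auto simp: fexp_const)
  moreover have "(\<Prod>x\<in>A. if x \<in> B then g x (f x) else 1)
      = (\<Prod>x\<in>A. (\<lambda>v. if x \<in> B then g x v else 1) (f x))" for f
    by simp
  ultimately show ?thesis
    using fexp_Pi_pmf_prod[OF assms(1,2), of d "\<lambda>x v. if x \<in> B then g x v else 1"] by simp
qed

lemma fexp_Pi_pmf_component:
  assumes "finite A" "finite (set_pmf p)" "x \<in> A"
  shows "fexp (Pi_pmf A d (\<lambda>_. p)) (\<lambda>f. g (f x)) = fexp p g"
  using fexp_Pi_pmf_prod_subset[OF assms(1,2), of "{x}" d "\<lambda>_. g"] assms by simp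

lemma fexp_Pi_pmf_two:
  assumes "finite A" "finite (set_pmf p)" "x \<in> A" "y \<in> A" "x \<noteq> y"
  shows "fexp (Pi_pmf A d (\<lambda>_. p)) (\<lambda>f. g (f x) * h (f y)) = fexp p g * fexp p h"
  using fexp_Pi_pmf_prod_subset[OF assms(1,2), of "{x,y}" d "\<lambda>z. if z = x then g else h"] assms by simp

text \<open>Off-diagonal products factor by independence and vanish because \<open>X\<close> is
  centred. In use \<open>A\<close> is one level of the tree, \<open>X\<close> a centred output
  probability and \<open>w\<close> the truncated weight of a history.\<close>

lemma fexp_weighted_square:
  assumes A: "finite A" and p: "finite (set_pmf p)" and z: "fexp p X = 0"
  shows "fexp (Pi_pmf A d (\<lambda>_. p)) (\<lambda>f. (\<Sum>h\<in>A. w h * X (f h))\<^sup>2) = (\<Sum>h\<in>A. (w h)\<^sup>2 * fexp p (\<lambda>u. (X u)\<^sup>2))"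
proof -
  have *: "fexp (Pi_pmf A d (\<lambda>_. p)) (\<lambda>f. (w h * X (f h)) * (w h' * X (f h')))
      = (if h = h' then (w h)\<^sup>2 * fexp p (\<lambda>u. (X u)\<^sup>2) else 0)" if "h \<in> A" "h' \<in> A" for h h'
  proof (cases "h = h'")
    case True
    have "fexp (Pi_pmf A d (\<lambda>_. p)) (\<lambda>f. (w h * X (f h)) * (w h' * X (f h')))
       = fexp (Pi_pmf A d (\<lambda>_. p)) (\<lambda>f. (w h)\<^sup>2 * (\<lambda>u. (X u)\<^sup>2) (f h))"
      using True by (intro fexp_cong) (auto simp: power2_eq_square)
    also have "\<dots> = (w h)\<^sup>2 * fexp p (\<lambda>u. (X u)\<^sup>2)"
      unfolding fexp_cmult by (subst fexp_Pi_pmf_component[OF A p that(1)]) simp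
    finally show ?thesis using True by simp
  next
    case False
    show ?thesis
      using fexp_Pi_pmf_two[OF A p that False, of d "\<lambda>u. w h * X u" "\<lambda>u. w h' * X u"] False z
      by (simp add: fexp_cmult)
  qed
  show ?thesis
    unfolding power2_eq_square[of "sum _ _"] sum_product fexp_sum
    by (simp add: * A sum.delta cong: sum.cong)
qed

section \<open>Random tree codes\<close>

definition seqs :: "nat \<Rightarrow> 'a set \<Rightarrow> 'a list set" where
  "seqs n A = {xs. length xs = n \<and> set xs \<subseteq> A}"

lemma seqs_0 [simp]: "seqs 0 A = {[]}"
  by (auto simp: seqs_def)

lemma seqs_Suc: "seqs (Suc n) A = (\<lambda>(x, xs). x # xs) ` (A \<times> seqs n A)"
  by (auto simp: seqs_def length_Suc_conv image_iff)

lemma finite_seqs [simp]: "finite A \<Longrightarrow> finite (seqs n A)"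
  by (induction n) (auto simp: seqs_Suc)

lemma sum_seqs_Suc: "(\<Sum>xs\<in>seqs (Suc n) A. f xs) = (\<Sum>xs\<in>seqs n A. \<Sum>x\<in>A. f (x # xs))"
proof -
  have "(\<Sum>xs\<in>seqs (Suc n) A. f xs) = (\<Sum>(x, xs)\<in>A \<times> seqs n A. f (x # xs))"
    unfolding seqs_Suc by (subst sum.reindex) (auto simp: inj_on_def case_prod_beta)
  then show ?thesis
    by (simp add: sum.cartesian_product[symmetric] sum.swap[of _ _ A])
qed

text \<open>Block lists carry the most recent block first: \<^term>\<open>U\<close> maps the past state blocks to the
  codeword of the next block.\<close>

primrec block_prob :: "('s \<Rightarrow> real) \<Rightarrow> ('u \<Rightarrow> 's \<Rightarrow> 'o \<Rightarrow> real) \<Rightarrow> ('s list \<Rightarrow> 'u) \<Rightarrow> 's list \<Rightarrow> 'o list \<Rightarrow> real" where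
  "block_prob Q Wo U [] xs = 1"
| "block_prob Q Wo U (s # ss) xs = block_prob Q Wo U ss (tl xs) * (Q s * Wo (U ss) s (hd xs))"

text \<open>One-shot setting: a whole block counts as a single letter, so the tree argument never
  mentions the block length. \<open>PS\<close> is the backward channel from \<open>v\<close> to the
  state, and \<open>PS_avg\<close> makes it consistent with the state law \<open>Q\<close>.\<close>

locale tree_code =
  fixes PU :: "'u pmf" and PV :: "'v pmf" and Q :: "'s \<Rightarrow> real" and S :: "'s set"
    and PS :: "'v \<Rightarrow> 's \<Rightarrow> real" and K M :: nat and \<gamma> :: real
  assumes finite_PU: "finite (set_pmf PU)" and finite_PV: "finite (set_pmf PV)"
    and finite_S: "finite S"
    and Q_nonneg: "s \<in> S \<Longrightarrow> 0 \<le> Q s" and Q_sum: "sum Q S = 1"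
    and PS_nonneg: "s \<in> S \<Longrightarrow> 0 \<le> PS v s"
    and PS_avg: "s \<in> S \<Longrightarrow> fexp PV (\<lambda>v. PS v s) = Q s"
    and K_pos: "0 < K" and M_pos: "0 < M" and \<gamma>_pos: "0 < \<gamma>"
begin

text \<open>A node is a history with the newest index in front and the message at the end:
  \<open>tl\<close> gives the parent and \<open>last\<close> the message.\<close>

primrec nodes :: "nat \<Rightarrow> nat list set" where
  "nodes 0 = (\<lambda>m. [m]) ` {..<M}"
| "nodes (Suc b) = (\<lambda>(i, h). i # h) ` ({..<K} \<times> nodes b)"

lemma finite_nodes [simp]: "finite (nodes b)"
  by (induction b) auto

lemma nodes_not_Nil: "h \<in> nodes b \<Longrightarrow> h \<noteq> []"
  by (cases b) auto

lemma sum_nodes_0: "(\<Sum>h\<in>nodes 0. f h) = (\<Sum>m<M. f [m])"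
  by (simp add: sum.reindex inj_on_def)

lemma sum_nodes_Suc: "(\<Sum>h\<in>nodes (Suc b). f h) = (\<Sum>h\<in>nodes b. \<Sum>i<K. f (i # h))"
proof -
  have "(\<Sum>h\<in>nodes (Suc b). f h) = (\<Sum>(i, h)\<in>{..<K} \<times> nodes b. f (i # h))"
    unfolding nodes.simps by (subst sum.reindex) (auto simp: inj_on_def case_prod_beta)
  then show ?thesis
    by (simp add: sum.cartesian_product[symmetric] sum.swap[of _ _ "{..<K}"])
qed

lemma card_nodes: "card (nodes b) = M * K ^ b"
proof (induction b)
  case 0
  then show ?case by (simp add: card_image inj_on_def)
next
  case (Suc b)
  have "card (nodes (Suc b)) = card ({..<K} \<times> nodes b)"
    unfolding nodes.simps by (intro card_image) (auto simp: inj_on_def)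
  then show ?case using Suc by (simp add: card_cartesian_product)
qed

definition good :: "'v \<Rightarrow> 's \<Rightarrow> bool" where
  "good v s \<longleftrightarrow> Q s * \<gamma> \<le> PS v s"

text \<open>\<open>LEAST\<close> makes the index a function of codebook and state, as a
  deterministic encoder requires. The default 0 is never good, so it drops out of
  \<open>gstep\<close> and its weight is charged to \<open>cover_fail\<close>.\<close>

definition pick :: "(nat list \<Rightarrow> 'v) \<Rightarrow> nat list \<Rightarrow> 's \<Rightarrow> nat" where
  "pick v h s = (if \<exists>i<K. good (v (i # h)) s then LEAST i. i < K \<and> good (v (i # h)) s else 0)"

lemma pick_less: "pick v h s < K"
  unfolding pick_def using K_pos by (auto intro: LeastI2)

lemma good_pick: "i < K \<Longrightarrow> good (v (i # h)) s \<Longrightarrow> good (v (pick v h s # h)) s"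
  unfolding pick_def by (auto intro: LeastI2)

text \<open>Level \<open>b\<close> is exactly what block \<open>b\<close> consumes: the
  \<open>U\<close> codeword at a node and the \<open>V\<close> candidates at all its
  children.\<close>

definition level :: "nat \<Rightarrow> ((nat list \<Rightarrow> 'u) \<times> (nat list \<Rightarrow> 'v)) pmf" where
  "level b = pair_pmf (Pi_pmf (nodes b) undefined (\<lambda>_. PU)) (Pi_pmf (nodes (Suc b)) undefined (\<lambda>_. PV))"

lemma finite_level: "finite (set_pmf (level b))"
  unfolding level_def using finite_PU finite_PV
  by (simp add: finite_set_Pi_pmf del: nodes.simps)

text \<open>A nested expectation in place of one large product measure: the newest level is averaged
  innermost, so in an induction step all weights determined by the older levels \<open>C\<close> are
  constants.\<close>

primrec EC :: "nat \<Rightarrow> (((nat list \<Rightarrow> 'u) \<times> (nat list \<Rightarrow> 'v)) list \<Rightarrow> real) \<Rightarrow> real" where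
  "EC 0 F = F []"
| "EC (Suc b) F = EC b (\<lambda>C. fexp (level b) (\<lambda>c. F (c # C)))"

lemma EC_add: "EC b (\<lambda>C. F C + G C) = EC b F + EC b G"
  by (induction b arbitrary: F G) (simp_all add: fexp_add)

lemma EC_cmult: "EC b (\<lambda>C. k * F C) = k * EC b F"
  by (induction b arbitrary: F) (simp_all add: fexp_cmult)

lemma EC_sum: "EC b (\<lambda>C. \<Sum>i\<in>I. F i C) = (\<Sum>i\<in>I. EC b (F i))"
  by (induction b arbitrary: F) (simp_all add: fexp_sum)

lemma EC_mono: "(\<And>C. length C = b \<Longrightarrow> F C \<le> G C) \<Longrightarrow> EC b F \<le> EC b G"
proof (induction b arbitrary: F G)
  case (Suc b)
  have "EC b (\<lambda>C. fexp (level b) (\<lambda>c. F (c # C))) \<le> EC b (\<lambda>C. fexp (level b) (\<lambda>c. G (c # C)))"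
    by (rule Suc.IH, rule fexp_mono, rule Suc.prems) simp
  then show ?case by simp
qed simp

lemma EC_const: "EC b (\<lambda>_. k) = k"
  by (induction b) (simp_all add: fexp_const finite_level)

lemma EC_attained: "\<exists>C. length C = b \<and> F C \<le> EC b F"
proof (induction b arbitrary: F)
  case (Suc b)
  from Suc[of "\<lambda>C. fexp (level b) (\<lambda>c. F (c # C))"] obtain C where
    C: "length C = b" "fexp (level b) (\<lambda>c. F (c # C)) \<le> EC (Suc b) F" by auto
  moreover obtain c where "F (c # C) \<le> fexp (level b) (\<lambda>c. F (c # C))"
    using fexp_attained[OF finite_level, of b "\<lambda>c. F (c # C)"] by blast
  ultimately show ?case by (intro exI[of _ "c # C"]) auto
qed auto

lemma fexp_level:
  "fexp (level b) (\<lambda>c. F (fst c) (snd c)) = fexp (Pi_pmf (nodes b) undefined (\<lambda>_. PU))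
     (\<lambda>u. fexp (Pi_pmf (nodes (Suc b)) undefined (\<lambda>_. PV)) (\<lambda>v. F u v))"
  unfolding level_def fexp_pair by simp

lemma fexp_level_node:
  assumes "h \<in> nodes b" "h' \<in> nodes (Suc b)"
  shows "fexp (level b) (\<lambda>c. F (fst c h) (snd c h')) = fexp PU (\<lambda>u. fexp PV (\<lambda>v. F u v))"
  unfolding fexp_level[of b "\<lambda>u v. F (u h) (v h')"]
  using assms finite_PU finite_PV
  by (simp add: fexp_Pi_pmf_component[where g = "F _"] fexp_Pi_pmf_component[where g = "\<lambda>x. fexp PV (F x)"]
     del: nodes.simps)

section \<open>Failure probability of the quantiser\<close>

definition cover_fail :: real where
  "cover_fail = (\<Sum>s\<in>S. Q s * (1 - fexp PV (\<lambda>v. of_bool (good v s))) ^ K)"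

lemma fexp_good_bounds: "0 \<le> fexp PV (\<lambda>v. of_bool (good v s))" "fexp PV (\<lambda>v. of_bool (good v s)) \<le> 1"
proof -
  have "fexp PV (\<lambda>v. of_bool (good v s)) \<le> fexp PV (\<lambda>v. 1)" by (intro fexp_mono) auto
  then show "fexp PV (\<lambda>v. of_bool (good v s)) \<le> 1" by (simp add: fexp_const finite_PV)
qed (auto intro: fexp_nonneg)

lemma cover_fail_nonneg: "0 \<le> cover_fail"
  unfolding cover_fail_def using fexp_good_bounds
  by (intro sum_nonneg mult_nonneg_nonneg Q_nonneg zero_le_power) auto

text \<open>A one-shot covering lemma. Only candidates with
  \<open>PS v s \<le> \<gamma>' * Q s\<close> are counted. By change of measure their probability is
  at least the joint mass \<open>a s\<close> divided by \<open>\<gamma>' * Q s\<close>, so about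
  \<gamma>' candidates suffice; what \<open>a s\<close> misses is the two atypicality terms.\<close>

lemma cover_fail_le:
  assumes \<gamma>': "0 < \<gamma>'" and PS_sum: "\<And>v. v \<in> set_pmf PV \<Longrightarrow> sum (PS v) S = 1"
  shows "cover_fail \<le> fexp PV (\<lambda>v. \<Sum>s\<in>S. PS v s * of_bool (\<not> good v s))
    + fexp PV (\<lambda>v. \<Sum>s\<in>S. PS v s * of_bool (\<not> PS v s \<le> \<gamma>' * Q s)) + exp (- (K / \<gamma>'))"
proof -
  define a where "a s = fexp PV (\<lambda>v. PS v s * of_bool (good v s \<and> PS v s \<le> \<gamma>' * Q s))" for s
  have "Q s * (1 - fexp PV (\<lambda>v. of_bool (good v s))) ^ K \<le> Q s - a s + Q s * exp (- (K / \<gamma>'))"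
    if s: "s \<in> S" for s
  proof (cases "Q s = 0")
    case True
    have "a s \<le> fexp PV (\<lambda>v. PS v s)"
      unfolding a_def using PS_nonneg[OF s] by (intro fexp_mono) auto
    then show ?thesis using True by (simp add: PS_avg[OF s])
  next
    case False
    then have Q: "0 < Q s" using Q_nonneg[OF s] by simp
    define p where "p = fexp PV (\<lambda>v. of_bool (good v s))"
    have p: "0 \<le> p" "p \<le> 1" using fexp_good_bounds by (auto simp: p_def)
    have a0: "0 \<le> a s" unfolding a_def using PS_nonneg[OF s] by (intro fexp_nonneg) auto
    have aQ: "a s \<le> Q s"
      unfolding a_def PS_avg[OF s, symmetric] using PS_nonneg[OF s] by (intro fexp_mono) auto
    have "a s \<le> fexp PV (\<lambda>v. \<gamma>' * Q s * of_bool (good v s))"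
      unfolding a_def using \<gamma>' Q by (intro fexp_mono) auto
    then have ap: "a s / (\<gamma>' * Q s) \<le> p" using \<gamma>' Q by (simp add: fexp_cmult p_def field_simps)
    define t where "t = a s / Q s"
    have t: "0 \<le> t" "t \<le> 1" using a0 aQ Q by (auto simp: t_def)
    have "(1 - p) ^ K \<le> exp (- p) ^ K"
      using p exp_ge_add_one_self[of "- p"] by (intro power_mono) auto
    also have "\<dots> = exp (- (K * p))" by (simp add: exp_of_nat_mult[symmetric])
    \<comment> \<open>The exponent is written as a point of the segment from 0 to
      \<open>- (K / \<gamma>')\<close>, ready for convexity of exp. The outcome is the familiar (1 -
      xy)^K <= 1 - x + e^{-Ky}.\<close>
    also have "\<dots> \<le> exp ((1 - t) * 0 + t * (- (K / \<gamma>')))"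
      using mult_left_mono[OF ap, of "real K"] \<gamma>' Q by (simp add: t_def field_simps)
    also have "\<dots> \<le> (1 - t) * exp 0 + t * exp (- (K / \<gamma>'))"
      using convex_onD[OF exp_convex, of t 0 "- (real K / \<gamma>')"] t by simp
    also have "\<dots> \<le> 1 - t + exp (- (K / \<gamma>'))"
      using mult_right_mono[OF t(2), of "exp (- (K / \<gamma>'))"] by simp
    finally have "Q s * (1 - p) ^ K \<le> Q s * (1 - t + exp (- (K / \<gamma>')))"
      using Q by (intro mult_left_mono) auto
    also have "\<dots> = Q s - a s + Q s * exp (- (K / \<gamma>'))"
      using Q by (simp add: t_def algebra_simps)
    finally show ?thesis by (simp add: p_def)
  qed
  then have "cover_fail \<le> (\<Sum>s\<in>S. Q s - a s + Q s * exp (- (K / \<gamma>')))"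
    unfolding cover_fail_def by (rule sum_mono)
  also have "\<dots> = 1 - (\<Sum>s\<in>S. a s) + exp (- (K / \<gamma>'))"
    by (simp add: sum.distrib sum_subtractf sum_distrib_right[symmetric] Q_sum)
  also have "1 - (\<Sum>s\<in>S. a s)
      = fexp PV (\<lambda>v. \<Sum>s\<in>S. PS v s * of_bool (\<not> (good v s \<and> PS v s \<le> \<gamma>' * Q s)))"
  proof -
    have "1 = fexp PV (\<lambda>v. sum (PS v) S)"
      using fexp_cong[of PV "\<lambda>v. sum (PS v) S" "\<lambda>_. 1"] PS_sum fexp_const[OF finite_PV, of 1] by simp
    then have "1 - (\<Sum>s\<in>S. a s) = fexp PV (\<lambda>v. sum (PS v) S - (\<Sum>s\<in>S. PS v s * of_bool (good v s \<and> PS v s \<le> \<gamma>' * Q s)))"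
      unfolding a_def fexp_diff fexp_sum[where f = "\<lambda>s v. PS v s * of_bool (_ v s)"] by simp
    also have "\<dots> = fexp PV (\<lambda>v. \<Sum>s\<in>S. PS v s * of_bool (\<not> (good v s \<and> PS v s \<le> \<gamma>' * Q s)))"
      unfolding sum_subtractf[symmetric] by (intro fexp_cong sum.cong) auto
    finally show ?thesis .
  qed
  also have "\<dots> \<le> fexp PV (\<lambda>v. (\<Sum>s\<in>S. PS v s * of_bool (\<not> good v s))
    + (\<Sum>s\<in>S. PS v s * of_bool (\<not> PS v s \<le> \<gamma>' * Q s)))"
    unfolding sum.distrib[symmetric] by (intro fexp_mono sum_mono) (use PS_nonneg in auto)
  finally show ?thesis by (simp add: fexp_add)
qed

primrec hist :: "((nat list \<Rightarrow> 'u) \<times> (nat list \<Rightarrow> 'v)) list \<Rightarrow> nat \<Rightarrow> 's list \<Rightarrow> nat list" where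
  "hist [] m ss = [m]"
| "hist (c # C) m ss = pick (snd c) (hist C m (tl ss)) (hd ss) # hist C m (tl ss)"

lemma last_hist [simp]: "last (hist C m ss) = m"
proof -
  have "hist C m ss \<noteq> [] \<and> last (hist C m ss) = m"
    by (induction C arbitrary: ss) auto
  then show ?thesis ..
qed

text \<open>\<open>C\<close> lists the newest level first, so the level used after the past blocks
  \<open>ss\<close> is found by counting from the oldest end, and the history reads only the
  \<open>length ss\<close> levels below it.\<close>

definition encode :: "((nat list \<Rightarrow> 'u) \<times> (nat list \<Rightarrow> 'v)) list \<Rightarrow> nat \<Rightarrow> 's list \<Rightarrow> 'u" where
  "encode C m ss = fst (rev C ! length ss) (hist (drop (length C - length ss) C) m ss)"

lemma fexp_level_no_good:
  assumes "h \<in> nodes b"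
  shows "fexp (level b) (\<lambda>c. \<Prod>i<K. 1 - of_bool (good (snd c (i # h)) s))
    = (1 - fexp PV (\<lambda>v. of_bool (good v s))) ^ K"
proof -
  have inj: "inj_on (\<lambda>i. i # h) {..<K}" by (auto simp: inj_on_def)
  have sub: "(\<lambda>i. i # h) ` {..<K} \<subseteq> nodes (Suc b)" using assms by auto
  have "fexp (level b) (\<lambda>c. \<Prod>i<K. 1 - of_bool (good (snd c (i # h)) s))
    = fexp (Pi_pmf (nodes (Suc b)) undefined (\<lambda>_. PV)) (\<lambda>v. \<Prod>x\<in>(\<lambda>i. i # h) ` {..<K}. 1 - of_bool (good (v x) s))"
    unfolding fexp_level[of b "\<lambda>u v. \<Prod>i<K. 1 - of_bool (good (v (i # h)) s)"]
    using inj finite_PU by (simp add: prod.reindex fexp_const finite_set_Pi_pmf del: nodes.simps)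
  also have "\<dots> = (\<Prod>x\<in>(\<lambda>i. i # h) ` {..<K}. fexp PV (\<lambda>v. 1 - of_bool (good v s)))"
    by (rule fexp_Pi_pmf_prod_subset[OF _ finite_PV sub]) simp
  also have "\<dots> = (1 - fexp PV (\<lambda>v. of_bool (good v s))) ^ K"
    using inj by (simp add: fexp_diff fexp_const finite_PV card_image)
  finally show ?thesis .
qed

end

section \<open>Output laws of a tree code and their truncation\<close>

locale tree_channel = tree_code PU PV Q S PS K M \<gamma>
  for PU :: "'u pmf" and PV :: "'v pmf" and Q :: "'s \<Rightarrow> real" and S PS K M \<gamma> +
  fixes OS :: "'o set" and Wo :: "'u \<Rightarrow> 's \<Rightarrow> 'o \<Rightarrow> real"
  assumes finite_O: "finite OS"
    and Wo_nonneg: "s \<in> S \<Longrightarrow> x \<in> OS \<Longrightarrow> 0 \<le> Wo u s x"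
    and Wo_sum: "s \<in> S \<Longrightarrow> (\<Sum>x\<in>OS. Wo u s x) = 1"
begin

definition out :: "'u \<Rightarrow> 'o \<Rightarrow> real" where
  "out u x = (\<Sum>s\<in>S. Q s * Wo u s x)"

definition outV :: "'u \<Rightarrow> 'v \<Rightarrow> 'o \<Rightarrow> real" where
  "outV u v x = (\<Sum>s\<in>S. PS v s * Wo u s x)"

definition Qo :: "'o \<Rightarrow> real" where
  "Qo x = fexp PU (\<lambda>u. out u x)"

lemma out_nonneg: "x \<in> OS \<Longrightarrow> 0 \<le> out u x"
  unfolding out_def by (intro sum_nonneg mult_nonneg_nonneg Q_nonneg Wo_nonneg)

lemma outV_nonneg: "x \<in> OS \<Longrightarrow> 0 \<le> outV u v x"
  unfolding outV_def by (intro sum_nonneg mult_nonneg_nonneg PS_nonneg Wo_nonneg)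

lemma sum_out: "(\<Sum>x\<in>OS. out u x) = 1"
proof -
  have "(\<Sum>x\<in>OS. out u x) = (\<Sum>s\<in>S. Q s * (\<Sum>x\<in>OS. Wo u s x))"
    unfolding out_def sum_distrib_left by (rule sum.swap)
  then show ?thesis by (simp add: Wo_sum Q_sum)
qed

lemma Qo_nonneg: "x \<in> OS \<Longrightarrow> 0 \<le> Qo x"
  unfolding Qo_def by (intro fexp_nonneg out_nonneg)

lemma sum_Qo: "(\<Sum>x\<in>OS. Qo x) = 1"
  unfolding Qo_def fexp_sum[symmetric] by (simp add: sum_out fexp_const finite_PU)

lemma fexp_outV: "fexp PV (\<lambda>v. outV u v x) = out u x"
  unfolding outV_def out_def fexp_sum fexp_multc by (simp add: PS_avg)

definition step :: "(nat list \<Rightarrow> 'u) \<times> (nat list \<Rightarrow> 'v) \<Rightarrow> nat list \<Rightarrow> nat \<Rightarrow> 'o \<Rightarrow> real" where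
  "step c h i x = (\<Sum>s\<in>S. Q s * Wo (fst c h) s x * of_bool (pick (snd c) h s = i))"

text \<open>The test \<open>T\<close> stays a parameter because the two receivers need opposite
  tails of the information density: a lower bound for decoding, an upper bound for
  covertness.\<close>

definition gstep :: "('u \<Rightarrow> 'v \<Rightarrow> 'o \<Rightarrow> bool) \<Rightarrow> (nat list \<Rightarrow> 'u) \<times> (nat list \<Rightarrow> 'v) \<Rightarrow> nat list \<Rightarrow> nat \<Rightarrow> 'o \<Rightarrow> real" where
  "gstep T c h i x = (\<Sum>s\<in>S. Q s * Wo (fst c h) s x *
      of_bool (pick (snd c) h s = i \<and> good (snd c (i # h)) s \<and> T (fst c h) (snd c (i # h)) x))"

lemma gstep_nonneg: "x \<in> OS \<Longrightarrow> 0 \<le> gstep T c h i x"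
  unfolding gstep_def by (intro sum_nonneg mult_nonneg_nonneg Q_nonneg Wo_nonneg) auto

lemma gstep_le_step: "x \<in> OS \<Longrightarrow> gstep T c h i x \<le> step c h i x"
  unfolding gstep_def step_def
  by (intro sum_mono mult_left_mono mult_nonneg_nonneg Q_nonneg Wo_nonneg) auto

lemma sum_step: "(\<Sum>i<K. step c h i x) = out (fst c h) x"
proof -
  have "(\<Sum>i<K. step c h i x)
     = (\<Sum>s\<in>S. Q s * Wo (fst c h) s x * (\<Sum>i<K. of_bool (pick (snd c) h s = i)))"
    unfolding step_def sum_distrib_left by (rule sum.swap)
  also have "\<dots> = out (fst c h) x"
    unfolding out_def by (intro sum.cong) (auto simp: of_bool_def pick_less)
  finally show ?thesis .
qed

lemma sum_step_out: "(\<Sum>i<K. \<Sum>x\<in>OS. step c h i x) = 1"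
  by (subst sum.swap) (simp add: sum_step sum_out)

lemma gstep_le:
  assumes x: "x \<in> OS" and T: "\<And>u v. T u v x \<Longrightarrow> outV u v x \<le> B" and B: "0 \<le> B"
  shows "gstep T c h i x \<le> B / \<gamma>"
proof (cases "T (fst c h) (snd c (i # h)) x")
  case True
  have "gstep T c h i x \<le> (\<Sum>s\<in>S. PS (snd c (i # h)) s / \<gamma> * Wo (fst c h) s x)"
    unfolding gstep_def
  proof (rule sum_mono)
    fix s assume s: "s \<in> S"
    have "Q s * of_bool (good (snd c (i # h)) s) \<le> PS (snd c (i # h)) s / \<gamma>"
      using \<gamma>_pos PS_nonneg[OF s] by (auto simp: good_def field_simps)
    from mult_right_mono[OF this Wo_nonneg[OF s x, of "fst c h"]]
    show "Q s * Wo (fst c h) s x * of_bool (pick (snd c) h s = i \<and> good (snd c (i # h)) s \<and> T (fst c h) (snd c (i # h)) x)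
       \<le> PS (snd c (i # h)) s / \<gamma> * Wo (fst c h) s x"
      using Q_nonneg[OF s] Wo_nonneg[OF s x, of "fst c h"] PS_nonneg[OF s] \<gamma>_pos
      by (cases "good (snd c (i # h)) s"; cases "pick (snd c) h s = i") (auto simp: True)
  qed
  also have "\<dots> = outV (fst c h) (snd c (i # h)) x / \<gamma>"
    by (simp add: outV_def sum_divide_distrib)
  also have "\<dots> \<le> B / \<gamma>" using T[OF True] \<gamma>_pos by (simp add: divide_right_mono)
  finally show ?thesis .
qed (use B \<gamma>_pos in \<open>simp add: gstep_def\<close>)

text \<open>The joint law of history and outputs for a fixed codebook, with the states already
  summed out in \<open>step\<close> and a uniform message at the root.\<close>

primrec A :: "((nat list \<Rightarrow> 'u) \<times> (nat list \<Rightarrow> 'v)) list \<Rightarrow> nat list \<Rightarrow> 'o list \<Rightarrow> real" where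
  "A [] h xs = 1 / M"
| "A (c # C) h xs = A C (tl h) (tl xs) * step c (tl h) (hd h) (hd xs)"

primrec G :: "('u \<Rightarrow> 'v \<Rightarrow> 'o \<Rightarrow> bool) \<Rightarrow> ((nat list \<Rightarrow> 'u) \<times> (nat list \<Rightarrow> 'v)) list \<Rightarrow> nat list \<Rightarrow> 'o list \<Rightarrow> real" where
  "G T [] h xs = 1 / M"
| "G T (c # C) h xs = G T C (tl h) (tl xs) * gstep T c (tl h) (hd h) (hd xs)"

lemma G_bounds:
  assumes "xs \<in> seqs (length C) OS"
  shows "0 \<le> G T C h xs \<and> G T C h xs \<le> A C h xs"
  using assms
proof (induction C arbitrary: h xs)
  case (Cons c C)
  then obtain y ys where xs: "xs = y # ys" "y \<in> OS" "ys \<in> seqs (length C) OS"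
    by (auto simp: seqs_Suc)
  then show ?case using Cons.IH[OF xs(3), of "tl h"] gstep_nonneg[of y T c] gstep_le_step[of y T c]
    by (auto intro!: mult_mono)
qed simp

lemmas G_nonneg = G_bounds[THEN conjunct1]
lemmas G_le_A = G_bounds[THEN conjunct2]

lemma A_nonneg: "xs \<in> seqs (length C) OS \<Longrightarrow> 0 \<le> A C h xs"
  using G_bounds order_trans by blast

lemma sum_A:
  assumes "length C = b"
  shows "(\<Sum>h\<in>nodes b. \<Sum>xs\<in>seqs b OS. A C h xs) = 1"
  using assms
proof (induction C arbitrary: b)
  case Nil
  then show ?case using M_pos by (simp add: card_nodes del: nodes.simps)
next
  case (Cons c C)
  have "(\<Sum>i<K. \<Sum>xs\<in>seqs (length C) OS. \<Sum>x\<in>OS. A C h xs * step c h i x)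
     = (\<Sum>xs\<in>seqs (length C) OS. A C h xs * (\<Sum>i<K. \<Sum>x\<in>OS. step c h i x))" for h
    unfolding sum_distrib_left by (rule sum.swap)
  then show ?case using Cons
    by (auto simp: sum_nodes_Suc sum_seqs_Suc sum_step_out simp del: nodes.simps)
qed

section \<open>Mass lost by the truncation\<close>

definition bad :: "('u \<Rightarrow> 'v \<Rightarrow> 'o \<Rightarrow> bool) \<Rightarrow> nat \<Rightarrow> ((nat list \<Rightarrow> 'u) \<times> (nat list \<Rightarrow> 'v)) list \<Rightarrow> real" where
  "bad T b C = (\<Sum>h\<in>nodes b. \<Sum>xs\<in>seqs b OS. A C h xs - G T C h xs)"

lemma sum_G_le_1:
  assumes "length C = b"
  shows "(\<Sum>h\<in>nodes b. \<Sum>xs\<in>seqs b OS. G T C h xs) \<le> 1"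
  unfolding sum_A[OF assms, symmetric] using assms by (intro sum_mono G_le_A) auto

text \<open>\<open>step\<close> has total mass one, so the old loss is carried over unchanged and
  the new loss is incurred only by the surviving weight \<open>G\<close>.\<close>

lemma bad_Suc:
  assumes "length C = b"
  shows "bad T (Suc b) (c # C) = bad T b C + (\<Sum>h\<in>nodes b. \<Sum>xs\<in>seqs b OS.
      G T C h xs * (1 - (\<Sum>i<K. \<Sum>x\<in>OS. gstep T c h i x)))"
proof -
  have *: "(\<Sum>i<K. \<Sum>xs\<in>seqs b OS. \<Sum>x\<in>OS. f xs * g i x)
     = (\<Sum>xs\<in>seqs b OS. f xs * (\<Sum>i<K. \<Sum>x\<in>OS. g i x))" for f and g :: "nat \<Rightarrow> 'o \<Rightarrow> real"
    unfolding sum_distrib_left by (rule sum.swap)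
  show ?thesis
    by (simp add: bad_def sum_nodes_Suc sum_seqs_Suc sum_subtractf * sum_step_out algebra_simps
        sum.distrib del: nodes.simps)
qed

text \<open>\<open>G\<close> depends on older levels only, so averaging the newest level acts on the
  one-step loss alone. The total mass of \<open>G\<close> is at most one, so every block adds at
  most \<beta>.\<close>

lemma EC_bad:
  assumes \<beta>: "0 \<le> \<beta>"
    and step: "\<And>b h. h \<in> nodes b \<Longrightarrow>
      fexp (level b) (\<lambda>c. 1 - (\<Sum>i<K. \<Sum>x\<in>OS. gstep T c h i x)) \<le> \<beta>"
  shows "EC b (bad T b) \<le> b * \<beta>"
proof (induction b)
  case 0
  then show ?case by (simp add: bad_def)
next
  case (Suc b)
  have "EC (Suc b) (bad T (Suc b)) \<le> EC b (\<lambda>C. bad T b C + \<beta>)"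
    unfolding EC.simps
  proof (rule EC_mono)
    fix C :: "((nat list \<Rightarrow> 'u) \<times> (nat list \<Rightarrow> 'v)) list" assume C: "length C = b"
    have "fexp (level b) (\<lambda>c. bad T (Suc b) (c # C)) = bad T b C + (\<Sum>h\<in>nodes b. \<Sum>xs\<in>seqs b OS.
      G T C h xs * fexp (level b) (\<lambda>c. 1 - (\<Sum>i<K. \<Sum>x\<in>OS. gstep T c h i x)))"
      unfolding bad_Suc[OF C] fexp_add fexp_sum fexp_cmult by (simp add: fexp_const finite_level)
    also have "\<dots> \<le> bad T b C + (\<Sum>h\<in>nodes b. \<Sum>xs\<in>seqs b OS. G T C h xs * \<beta>)"
      using C by (intro add_left_mono sum_mono mult_left_mono step G_nonneg) auto
    also have "\<dots> \<le> bad T b C + \<beta>"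
      using mult_right_mono[OF sum_G_le_1[OF C, of T] \<beta>] by (simp add: sum_distrib_right)
    finally show "fexp (level b) (\<lambda>c. bad T (Suc b) (c # C)) \<le> bad T b C + \<beta>" .
  qed
  also have "\<dots> \<le> Suc b * \<beta>"
    using Suc by (simp add: EC_add EC_const algebra_simps)
  finally show ?case .
qed

text \<open>Measured under the ideal law in which \<open>u\<close> and \<open>v\<close> are
  independent and the state follows \<open>PS v\<close>, not under the law of the code. The passage
  between the two costs the factor \<open>K / \<gamma>\<close>.\<close>

definition atypical :: "('u \<Rightarrow> 'v \<Rightarrow> 'o \<Rightarrow> bool) \<Rightarrow> real" where
  "atypical T = fexp PU (\<lambda>u. fexp PV (\<lambda>v. \<Sum>x\<in>OS. outV u v x * of_bool (\<not> T u v x)))"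

text \<open>Mass is lost either because no candidate is good or because the picked good candidate
  gives an atypical output. In the second case the picked term is bounded by the sum over all
  \<open>K\<close> candidates, and goodness replaces \<open>Q\<close> by
  \<open>PS / \<gamma>\<close>. Neither summand mentions \<open>pick\<close> any more, so both have
  computable expectations.\<close>

lemma one_minus_gstep_le:
  "1 - (\<Sum>i<K. \<Sum>x\<in>OS. gstep T c h i x)
    \<le> (\<Sum>s\<in>S. Q s * (\<Prod>i<K. 1 - of_bool (good (snd c (i # h)) s)))
      + (\<Sum>i<K. \<Sum>x\<in>OS. outV (fst c h) (snd c (i # h)) x * of_bool (\<not> T (fst c h) (snd c (i # h)) x)) / \<gamma>"
proof -
  define u where "u = fst c h"
  define v where "v i = snd c (i # h)" for i
  define r where "r i s = (\<Sum>x\<in>OS. Wo u s x * of_bool (good (v i) s \<and> T u (v i) x))" for i s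
  have "(\<Sum>i<K. \<Sum>x\<in>OS. gstep T c h i x)
      = (\<Sum>i<K. \<Sum>s\<in>S. of_bool (pick (snd c) h s = i) * (Q s * r i s))"
    unfolding gstep_def r_def u_def v_def sum_distrib_left
    by (intro sum.cong refl, subst sum.swap) (auto intro!: sum.cong)
  also have "\<dots> = (\<Sum>s\<in>S. Q s * r (pick (snd c) h s) s)"
    by (subst sum.swap) (auto intro!: sum.cong simp: of_bool_def pick_less if_distrib[of "\<lambda>x. x * _"] sum.delta cong: if_cong)
  finally have "1 - (\<Sum>i<K. \<Sum>x\<in>OS. gstep T c h i x) = (\<Sum>s\<in>S. Q s * (1 - r (pick (snd c) h s) s))"
    by (simp add: algebra_simps sum_subtractf Q_sum)
  also have "\<dots> \<le> (\<Sum>s\<in>S. Q s * ((\<Prod>i<K. 1 - of_bool (good (v i) s))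
      + (\<Sum>i<K. \<Sum>x\<in>OS. Wo u s x * of_bool (good (v i) s \<and> \<not> T u (v i) x))))"
  proof (intro sum_mono mult_left_mono Q_nonneg)
    fix s assume s: "s \<in> S"
    have nn: "0 \<le> (\<Sum>x\<in>OS. Wo u s x * of_bool (good (v i) s \<and> \<not> T u (v i) x))" for i
      by (intro sum_nonneg mult_nonneg_nonneg Wo_nonneg s) auto
    have r0: "0 \<le> r i s" for i
      unfolding r_def by (intro sum_nonneg mult_nonneg_nonneg Wo_nonneg s) auto
    show "1 - r (pick (snd c) h s) s \<le> (\<Prod>i<K. 1 - of_bool (good (v i) s))
      + (\<Sum>i<K. \<Sum>x\<in>OS. Wo u s x * of_bool (good (v i) s \<and> \<not> T u (v i) x))"
    proof (cases "\<exists>i<K. good (v i) s")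
      case False
      then have "(\<Prod>i<K. 1 - of_bool (good (v i) s)) = (1::real)" by (intro prod.neutral) auto
      then show ?thesis using r0 nn
        by (smt (verit) sum_nonneg)
    next
      case True
      define j where "j = pick (snd c) h s"
      have j: "j < K" "good (v j) s" using True good_pick pick_less by (auto simp: j_def v_def)
      have "1 - r j s = (\<Sum>x\<in>OS. Wo u s x * of_bool (good (v j) s \<and> \<not> T u (v j) x))"
        unfolding r_def Wo_sum[OF s, of u, symmetric] sum_subtractf[symmetric]
        by (intro sum.cong) (auto simp: j)
      also have "\<dots> \<le> (\<Sum>i<K. \<Sum>x\<in>OS. Wo u s x * of_bool (good (v i) s \<and> \<not> T u (v i) x))"
        using j nn by (intro member_le_sum) auto
      finally have "1 - r j s \<le> (\<Sum>i<K. \<Sum>x\<in>OS. Wo u s x * of_bool (good (v i) s \<and> \<not> T u (v i) x))" .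
      moreover have "0 \<le> (\<Prod>i<K. 1 - of_bool (good (v i) s) :: real)" by (intro prod_nonneg) auto
      ultimately show ?thesis by (simp add: j_def)
    qed
  qed
  also have "\<dots> = (\<Sum>s\<in>S. Q s * (\<Prod>i<K. 1 - of_bool (good (v i) s)))
      + (\<Sum>s\<in>S. \<Sum>i<K. \<Sum>x\<in>OS. Q s * (Wo u s x * of_bool (good (v i) s \<and> \<not> T u (v i) x)))"
    by (simp add: distrib_left sum.distrib sum_distrib_left)
  also have "(\<Sum>s\<in>S. \<Sum>i<K. \<Sum>x\<in>OS. Q s * (Wo u s x * of_bool (good (v i) s \<and> \<not> T u (v i) x)))
     \<le> (\<Sum>s\<in>S. \<Sum>i<K. \<Sum>x\<in>OS. PS (v i) s / \<gamma> * (Wo u s x * of_bool (\<not> T u (v i) x)))"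
  proof (intro sum_mono)
    fix s i x assume s: "s \<in> S" and x: "x \<in> OS"
    have "Q s \<le> PS (v i) s / \<gamma>" if "good (v i) s"
      using that \<gamma>_pos by (auto simp: good_def field_simps)
    then show "Q s * (Wo u s x * of_bool (good (v i) s \<and> \<not> T u (v i) x))
      \<le> PS (v i) s / \<gamma> * (Wo u s x * of_bool (\<not> T u (v i) x))"
      using Wo_nonneg[OF s x, of u] PS_nonneg[OF s, of "v i"] \<gamma>_pos
        mult_right_mono[of "Q s" "PS (v i) s / \<gamma>" "Wo u s x"]
      by (cases "good (v i) s"; cases "T u (v i) x") auto
  qed
  also have "\<dots> = (\<Sum>i<K. \<Sum>s\<in>S. \<Sum>x\<in>OS. PS (v i) s / \<gamma> * (Wo u s x * of_bool (\<not> T u (v i) x)))"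
    by (rule sum.swap)
  also have "\<dots> = (\<Sum>i<K. \<Sum>x\<in>OS. outV u (v i) x * of_bool (\<not> T u (v i) x)) / \<gamma>"
    unfolding outV_def sum_divide_distrib sum_distrib_right
    by (intro sum.cong refl, subst sum.swap) (auto intro!: sum.cong)
  finally show ?thesis by (simp add: u_def v_def)
qed

text \<open>Each single candidate, seen with the codeword at its parent, has exactly the law
  \<open>PU\<close> times \<open>PV\<close>; hence each of the \<open>K\<close> union-bound terms
  averages to \<open>atypical T\<close>.\<close>

lemma fexp_one_minus_gstep:
  assumes h: "h \<in> nodes b"
  shows "fexp (level b) (\<lambda>c. 1 - (\<Sum>i<K. \<Sum>x\<in>OS. gstep T c h i x)) \<le> cover_fail + K / \<gamma> * atypical T"
proof -
  have "fexp (level b) (\<lambda>c. 1 - (\<Sum>i<K. \<Sum>x\<in>OS. gstep T c h i x))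
    \<le> fexp (level b) (\<lambda>c. (\<Sum>s\<in>S. Q s * (\<Prod>i<K. 1 - of_bool (good (snd c (i # h)) s)))
      + (\<Sum>i<K. \<Sum>x\<in>OS. outV (fst c h) (snd c (i # h)) x * of_bool (\<not> T (fst c h) (snd c (i # h)) x)) / \<gamma>)"
    by (intro fexp_mono one_minus_gstep_le)
  also have "\<dots> = cover_fail + (\<Sum>i<K. fexp (level b) (\<lambda>c. \<Sum>x\<in>OS. outV (fst c h) (snd c (i # h)) x * of_bool (\<not> T (fst c h) (snd c (i # h)) x))) / \<gamma>"
    unfolding fexp_add fexp_divide fexp_sum[where I = S] fexp_sum[where I = "{..<K}"] fexp_cmult fexp_level_no_good[OF h] cover_fail_def ..
  also have "(\<Sum>i<K. fexp (level b) (\<lambda>c. \<Sum>x\<in>OS. outV (fst c h) (snd c (i # h)) x * of_bool (\<not> T (fst c h) (snd c (i # h)) x)))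
      = (\<Sum>i<K. atypical T)"
    using h unfolding atypical_def
    by (intro sum.cong refl fexp_level_node[where F = "\<lambda>u v. \<Sum>x\<in>OS. outV u v x * of_bool (\<not> T u v x)"]) auto
  finally show ?thesis by simp
qed

lemma atypical_nonneg: "0 \<le> atypical T"
  unfolding atypical_def by (intro fexp_nonneg sum_nonneg mult_nonneg_nonneg outV_nonneg) auto

lemma EC_bad_le: "EC b (bad T b) \<le> b * (cover_fail + K / \<gamma> * atypical T)"
  using cover_fail_nonneg atypical_nonneg[of T] \<gamma>_pos
  by (intro EC_bad fexp_one_minus_gstep) auto

section \<open>Covertness: L1 deviation of the output law from its target\<close>

definition dev :: "nat \<Rightarrow> ((nat list \<Rightarrow> 'u) \<times> (nat list \<Rightarrow> 'v)) list \<Rightarrow> real" where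
  "dev b C = (\<Sum>xs\<in>seqs b OS. \<bar>(\<Sum>h\<in>nodes b. A C h xs) - prod_list (map Qo xs)\<bar>)"

text \<open>Summing out the newest index turns \<open>step\<close> into \<open>out\<close>, so the
  newest \<open>V\<close> candidates disappear. The error then splits into the old deviation, the
  truncated mass (counted twice, against \<open>out\<close> and against \<open>Qo\<close>), and a
  sum with weights \<open>G\<close> whose terms are centred in the fresh \<open>U\<close>
  codewords.\<close>

lemma dev_Suc:
  assumes C: "length C = b"
  shows "dev (Suc b) (c # C) \<le> dev b C + 2 * bad T b C
    + (\<Sum>xs\<in>seqs b OS. \<Sum>x\<in>OS. \<bar>\<Sum>h\<in>nodes b. G T C h xs * (out (fst c h) x - Qo x)\<bar>)"
proof -
  let ?D = "\<lambda>xs. (\<Sum>h\<in>nodes b. A C h xs) - prod_list (map Qo xs)"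
  let ?B = "\<lambda>xs x. \<Sum>h\<in>nodes b. (A C h xs - G T C h xs) * (out (fst c h) x - Qo x)"
  let ?G = "\<lambda>xs x. \<Sum>h\<in>nodes b. G T C h xs * (out (fst c h) x - Qo x)"
  let ?B' = "\<lambda>xs x. \<Sum>h\<in>nodes b. (A C h xs - G T C h xs) * (out (fst c h) x + Qo x)"
  have "dev (Suc b) (c # C) = (\<Sum>xs\<in>seqs b OS. \<Sum>x\<in>OS. \<bar>?D xs * Qo x + ?B xs x + ?G xs x\<bar>)"
    unfolding dev_def sum_seqs_Suc sum_nodes_Suc
    by (intro sum.cong refl arg_cong[where f = abs])
      (simp add: sum_distrib_left[symmetric] sum_step algebra_simps sum.distrib sum_subtractf
        sum_distrib_right)
  also have "\<dots> \<le> (\<Sum>xs\<in>seqs b OS. \<Sum>x\<in>OS. \<bar>?D xs\<bar> * Qo x + ?B' xs x + \<bar>?G xs x\<bar>)"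
  proof (intro sum_mono)
    fix xs x assume xs: "xs \<in> seqs b OS" and x: "x \<in> OS"
    have "\<bar>?B xs x\<bar> \<le> ?B' xs x"
      using G_le_A[of xs C T] xs C out_nonneg[OF x] Qo_nonneg[OF x]
      by (intro order.trans[OF sum_abs] sum_mono) (auto simp: abs_mult abs_le_iff intro!: mult_left_mono)
    moreover have "\<bar>?D xs * Qo x\<bar> = \<bar>?D xs\<bar> * Qo x" using Qo_nonneg[OF x] by (simp add: abs_mult)
    ultimately show "\<bar>?D xs * Qo x + ?B xs x + ?G xs x\<bar> \<le> \<bar>?D xs\<bar> * Qo x + ?B' xs x + \<bar>?G xs x\<bar>" by linarith
  qed
  also have "\<dots> = dev b C + (\<Sum>xs\<in>seqs b OS. \<Sum>x\<in>OS. ?B' xs x) + (\<Sum>xs\<in>seqs b OS. \<Sum>x\<in>OS. \<bar>?G xs x\<bar>)"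
    by (simp add: sum.distrib sum_distrib_left[symmetric] sum_Qo dev_def)
  also have "(\<Sum>xs\<in>seqs b OS. \<Sum>x\<in>OS. ?B' xs x)
     = (\<Sum>xs\<in>seqs b OS. \<Sum>h\<in>nodes b. (A C h xs - G T C h xs) * (\<Sum>x\<in>OS. out (fst c h) x + Qo x))"
    unfolding sum_distrib_left by (intro sum.cong refl sum.swap)
  also have "\<dots> = 2 * bad T b C"
    unfolding bad_def by (simp add: sum.distrib sum_out sum_Qo sum_distrib_left mult.commute) (rule sum.swap)
  finally show ?thesis .
qed

text \<open>A min-entropy bound: relative to the target output law, no history has truncated weight
  above this value. Per block, \<eta> is the information its output may reveal, and 1/\<gamma> is
  the uncertainty that the new index adds.\<close>

lemma G_le:
  assumes T: "\<And>u v x. x \<in> OS \<Longrightarrow> T u v x \<Longrightarrow> outV u v x \<le> \<eta> * Qo x" and \<eta>: "0 \<le> \<eta>"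
    and xs: "xs \<in> seqs (length C) OS"
  shows "G T C h xs \<le> (\<eta> / \<gamma>) ^ length C / M * prod_list (map Qo xs)"
  using xs
proof (induction C arbitrary: h xs)
  case (Cons c C)
  then obtain y ys where xs: "xs = y # ys" "y \<in> OS" "ys \<in> seqs (length C) OS"
    by (auto simp: seqs_Suc)
  have "gstep T c (tl h) (hd h) y \<le> \<eta> * Qo y / \<gamma>"
    using T \<eta> xs(2) Qo_nonneg[OF xs(2)] by (intro gstep_le) auto
  then have "G T C (tl h) ys * gstep T c (tl h) (hd h) y
     \<le> ((\<eta> / \<gamma>) ^ length C / M * prod_list (map Qo ys)) * (\<eta> * Qo y / \<gamma>)"
    using Cons.IH[OF xs(3), of "tl h"] gstep_nonneg[OF xs(2)] order.trans[OF G_nonneg[OF xs(3)] Cons.IH[OF xs(3)]]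
    by (intro mult_mono) auto
  then show ?case by (simp add: xs(1) field_simps)
qed (use M_pos in simp)

lemma abs_le_am_gm: "0 < (a::real) \<Longrightarrow> \<bar>x\<bar> \<le> (a + x\<^sup>2 / a) / 2"
proof -
  assume a: "0 < a"
  have "0 \<le> (\<bar>x\<bar> - a)\<^sup>2" by simp
  then show ?thesis using a by (simp add: field_simps power2_eq_square abs_mult_self_eq)
qed

lemma prod_Qo_pos: "(\<And>x. x \<in> OS \<Longrightarrow> 0 < Qo x) \<Longrightarrow> xs \<in> seqs b OS \<Longrightarrow> 0 < prod_list (map Qo xs)"
  by (induction xs arbitrary: b) (auto simp: seqs_def)

lemma sum_prod_Qo: "(\<Sum>xs\<in>seqs b OS. prod_list (map Qo xs)) = 1"
  by (induction b) (simp_all add: sum_seqs_Suc sum_distrib_right[symmetric] sum_Qo)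

text \<open>Soft covering by second moments, one block at a time. The fresh codewords are
  independent of the weights \<open>G\<close>, so the variance of the centred sum is governed by the
  largest weight, which \<open>G_le\<close> bounds; the hypothesis on \<open>D\<close> makes it
  small relative to \<theta>.\<close>

lemma EC_dev:
  assumes D: "\<And>u x. x \<in> OS \<Longrightarrow> out u x \<le> D * Qo x"
    and T: "\<And>u v x. x \<in> OS \<Longrightarrow> T u v x \<Longrightarrow> outV u v x \<le> \<eta> * Qo x"
    and \<eta>: "0 \<le> \<eta>" and D0: "0 \<le> D" and \<theta>: "0 < \<theta>"
    and pos: "\<And>x. x \<in> OS \<Longrightarrow> 0 < Qo x"
    and \<kappa>: "\<And>j. j < b \<Longrightarrow> D * ((\<eta> / \<gamma>) ^ j / M) \<le> \<theta>\<^sup>2"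
    and \<beta>: "\<And>j. j < b \<Longrightarrow> EC j (bad T j) \<le> \<beta>"
  shows "EC b (dev b) \<le> b * (2 * \<beta> + \<theta>)"
  using \<kappa> \<beta>
proof (induction b)
  case 0
  then show ?case using M_pos by (simp add: dev_def sum_nodes_0 del: nodes.simps)
next
  case (Suc b)
  define \<kappa> where "\<kappa> = (\<eta> / \<gamma>) ^ b / M"
  have \<kappa>: "D * \<kappa> \<le> \<theta>\<^sup>2" using Suc.prems(1)[of b] by (simp add: \<kappa>_def)
  have \<kappa>0: "0 \<le> \<kappa>" using \<eta> \<gamma>_pos by (simp add: \<kappa>_def)
  have "EC (Suc b) (dev (Suc b)) \<le> EC b (\<lambda>C. dev b C + (2 * bad T b C + \<theta>))"
    unfolding EC.simps
  proof (rule EC_mono)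
    fix C :: "((nat list \<Rightarrow> 'u) \<times> (nat list \<Rightarrow> 'v)) list" assume C: "length C = b"
    have main: "fexp (level b) (\<lambda>c. \<bar>\<Sum>h\<in>nodes b. G T C h xs * (out (fst c h) x - Qo x)\<bar>)
       \<le> (\<theta> * (prod_list (map Qo xs) * Qo x) + \<theta> * ((\<Sum>h\<in>nodes b. G T C h xs) * Qo x)) / 2"
      if xs: "xs \<in> seqs b OS" and x: "x \<in> OS" for xs x
    proof -
      let ?q = "prod_list (map Qo xs)"
      have q: "0 < ?q" using prod_Qo_pos[OF pos xs] .
      \<comment> \<open>The scale in |x| <= (a + x^2/a)/2 is \<theta> times the target probability.
        Both halves then sum over all outputs to at most \<theta>/2, the second because
        \<open>G\<close> has mass at most one.\<close>
      define a where "a = \<theta> * (?q * Qo x)"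
      have a: "0 < a" using \<theta> q pos[OF x] by (simp add: a_def)
      \<comment> \<open>One factor of \<open>out\<close> squared is bounded by
        \<open>D * Qo x\<close>; averaging the other over \<open>u\<close> gives
        \<open>Qo x\<close>.\<close>
      have var: "fexp PU (\<lambda>u. (out u x - Qo x)\<^sup>2) \<le> D * (Qo x)\<^sup>2"
      proof -
        have "(out u x - Qo x)\<^sup>2 \<le> (D * Qo x) * out u x + (Qo x)\<^sup>2 - 2 * Qo x * out u x" for u
          using mult_right_mono[OF D[OF x] out_nonneg[OF x], of u u] by (simp add: power2_eq_square algebra_simps)
        then have "fexp PU (\<lambda>u. (out u x - Qo x)\<^sup>2)
          \<le> fexp PU (\<lambda>u. (D * Qo x) * out u x + (Qo x)\<^sup>2 - 2 * Qo x * out u x)"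
          by (intro fexp_mono)
        also have "\<dots> = D * (Qo x)\<^sup>2 - (Qo x)\<^sup>2"
          unfolding fexp_diff fexp_add fexp_cmult Qo_def[symmetric]
          by (simp add: fexp_const finite_PU power2_eq_square)
        finally show ?thesis using zero_le_power2[of "Qo x"] by linarith
      qed
      have "fexp (level b) (\<lambda>c. \<bar>\<Sum>h\<in>nodes b. G T C h xs * (out (fst c h) x - Qo x)\<bar>)
        \<le> fexp (level b) (\<lambda>c. a / 2 + (1 / (2 * a)) * (\<Sum>h\<in>nodes b. G T C h xs * (out (fst c h) x - Qo x))\<^sup>2)"
        by (intro fexp_mono order.trans[OF abs_le_am_gm[OF a]]) (simp add: field_simps)
      also have "\<dots> = a / 2 + (1 / (2 * a)) * fexp (level b) (\<lambda>c. (\<Sum>h\<in>nodes b. G T C h xs * (out (fst c h) x - Qo x))\<^sup>2)"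
        unfolding fexp_add fexp_cmult by (simp add: fexp_const finite_level)
      also have "fexp (level b) (\<lambda>c. (\<Sum>h\<in>nodes b. G T C h xs * (out (fst c h) x - Qo x))\<^sup>2)
         = (\<Sum>h\<in>nodes b. (G T C h xs)\<^sup>2 * fexp PU (\<lambda>u. (out u x - Qo x)\<^sup>2))"
        unfolding fexp_level[of b "\<lambda>u v. (\<Sum>h\<in>nodes b. G T C h xs * (out (u h) x - Qo x))\<^sup>2"]
        using finite_PU finite_PV
        by (simp add: fexp_const finite_set_Pi_pmf del: nodes.simps)
           (rule fexp_weighted_square, auto simp: fexp_diff fexp_const Qo_def)
      \<comment> \<open>Only one factor of the squared weight is bounded by its maximum. The other
        is kept, since its sum over all histories and outputs is at most one.\<close>
      also have "\<dots> \<le> (\<Sum>h\<in>nodes b. (\<kappa> * ?q * G T C h xs) * (D * (Qo x)\<^sup>2))"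
      proof (intro sum_mono mult_mono var)
        fix h
        have "G T C h xs \<le> \<kappa> * ?q" using G_le[where C = C and xs = xs and h = h and T = T, OF T \<eta>] xs C by (simp add: \<kappa>_def)
        moreover have g0: "0 \<le> G T C h xs" using G_nonneg xs C by auto
        ultimately show "(G T C h xs)\<^sup>2 \<le> \<kappa> * ?q * G T C h xs"
          unfolding power2_eq_square by (rule mult_right_mono)
        show "0 \<le> \<kappa> * ?q * G T C h xs" using \<kappa>0 q g0 by simp
        show "0 \<le> fexp PU (\<lambda>u. (out u x - Qo x)\<^sup>2)" by (intro fexp_nonneg) simp
      qed
      also have "\<dots> = (D * \<kappa>) * (?q * (Qo x)\<^sup>2 * (\<Sum>h\<in>nodes b. G T C h xs))"
        by (simp add: sum_distrib_left algebra_simps)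
      also have "\<dots> \<le> \<theta>\<^sup>2 * (?q * (Qo x)\<^sup>2 * (\<Sum>h\<in>nodes b. G T C h xs))"
        using \<kappa> q xs C by (intro mult_right_mono mult_nonneg_nonneg sum_nonneg G_nonneg) auto
      also have "a / 2 + 1 / (2 * a) * \<dots> = (\<theta> * (?q * Qo x) + \<theta> * ((\<Sum>h\<in>nodes b. G T C h xs) * Qo x)) / 2"
        using \<theta> q pos[OF x] by (simp add: a_def field_simps power2_eq_square)
      finally show ?thesis using a by (simp add: divide_right_mono mult_left_mono)
    qed
    have "fexp (level b) (\<lambda>c. dev (Suc b) (c # C))
      \<le> fexp (level b) (\<lambda>c. (dev b C + 2 * bad T b C)
        + (\<Sum>xs\<in>seqs b OS. \<Sum>x\<in>OS. \<bar>\<Sum>h\<in>nodes b. G T C h xs * (out (fst c h) x - Qo x)\<bar>))"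
      by (intro fexp_mono dev_Suc C)
    also have "\<dots> = dev b C + 2 * bad T b C + (\<Sum>xs\<in>seqs b OS. \<Sum>x\<in>OS.
        fexp (level b) (\<lambda>c. \<bar>\<Sum>h\<in>nodes b. G T C h xs * (out (fst c h) x - Qo x)\<bar>))"
      unfolding fexp_add fexp_sum by (simp add: fexp_const finite_level)
    also have "\<dots> \<le> dev b C + 2 * bad T b C + (\<Sum>xs\<in>seqs b OS. \<Sum>x\<in>OS.
        (\<theta> * (prod_list (map Qo xs) * Qo x) + \<theta> * ((\<Sum>h\<in>nodes b. G T C h xs) * Qo x)) / 2)"
      by (intro add_left_mono sum_mono main)
    also have "(\<Sum>xs\<in>seqs b OS. \<Sum>x\<in>OS.
        (\<theta> * (prod_list (map Qo xs) * Qo x) + \<theta> * ((\<Sum>h\<in>nodes b. G T C h xs) * Qo x)) / 2)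
      = \<theta> / 2 * ((\<Sum>xs\<in>seqs b OS. prod_list (map Qo xs)) + (\<Sum>xs\<in>seqs b OS. \<Sum>h\<in>nodes b. G T C h xs))"
    proof -
      have "(\<theta> * (p * q) + \<theta> * (g * q)) / 2 = \<theta> / 2 * ((p + g) * q)" for p q g
        by (simp add: algebra_simps)
      then show ?thesis
        by (simp only: sum_distrib_left[symmetric] sum_Qo mult_1_right sum.distrib)
    qed
    also have "(\<Sum>xs\<in>seqs b OS. prod_list (map Qo xs)) = 1"
      by (rule sum_prod_Qo)
    also have "(\<Sum>xs\<in>seqs b OS. \<Sum>h\<in>nodes b. G T C h xs) \<le> 1"
      using sum_G_le_1[OF C, of T] by (subst sum.swap)
    finally show "fexp (level b) (\<lambda>c. dev (Suc b) (c # C)) \<le> dev b C + (2 * bad T b C + \<theta>)"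
      using \<theta> by (simp add: algebra_simps)
  qed
  also have "\<dots> = EC b (dev b) + (2 * EC b (bad T b) + \<theta>)"
    by (simp add: EC_add EC_cmult EC_const)
  also have "\<dots> \<le> b * (2 * \<beta> + \<theta>) + (2 * \<beta> + \<theta>)"
    using Suc.IH Suc.prems(1) Suc.prems(2) by (intro add_mono mult_left_mono) auto
  finally show ?case by (simp add: algebra_simps)
qed

section \<open>Reliability: threshold decoding over histories\<close>

primrec ratio :: "((nat list \<Rightarrow> 'u) \<times> (nat list \<Rightarrow> 'v)) list \<Rightarrow> nat list \<Rightarrow> 'o list \<Rightarrow> real" where
  "ratio [] h xs = 1"
| "ratio (c # C) h xs = ratio C (tl h) (tl xs) * (outV (fst c (tl h)) (snd c h) (hd xs) / Qo (hd xs))"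

lemma ratio_nonneg: "xs \<in> seqs (length C) OS \<Longrightarrow> 0 \<le> ratio C h xs"
proof (induction C arbitrary: h xs)
  case (Cons c C)
  then obtain y ys where xs: "xs = y # ys" "y \<in> OS" "ys \<in> seqs (length C) OS"
    by (auto simp: seqs_Suc)
  then show ?case using Cons.IH[OF xs(3)] outV_nonneg Qo_nonneg by auto
qed auto

text \<open>\<open>ratio\<close> is the likelihood of a history's codewords under the ideal law
  relative to the target output law. Nonzero \<open>G\<close> certifies that \<open>T\<close> held
  at every transition, so each factor is at least \<tau>.\<close>

lemma ratio_ge:
  assumes "xs \<in> seqs (length C) OS" "0 < \<tau>"
    and "\<And>u v x. T u v x \<Longrightarrow> \<tau> \<le> outV u v x / Qo x" and "G T C h xs \<noteq> 0"
    and "h \<in> nodes (length C)"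
  shows "\<tau> ^ length C \<le> ratio C h xs"
  using assms
proof (induction C arbitrary: h xs)
  case (Cons c C)
  then obtain y ys where xs: "xs = y # ys" "y \<in> OS" "ys \<in> seqs (length C) OS"
    by (auto simp: seqs_Suc)
  obtain i g where h: "h = i # g" "g \<in> nodes (length C)" using Cons.prems(5) by auto
  have "G T C g ys \<noteq> 0" "gstep T c g i y \<noteq> 0" using Cons.prems(4) xs h by auto
  then have "T (fst c g) (snd c (i # g)) y" by (intro ccontr[of "T _ _ _"]) (simp add: gstep_def)
  from Cons.prems(3)[OF this] have "\<tau> \<le> outV (fst c g) (snd c (i # g)) y / Qo y" .
  moreover have "\<tau> ^ length C \<le> ratio C g ys"
    using Cons.IH[OF xs(3) Cons.prems(2,3) \<open>G T C g ys \<noteq> 0\<close> h(2)] by auto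
  ultimately have "\<tau> ^ length C * \<tau> \<le> ratio C g ys * (outV (fst c g) (snd c (i # g)) y / Qo y)"
    using \<open>0 < \<tau>\<close> ratio_nonneg[OF xs(3)] by (intro mult_mono) auto
  then show ?case by (simp add: xs h mult.commute)
qed auto

text \<open>A likelihood ratio has mean at most one under its reference law. Histories of different
  messages have no node in common: once the newest index of the true history is summed out, its
  output depends on a \<open>U\<close> codeword independent of the wrong codewords, and averages to
  \<open>Qo\<close>. The wrong ratio averages to \<open>Qo x / Qo x\<close>, which leaves at most
  the total mass of \<open>Qo\<close>. Wrong histories of the right message need no such bound, as
  they do no harm.\<close>

lemma EC_cross:
  assumes "h' \<in> nodes b"
  shows "EC b (\<lambda>C. \<Sum>h\<in>nodes b. of_bool (last h \<noteq> last h') * (\<Sum>xs\<in>seqs b OS. A C h xs * ratio C h' xs)) \<le> 1"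
  using assms
proof (induction b arbitrary: h')
  case 0
  have "(\<Sum>m<M. of_bool (m \<noteq> last h') * (1 / real M)) \<le> (\<Sum>m<M. 1 / real M)"
    by (intro sum_mono) auto
  also have "\<dots> = 1" using M_pos by simp
  finally show ?case unfolding EC.simps sum_nodes_0 by simp
next
  case (Suc b)
  then obtain i' g' where h': "h' = i' # g'" "i' < K" "g' \<in> nodes b" by auto
  have l': "last h' = last g'" using h' nodes_not_Nil by auto
  have "EC (Suc b) (\<lambda>C. \<Sum>h\<in>nodes (Suc b). of_bool (last h \<noteq> last h') * (\<Sum>xs\<in>seqs (Suc b) OS. A C h xs * ratio C h' xs))
     \<le> EC b (\<lambda>C. \<Sum>h\<in>nodes b. of_bool (last h \<noteq> last g') * (\<Sum>xs\<in>seqs b OS. A C h xs * ratio C g' xs))"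
    unfolding EC.simps
  proof (rule EC_mono)
    fix C :: "((nat list \<Rightarrow> 'u) \<times> (nat list \<Rightarrow> 'v)) list" assume C: "length C = b"
    let ?r = "\<lambda>c x. outV (fst c g') (snd c h') x / Qo x"
    have "(\<Sum>h\<in>nodes (Suc b). of_bool (last h \<noteq> last h') * (\<Sum>xs\<in>seqs (Suc b) OS. A (c # C) h xs * ratio (c # C) h' xs))
      = (\<Sum>h\<in>nodes b. of_bool (last h \<noteq> last g') * (\<Sum>xs\<in>seqs b OS. (A C h xs * ratio C g' xs) * (\<Sum>x\<in>OS. out (fst c h) x * ?r c x)))" for c
    proof -
      have "(\<Sum>i<K. \<Sum>xs\<in>seqs b OS. \<Sum>x\<in>OS. A C h xs * step c h i x * (ratio C g' xs * ?r c x))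
        = (\<Sum>xs\<in>seqs b OS. (A C h xs * ratio C g' xs) * (\<Sum>x\<in>OS. out (fst c h) x * ?r c x))" for h
      proof -
        have "(\<Sum>i<K. \<Sum>xs\<in>seqs b OS. \<Sum>x\<in>OS. A C h xs * step c h i x * (ratio C g' xs * ?r c x))
          = (\<Sum>xs\<in>seqs b OS. \<Sum>x\<in>OS. \<Sum>i<K. A C h xs * step c h i x * (ratio C g' xs * ?r c x))"
          by (subst sum.swap, intro sum.cong refl sum.swap)
        also have "\<dots> = (\<Sum>xs\<in>seqs b OS. (A C h xs * ratio C g' xs) * (\<Sum>x\<in>OS. (\<Sum>i<K. step c h i x) * ?r c x))"
          by (simp add: sum_distrib_left sum_distrib_right sum_divide_distrib mult_ac)
        finally show ?thesis by (simp add: sum_step)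
      qed
      note * = this
      have "last (i # h) = last h" if "h \<in> nodes b" for i h
        using nodes_not_Nil[OF that] by simp
      then show ?thesis
        unfolding sum_nodes_Suc sum_seqs_Suc l'
        by (intro sum.cong refl) (simp add: h'(1) sum_distrib_left[symmetric] *[unfolded h'(1), simplified])
    qed
    then have "fexp (level b) (\<lambda>c. \<Sum>h\<in>nodes (Suc b). of_bool (last h \<noteq> last h') * (\<Sum>xs\<in>seqs (Suc b) OS. A (c # C) h xs * ratio (c # C) h' xs))
      = (\<Sum>h\<in>nodes b. of_bool (last h \<noteq> last g') * (\<Sum>xs\<in>seqs b OS. (A C h xs * ratio C g' xs) * fexp (level b) (\<lambda>c. \<Sum>x\<in>OS. out (fst c h) x * ?r c x)))"
      by (simp only: fexp_sum fexp_cmult)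
    also have "\<dots> \<le> (\<Sum>h\<in>nodes b. of_bool (last h \<noteq> last g') * (\<Sum>xs\<in>seqs b OS. (A C h xs * ratio C g' xs) * 1))"
    proof (intro sum_mono)
      fix h assume h: "h \<in> nodes b"
      show "of_bool (last h \<noteq> last g') * (\<Sum>xs\<in>seqs b OS. (A C h xs * ratio C g' xs) * fexp (level b) (\<lambda>c. \<Sum>x\<in>OS. out (fst c h) x * ?r c x))
        \<le> of_bool (last h \<noteq> last g') * (\<Sum>xs\<in>seqs b OS. (A C h xs * ratio C g' xs) * 1)"
      proof (cases "last h = last g'")
        case False
        then have ne: "h \<noteq> g'" by auto
        have "fexp (level b) (\<lambda>c. \<Sum>x\<in>OS. out (fst c h) x * ?r c x)
          = (\<Sum>x\<in>OS. fexp (Pi_pmf (nodes b) undefined (\<lambda>_. PU)) (\<lambda>u. out (u h) x * (out (u g') x / Qo x)))"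
        proof -
          have "fexp (level b) (\<lambda>c. \<Sum>x\<in>OS. out (fst c h) x * ?r c x)
            = (\<Sum>x\<in>OS. fexp (Pi_pmf (nodes b) undefined (\<lambda>_. PU)) (\<lambda>u. fexp (Pi_pmf (nodes (Suc b)) undefined (\<lambda>_. PV)) (\<lambda>v.  out (u h) x * (outV (u g') (v h') x / Qo x))))"
            unfolding fexp_sum
            by (intro sum.cong refl fexp_level[where F = "\<lambda>u v. out (u h) _ * (outV (u g') (v h') _ / Qo _)"])
          moreover have "fexp (Pi_pmf (nodes (Suc b)) undefined (\<lambda>_. PV)) (\<lambda>v.  out (u h) x * (outV (u g') (v h') x / Qo x))
              = out (u h) x * (out (u g') x / Qo x)" for u x
            unfolding fexp_cmult fexp_divide
            by (subst fexp_Pi_pmf_component[OF finite_nodes finite_PV Suc.prems, of undefined "\<lambda>v. outV (u g') v x"])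
               (simp add: fexp_outV)
          ultimately show ?thesis by simp
        qed
        also have "\<dots> = (\<Sum>x\<in>OS. Qo x * (Qo x / Qo x))"
          by (intro sum.cong refl,
              subst fexp_Pi_pmf_two[OF finite_nodes finite_PU h h'(3) ne, of undefined "\<lambda>u. out u _" "\<lambda>u. out u _ / Qo _"])
             (simp add: fexp_divide Qo_def[symmetric])
        also have "\<dots> \<le> (\<Sum>x\<in>OS. Qo x)"
          by (intro sum_mono) (auto simp: Qo_nonneg)
        finally have "fexp (level b) (\<lambda>c. \<Sum>x\<in>OS. out (fst c h) x * ?r c x) \<le> 1" by (simp add: sum_Qo)
        then show ?thesis
          using C by (intro mult_left_mono sum_mono mult_nonneg_nonneg A_nonneg ratio_nonneg) auto
      qed simp
    qed
    finally show "fexp (level b) (\<lambda>c. \<Sum>h\<in>nodes (Suc b). of_bool (last h \<noteq> last h') * (\<Sum>xs\<in>seqs (Suc b) OS. A (c # C) h xs * ratio (c # C) h' xs))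
      \<le> (\<Sum>h\<in>nodes b. of_bool (last h \<noteq> last g') * (\<Sum>xs\<in>seqs b OS. A C h xs * ratio C g' xs))" by simp
  qed
  also have "\<dots> \<le> 1" using Suc.IH[OF h'(3)] .
  finally show ?case .
qed

text \<open>Only the message of a passing history is returned. If several messages pass, the choice
  of \<open>SOME\<close> is immaterial, since the union bound charges every wrong message that
  passes.\<close>

definition decode :: "((nat list \<Rightarrow> 'u) \<times> (nat list \<Rightarrow> 'v)) list \<Rightarrow> real \<Rightarrow> 'o list \<Rightarrow> nat" where
  "decode C t xs = (SOME m. \<exists>h\<in>nodes (length C). last h = m \<and> t \<le> ratio C h xs)"

definition decode_err :: "nat \<Rightarrow> real \<Rightarrow> ((nat list \<Rightarrow> 'u) \<times> (nat list \<Rightarrow> 'v)) list \<Rightarrow> real" where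
  "decode_err b t C = (\<Sum>h\<in>nodes b. \<Sum>xs\<in>seqs b OS. A C h xs * of_bool (decode C t xs \<noteq> last h))"

text \<open>Where \<open>G\<close> is nonzero the true history passes the threshold, so an error
  means that a history of another message passes too, and Markov's inequality bounds the indicator
  by its ratio over \<open>\<tau> ^ b\<close>. Where \<open>G\<close> vanishes, all of
  \<open>A\<close> is charged to \<open>bad\<close>.\<close>

lemma decode_err_le:
  assumes C: "length C = b" and \<tau>: "0 < \<tau>"
    and T: "\<And>u v x. T u v x \<Longrightarrow> \<tau> \<le> outV u v x / Qo x"
  shows "decode_err b (\<tau> ^ b) C \<le> bad T b C + (\<Sum>h'\<in>nodes b. (1 / \<tau> ^ b) *
      (\<Sum>h\<in>nodes b. of_bool (last h \<noteq> last h') * (\<Sum>xs\<in>seqs b OS. A C h xs * ratio C h' xs)))"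
proof -
  let ?t = "\<lambda>h h' xs. of_bool (last h \<noteq> last h') * (A C h xs * ratio C h' xs) / \<tau> ^ b"
  have "decode_err b (\<tau> ^ b) C \<le> (\<Sum>h\<in>nodes b. \<Sum>xs\<in>seqs b OS. (A C h xs - G T C h xs)
      + (\<Sum>h'\<in>nodes b. ?t h h' xs))"
    unfolding decode_err_def
  proof (intro sum_mono)
    fix h xs assume h: "h \<in> nodes b" and xs: "xs \<in> seqs b OS"
    have A0: "0 \<le> A C h xs" using A_nonneg xs C by auto
    have AG: "G T C h xs \<le> A C h xs" using G_le_A xs C by auto
    have t0: "0 \<le> ?t h h' xs" for h'
      using A0 ratio_nonneg[of xs C h'] xs C \<tau> by auto
    show "A C h xs * of_bool (decode C (\<tau> ^ b) xs \<noteq> last h) \<le> (A C h xs - G T C h xs)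
      + (\<Sum>h'\<in>nodes b. ?t h h' xs)"
    proof (cases "G T C h xs = 0 \<or> decode C (\<tau> ^ b) xs = last h")
      case True
      have "0 \<le> (\<Sum>h'\<in>nodes b. ?t h h' xs)" by (intro sum_nonneg t0)
      then show ?thesis using True A0 AG by auto
    next
      case False
      have "\<tau> ^ b \<le> ratio C h xs"
        using ratio_ge[of xs C \<tau> T h] T \<tau> xs C h False by auto
      then have "\<exists>h'\<in>nodes b. last h' = decode C (\<tau> ^ b) xs \<and> \<tau> ^ b \<le> ratio C h' xs"
        unfolding decode_def C using h
        by (intro someI_ex[of "\<lambda>m. \<exists>h\<in>nodes b. last h = m \<and> \<tau> ^ b \<le> ratio C h xs"]) auto
      then obtain h' where h': "h' \<in> nodes b" "last h' = decode C (\<tau> ^ b) xs" "\<tau> ^ b \<le> ratio C h' xs" by blast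
      have "A C h xs \<le> ?t h h' xs"
        using h' False \<tau> mult_left_mono[OF h'(3) A0] by (simp add: field_simps)
      also have "\<dots> \<le> (\<Sum>h'\<in>nodes b. ?t h h' xs)"
        using h' t0 by (intro member_le_sum) auto
      finally show ?thesis using AG False by auto
    qed
  qed
  also have "\<dots> = bad T b C + (\<Sum>h\<in>nodes b. \<Sum>h'\<in>nodes b. \<Sum>xs\<in>seqs b OS. ?t h h' xs)"
    unfolding bad_def by (simp add: sum.distrib) (intro sum.cong refl sum.swap)
  also have "(\<Sum>h\<in>nodes b. \<Sum>h'\<in>nodes b. \<Sum>xs\<in>seqs b OS. ?t h h' xs)
     = (\<Sum>h'\<in>nodes b. \<Sum>h\<in>nodes b. \<Sum>xs\<in>seqs b OS. ?t h h' xs)" by (rule sum.swap)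
  also have "\<dots> = (\<Sum>h'\<in>nodes b. (1 / \<tau> ^ b) *
      (\<Sum>h\<in>nodes b. of_bool (last h \<noteq> last h') * (\<Sum>xs\<in>seqs b OS. A C h xs * ratio C h' xs)))"
    by (simp add: sum_distrib_left)
  finally show ?thesis .
qed

lemma EC_decode_err:
  assumes \<tau>: "0 < \<tau>" and T: "\<And>u v x. T u v x \<Longrightarrow> \<tau> \<le> outV u v x / Qo x"
  shows "EC b (decode_err b (\<tau> ^ b)) \<le> b * (cover_fail + K / \<gamma> * atypical T) + real M * real K ^ b / \<tau> ^ b"
proof -
  have "EC b (decode_err b (\<tau> ^ b)) \<le> EC b (\<lambda>C. bad T b C + (\<Sum>h'\<in>nodes b. (1 / \<tau> ^ b) *
      (\<Sum>h\<in>nodes b. of_bool (last h \<noteq> last h') * (\<Sum>xs\<in>seqs b OS. A C h xs * ratio C h' xs))))"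
    by (rule EC_mono) (rule decode_err_le[OF _ \<tau> T])
  also have "\<dots> = EC b (bad T b) + (\<Sum>h'\<in>nodes b. (1 / \<tau> ^ b) * EC b (\<lambda>C.
      \<Sum>h\<in>nodes b. of_bool (last h \<noteq> last h') * (\<Sum>xs\<in>seqs b OS. A C h xs * ratio C h' xs)))"
    unfolding EC_add by (simp only: EC_sum EC_cmult)
  also have "\<dots> \<le> b * (cover_fail + K / \<gamma> * atypical T) + (\<Sum>h'\<in>nodes b. (1 / \<tau> ^ b) * 1)"
    using \<tau> by (intro add_mono EC_bad_le sum_mono mult_left_mono EC_cross) auto
  finally show ?thesis by (simp add: card_nodes)
qed

section \<open>Return from histories to state sequences\<close>

primrec path_prob :: "((nat list \<Rightarrow> 'u) \<times> (nat list \<Rightarrow> 'v)) list \<Rightarrow> nat \<Rightarrow> 's list \<Rightarrow> 'o list \<Rightarrow> real" where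
  "path_prob [] m ss xs = 1"
| "path_prob (c # C) m ss xs = path_prob C m (tl ss) (tl xs) *
     (Q (hd ss) * Wo (fst c (hist C m (tl ss))) (hd ss) (hd xs))"

lemma path_prob_eq_block_prob:
  assumes "length ss = length C"
  shows "path_prob C m ss xs = block_prob Q Wo (encode C m) ss xs"
proof -
  \<comment> \<open>\<open>encode\<close> addresses levels from the oldest end, so newer levels
    \<open>B\<close> in front do not matter. With \<open>B\<close> free, the induction can shorten
    \<open>D\<close> while the encoder keeps the full list.\<close>
  have "path_prob D m ss xs = block_prob Q Wo (encode (B @ D) m) ss xs" if "length ss = length D" for B D
    using that
  proof (induction D arbitrary: B ss xs)
    case (Cons c D)
    then obtain t ts where ss: "ss = t # ts" "length ts = length D" by (cases ss) auto
    have "encode (B @ c # D) m ts = fst c (hist D m ts)"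
      using ss(2) by (simp add: encode_def nth_append)
    moreover have "path_prob D m ts (tl xs) = block_prob Q Wo (encode (B @ c # D) m) ts (tl xs)"
      using Cons.IH[OF ss(2), of "tl xs" "B @ [c]"] by simp
    ultimately show ?case by (simp add: ss(1) mult.assoc)
  qed simp
  from this[OF assms, of "[]"] show ?thesis by simp
qed

text \<open>Message and states determine the history, so regrouping states by the history they
  produce gives \<open>A\<close>. The weight \<open>F\<close> is free: a function of the message
  yields the decoding error, the constant 1 the output law.\<close>

lemma sum_A_eq_path_prob:
  "(\<Sum>h\<in>nodes (length C). A C h xs * F h)
    = (1 / M) * (\<Sum>m<M. \<Sum>ss\<in>seqs (length C) S. path_prob C m ss xs * F (hist C m ss))"
proof (induction C arbitrary: F xs)
  case Nil
  show ?case by (simp add: sum_nodes_0 sum_distrib_left del: nodes.simps)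
next
  case (Cons c C)
  let ?F = "\<lambda>g. \<Sum>s\<in>S. Q s * Wo (fst c g) s (hd xs) * F (pick (snd c) g s # g)"
  have "(\<Sum>i<K. step c g i (hd xs) * F (i # g)) = ?F g" for g
  proof -
    have "(\<Sum>i<K. step c g i (hd xs) * F (i # g))
      = (\<Sum>s\<in>S. \<Sum>i<K. Q s * Wo (fst c g) s (hd xs) * of_bool (pick (snd c) g s = i) * F (i # g))"
      unfolding step_def sum_distrib_right by (rule sum.swap)
    also have "\<dots> = ?F g"
      by (intro sum.cong refl) (simp add: of_bool_def pick_less if_distrib[of "\<lambda>x. x * _"]
          if_distrib[of "\<lambda>x. _ * x"] sum.delta cong: if_cong)
    finally show ?thesis .
  qed
  then have "(\<Sum>h\<in>nodes (length (c # C)). A (c # C) h xs * F h) = (\<Sum>g\<in>nodes (length C). A C g (tl xs) * ?F g)"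
    unfolding list.size(4) add_0_right One_nat_def add_Suc_right sum_nodes_Suc
    by (intro sum.cong refl) (simp add: sum_distrib_left[symmetric] mult.assoc)
  also have "\<dots> = (1 / M) * (\<Sum>m<M. \<Sum>ss\<in>seqs (length C) S. path_prob C m ss (tl xs) * ?F (hist C m ss))"
    by (rule Cons.IH)
  also have "\<dots> = (1 / M) * (\<Sum>m<M. \<Sum>ss\<in>seqs (length (c # C)) S. path_prob (c # C) m ss xs * F (hist (c # C) m ss))"
    by (simp add: sum_seqs_Suc sum_distrib_left mult.assoc)
  finally show ?case .
qed

end

section \<open>One codebook for both receivers\<close>

locale tree_two_channels =
  Y: tree_channel PU PV Q S PS K M \<gamma> OY WY + Z: tree_channel PU PV Q S PS K M \<gamma> OZ WZ
  for PU :: "'u pmf" and PV :: "'v pmf" and Q :: "'s \<Rightarrow> real" and S PS K M \<gamma>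
    and OY :: "'y set" and WY and OZ :: "'z set" and WZ
begin

text \<open>Error and deviation are averaged as one weighted sum because separate existence
  arguments could select different codebooks. \<open>EC\<close> and \<open>cover_fail\<close> depend
  only on the shared \<open>tree_code\<close> data, so they agree for both channels.\<close>

lemma good_code_exists:
  assumes \<tau>: "0 < \<tau>" and TY: "\<And>u v y. TY u v y \<Longrightarrow> \<tau> \<le> Y.outV u v y / Y.Qo y"
    and D: "\<And>u z. z \<in> OZ \<Longrightarrow> Z.out u z \<le> D * Z.Qo z" and D0: "0 \<le> D"
    and TZ: "\<And>u v z. z \<in> OZ \<Longrightarrow> TZ u v z \<Longrightarrow> Z.outV u v z \<le> \<eta> * Z.Qo z" and \<eta>: "0 \<le> \<eta>"
    and pos: "\<And>z. z \<in> OZ \<Longrightarrow> 0 < Z.Qo z"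
    and \<theta>: "0 < \<theta>" "\<And>j. j < L \<Longrightarrow> D * ((\<eta> / \<gamma>) ^ j / M) \<le> \<theta>\<^sup>2"
    and w: "0 \<le> w"
  shows "\<exists>U dec.
    (1 / M) * (\<Sum>m<M. \<Sum>ss\<in>seqs L S. \<Sum>ys\<in>seqs L OY. block_prob Q WY (U m) ss ys * of_bool (dec ys \<noteq> m))
    + w * (\<Sum>zs\<in>seqs L OZ. \<bar>(1 / M) * (\<Sum>m<M. \<Sum>ss\<in>seqs L S. block_prob Q WZ (U m) ss zs) - prod_list (map Z.Qo zs)\<bar>)
    \<le> L * (Y.cover_fail + K / \<gamma> * Y.atypical TY) + real M * real K ^ L / \<tau> ^ L
      + w * (L * (2 * (L * (Y.cover_fail + K / \<gamma> * Z.atypical TZ)) + \<theta>))"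
proof -
  let ?E = "\<lambda>C. Y.decode_err L (\<tau> ^ L) C + w * Z.dev L C"
  obtain C where C: "length C = L" "?E C \<le> Y.EC L ?E" using Y.EC_attained[of L ?E] by blast
  have "Y.EC L (Z.dev L) \<le> L * (2 * (L * (Y.cover_fail + K / \<gamma> * Z.atypical TZ)) + \<theta>)"
  proof (rule Z.EC_dev[OF D TZ \<eta> D0 \<theta>(1) pos \<theta>(2)])
    fix j assume j: "j < L"
    have "Y.EC j (Z.bad TZ j) \<le> j * (Y.cover_fail + K / \<gamma> * Z.atypical TZ)"
      by (rule Z.EC_bad_le)
    also have "\<dots> \<le> L * (Y.cover_fail + K / \<gamma> * Z.atypical TZ)"
      using j Y.cover_fail_nonneg Z.atypical_nonneg[of TZ] Y.\<gamma>_pos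
      by (intro mult_right_mono) auto
    finally show "Y.EC j (Z.bad TZ j) \<le> L * (Y.cover_fail + K / \<gamma> * Z.atypical TZ)" .
  qed auto
  from mult_left_mono[OF this w] Y.EC_decode_err[where b = L and T = TY, OF \<tau> TY]
  have bound: "?E C \<le> L * (Y.cover_fail + K / \<gamma> * Y.atypical TY) + real M * real K ^ L / \<tau> ^ L
      + w * (L * (2 * (L * (Y.cover_fail + K / \<gamma> * Z.atypical TZ)) + \<theta>))"
    using C(2) by (simp add: Y.EC_add Y.EC_cmult)
  have "Y.decode_err L (\<tau> ^ L) C = (\<Sum>ys\<in>seqs L OY. \<Sum>h\<in>Y.nodes (length C). Y.A C h ys * of_bool (Y.decode C (\<tau> ^ L) ys \<noteq> last h))"
    unfolding Y.decode_err_def C(1) by (rule sum.swap)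
  also have "\<dots> = (\<Sum>ys\<in>seqs L OY. (1 / M) * (\<Sum>m<M. \<Sum>ss\<in>seqs L S. Y.path_prob C m ss ys * of_bool (Y.decode C (\<tau> ^ L) ys \<noteq> m)))"
    using Y.sum_A_eq_path_prob[of C _ "\<lambda>h. of_bool (Y.decode C (\<tau> ^ L) _ \<noteq> last h)"] C(1)
    by (intro sum.cong refl) (simp only: Y.last_hist)
  also have "\<dots> = (1 / M) * (\<Sum>m<M. \<Sum>ss\<in>seqs L S. \<Sum>ys\<in>seqs L OY. Y.path_prob C m ss ys * of_bool (Y.decode C (\<tau> ^ L) ys \<noteq> m))"
    unfolding sum_distrib_left[symmetric]
    by (subst sum.swap, intro arg_cong[where f = "\<lambda>x. _ * x"] sum.cong refl, subst sum.swap, rule refl)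
  finally have e: "Y.decode_err L (\<tau> ^ L) C = \<dots>" .
  have d: "Z.dev L C = (\<Sum>zs\<in>seqs L OZ. \<bar>(1 / M) * (\<Sum>m<M. \<Sum>ss\<in>seqs L S. Z.path_prob C m ss zs) - prod_list (map Z.Qo zs)\<bar>)"
    unfolding Z.dev_def using Z.sum_A_eq_path_prob[of C _ "\<lambda>_. 1"] C(1) by simp
  have YP: "Y.path_prob C m ss ys = block_prob Q WY (Y.encode C m) ss ys"
    and ZP: "Z.path_prob C m ss zs = block_prob Q WZ (Y.encode C m) ss zs"
    if "ss \<in> seqs L S" for m ss ys zs
    using that C(1) by (auto simp: seqs_def Y.path_prob_eq_block_prob Z.path_prob_eq_block_prob)
  show ?thesis using bound unfolding e d
    by (intro exI[of _ "Y.encode C"] exI[of _ "Y.decode C (\<tau> ^ L)"]) (simp add: YP ZP cong: sum.cong)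
qed

end

section \<open>Independent sequences and exponential tail bounds\<close>

lemma sum_seqs_prod:
  fixes f :: "nat \<Rightarrow> 'a \<Rightarrow> real"
  shows "(\<Sum>xs\<in>seqs n A. \<Prod>i<n. f i (xs ! i)) = (\<Prod>i<n. \<Sum>a\<in>A. f i a)"
proof (induction n arbitrary: f)
  case (Suc n)
  have "(\<Sum>xs\<in>seqs (Suc n) A. \<Prod>i<Suc n. f i (xs ! i))
     = (\<Sum>xs\<in>seqs n A. \<Sum>a\<in>A. f 0 a * (\<Prod>i<n. f (Suc i) (xs ! i)))"
    by (simp add: sum_seqs_Suc prod.lessThan_Suc_shift del: prod.lessThan_Suc)
  also have "\<dots> = (\<Sum>a\<in>A. f 0 a) * (\<Prod>i<n. \<Sum>a\<in>A. f (Suc i) a)"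
    by (simp only: sum_distrib_right[symmetric] sum_distrib_left[symmetric] Suc.IH[of "\<lambda>i. f (Suc i)"])
  finally show ?case by (simp add: prod.lessThan_Suc_shift del: prod.lessThan_Suc)
qed simp

lemma set_replicate_pmf_eq_seqs: "set_pmf (replicate_pmf n p) = seqs n (set_pmf p)"
  by (auto simp: set_replicate_pmf seqs_def lists_eq_set)

lemma pmf_replicate_pmf:
  "length xs = n \<Longrightarrow> pmf (replicate_pmf n p) xs = (\<Prod>i<n. pmf p (xs ! i))"
proof (induction n arbitrary: xs)
  case (Suc n)
  then obtain y ys where xs: "xs = y # ys" "length ys = n" by (cases xs) auto
  have "replicate_pmf (Suc n) p = map_pmf (\<lambda>(x, xs). x # xs) (pair_pmf p (replicate_pmf n p))"
    by (simp add: pair_pmf_def map_bind_pmf map_pmf_def bind_assoc_pmf bind_return_pmf)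
  then have "pmf (replicate_pmf (Suc n) p) xs
     = pmf (map_pmf (\<lambda>(x, xs). x # xs) (pair_pmf p (replicate_pmf n p))) (case (y, ys) of (x, xs) \<Rightarrow> x # xs)"
    using xs by simp
  also have "\<dots> = pmf (pair_pmf p (replicate_pmf n p)) (y, ys)"
    by (rule pmf_map_inj') (auto simp: inj_def)
  finally show ?case using Suc.IH[OF xs(2)] xs
    by (simp add: pmf_pair prod.lessThan_Suc_shift del: prod.lessThan_Suc)
qed simp

lemma fexp_replicate_pmf:
  "fexp (replicate_pmf n p) F = (\<Sum>xs\<in>seqs n (set_pmf p). (\<Prod>i<n. pmf p (xs ! i)) * F xs)"
  unfolding fexp_def set_replicate_pmf_eq_seqs
  by (intro sum.cong) (auto simp: seqs_def pmf_replicate_pmf)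

lemma fexp_replicate_pmf_prod:
  "fexp (replicate_pmf n p) (\<lambda>xs. \<Prod>i<n. f i (xs ! i)) = (\<Prod>i<n. fexp p (f i))"
  using sum_seqs_prod[where f = "\<lambda>i x. pmf p x * f i x" and A = "set_pmf p"]
  unfolding fexp_replicate_pmf prod.distrib[symmetric] by (simp add: fexp_def)

lemma seqs_nth: "xs \<in> seqs n A \<Longrightarrow> i < n \<Longrightarrow> xs ! i \<in> A"
  by (auto simp: seqs_def)

text \<open>The moment generating function of g - c equals 1 at 0 and has negative derivative there,
  so it drops below 1 at some positive argument.\<close>

lemma chernoff_exponent:
  fixes p g :: "'a \<Rightarrow> real"
  assumes p: "sum p X = 1" and mean: "(\<Sum>x\<in>X. p x * g x) < c"
  shows "\<exists>t>0. (\<Sum>x\<in>X. p x * exp (t * (g x - c))) < 1"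
proof -
  let ?\<phi> = "\<lambda>t. \<Sum>x\<in>X. p x * exp (t * (g x - c))"
  have "(?\<phi> has_real_derivative (\<Sum>x\<in>X. p x * (exp (0 * (g x - c)) * (g x - c)))) (at 0)"
    by (auto intro!: derivative_eq_intros DERIV_sum)
  moreover have "(\<Sum>x\<in>X. p x * (exp (0 * (g x - c)) * (g x - c))) < 0"
    using mean p by (simp add: algebra_simps sum_subtractf sum_distrib_left[symmetric])
  ultimately obtain d where d: "d > 0" "\<And>h. 0 < h \<Longrightarrow> h < d \<Longrightarrow> ?\<phi> (0 + h) < ?\<phi> 0"
    using DERIV_neg_dec_right[of ?\<phi> _ 0] by blast
  from d(2)[of "d / 2"] d(1) p show ?thesis by (intro exI[of _ "d / 2"]) auto
qed

text \<open>\<rho> is fixed before the length and the event, so one rate serves all blocks. The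
  event is tested only on sequences of positive letters, where logarithms of the factors are
  meaningful.\<close>

lemma chernoff_seqs:
  fixes p g :: "'a \<Rightarrow> 'b \<Rightarrow> 'c \<Rightarrow> real"
  assumes fin: "finite A" "finite B" "finite D"
    and p0: "\<And>a b d. a \<in> A \<Longrightarrow> b \<in> B \<Longrightarrow> d \<in> D \<Longrightarrow> 0 \<le> p a b d"
    and p: "(\<Sum>a\<in>A. \<Sum>b\<in>B. \<Sum>d\<in>D. p a b d) = 1"
    and mean: "(\<Sum>a\<in>A. \<Sum>b\<in>B. \<Sum>d\<in>D. p a b d * g a b d) < c"
  shows "\<exists>\<rho>. 0 < \<rho> \<and> \<rho> < 1 \<and> (\<forall>n E. (\<forall>as\<in>seqs n A. \<forall>bs\<in>seqs n B. \<forall>ds\<in>seqs n D.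
      E as bs ds \<longrightarrow> (\<forall>i<n. 0 < p (as ! i) (bs ! i) (ds ! i)) \<longrightarrow>
      n * c \<le> (\<Sum>i<n. g (as ! i) (bs ! i) (ds ! i))) \<longrightarrow>
    (\<Sum>as\<in>seqs n A. \<Sum>bs\<in>seqs n B. \<Sum>ds\<in>seqs n D.
      (\<Prod>i<n. p (as ! i) (bs ! i) (ds ! i)) * of_bool (E as bs ds)) \<le> \<rho> ^ n)"
proof -
  have flat: "(\<Sum>a\<in>A. \<Sum>b\<in>B. \<Sum>d\<in>D. h a b d) = (\<Sum>(a, b, d)\<in>A \<times> B \<times> D. h a b d)" for h :: "'a \<Rightarrow> 'b \<Rightarrow> 'c \<Rightarrow> real"
    by (simp add: sum.cartesian_product)
  obtain t where t: "t > 0" "(\<Sum>x\<in>A \<times> B \<times> D. (case x of (a, b, d) \<Rightarrow> p a b d) * exp (t * ((case x of (a, b, d) \<Rightarrow> g a b d) - c))) < 1"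
    using chernoff_exponent[of "\<lambda>(a, b, d). p a b d" "A \<times> B \<times> D" "\<lambda>(a, b, d). g a b d" c] p mean
    unfolding flat by (auto simp: case_prod_unfold)
  define f where "f a b d = p a b d * exp (t * (g a b d - c))" for a b d
  define \<phi> where "\<phi> = (\<Sum>a\<in>A. \<Sum>b\<in>B. \<Sum>d\<in>D. f a b d)"
  have \<phi>1: "\<phi> < 1" using t(2) unfolding \<phi>_def flat f_def by (simp add: case_prod_unfold)
  have f0: "0 \<le> f a b d" if "a \<in> A" "b \<in> B" "d \<in> D" for a b d using p0[OF that] by (simp add: f_def)
  have \<phi>0: "0 \<le> \<phi>" unfolding \<phi>_def by (intro sum_nonneg f0)
  \<comment> \<open>The maximum with 1/2 gives positivity without a separate argument.\<close>
  define \<rho> where "\<rho> = max \<phi> (1/2)"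
  have "(\<Sum>as\<in>seqs n A. \<Sum>bs\<in>seqs n B. \<Sum>ds\<in>seqs n D.
      (\<Prod>i<n. p (as ! i) (bs ! i) (ds ! i)) * of_bool (E as bs ds)) \<le> \<rho> ^ n"
    if E: "\<forall>as\<in>seqs n A. \<forall>bs\<in>seqs n B. \<forall>ds\<in>seqs n D.
      E as bs ds \<longrightarrow> (\<forall>i<n. 0 < p (as ! i) (bs ! i) (ds ! i)) \<longrightarrow>
      n * c \<le> (\<Sum>i<n. g (as ! i) (bs ! i) (ds ! i))" for n E
  proof -
    have "(\<Sum>as\<in>seqs n A. \<Sum>bs\<in>seqs n B. \<Sum>ds\<in>seqs n D.
        (\<Prod>i<n. p (as ! i) (bs ! i) (ds ! i)) * of_bool (E as bs ds))
      \<le> (\<Sum>as\<in>seqs n A. \<Sum>bs\<in>seqs n B. \<Sum>ds\<in>seqs n D. \<Prod>i<n. f (as ! i) (bs ! i) (ds ! i))"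
    proof (intro sum_mono)
      fix as bs ds assume m: "as \<in> seqs n A" "bs \<in> seqs n B" "ds \<in> seqs n D"
      let ?p = "\<lambda>i. p (as ! i) (bs ! i) (ds ! i)" and ?g = "\<lambda>i. g (as ! i) (bs ! i) (ds ! i)"
      have nn: "0 \<le> ?p i" if "i < n" for i using that m by (intro p0 seqs_nth) auto
      have fn: "0 \<le> (\<Prod>i<n. f (as ! i) (bs ! i) (ds ! i))"
        using m by (intro prod_nonneg) (auto intro!: f0 seqs_nth)
      show "(\<Prod>i<n. ?p i) * of_bool (E as bs ds) \<le> (\<Prod>i<n. f (as ! i) (bs ! i) (ds ! i))"
      proof (cases "E as bs ds \<and> (\<forall>i<n. 0 < ?p i)")
        case True
        then have "n * c \<le> (\<Sum>i<n. ?g i)" using E m by blast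
        then have "0 \<le> t * ((\<Sum>i<n. ?g i) - n * c)" using t(1) by simp
        then have "(1::real) \<le> exp (t * ((\<Sum>i<n. ?g i) - n * c))" by simp
        also have "\<dots> = (\<Prod>i<n. exp (t * (?g i - c)))"
          by (simp add: exp_sum[symmetric] sum_distrib_left[symmetric] sum_subtractf)
        finally have "(\<Prod>i<n. ?p i) * 1 \<le> (\<Prod>i<n. ?p i) * (\<Prod>i<n. exp (t * (?g i - c)))"
          using nn by (intro mult_left_mono prod_nonneg) auto
        then show ?thesis using True by (simp add: f_def prod.distrib)
      next
        case False
        then have z: "(\<Prod>i<n. ?p i) * of_bool (E as bs ds) = 0"
          using nn by (force simp: not_less)
        show ?thesis unfolding z by (rule fn)
      qed
    qed
    also have "\<dots> = \<phi> ^ n"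
      unfolding \<phi>_def sum_seqs_prod[where f = "\<lambda>i x. f (_ ! i) (_ ! i) x"]
        sum_seqs_prod[where f = "\<lambda>i b. \<Sum>d\<in>D. f (_ ! i) b d"]
        sum_seqs_prod[where f = "\<lambda>i a. \<Sum>b\<in>B. \<Sum>d\<in>D. f a b d"] by simp
    also have "\<dots> \<le> \<rho> ^ n" using \<phi>0 by (intro power_mono) (auto simp: \<rho>_def)
    finally show ?thesis .
  qed
  then show ?thesis using \<phi>1 by (intro exI[of _ \<rho>]) (auto simp: \<rho>_def)
qed

section \<open>Block codes over product alphabets\<close>

lemma prod_powr_sum: "0 < (b::real) \<Longrightarrow> (\<Prod>i\<in>I. b powr f i) = b powr (\<Sum>i\<in>I. f i)"
  by (induction I rule: infinite_finite_induct) (auto simp: powr_add)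

lemma powr_cancel: "2 powr (real n * (- c)) * (2 powr (real n * c) * x) = x"
  by (simp add: powr_minus)

lemma two_powr_power: "((2::real) powr d) ^ n = 2 powr (real n * d)"
  by (induction n) (simp_all add: distrib_right powr_add)

lemma log_prod_ratio_le:
  fixes a b :: "nat \<Rightarrow> real"
  assumes pos: "\<And>i. i < n \<Longrightarrow> 0 < a i" "\<And>i. i < n \<Longrightarrow> 0 < b i"
    and le: "2 powr c * (\<Prod>i<n. b i) \<le> (\<Prod>i<n. a i)"
  shows "c \<le> (\<Sum>i<n. log 2 (a i / b i))"
proof -
  have "2 powr (\<Sum>i<n. log 2 (a i / b i)) = (\<Prod>i<n. a i / b i)"
    using pos by (subst prod_powr_sum[symmetric]) (auto intro!: prod.cong)
  also have "\<dots> = (\<Prod>i<n. a i) / (\<Prod>i<n. b i)" by (simp add: prod_dividef)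
  also have "2 powr c \<le> \<dots>" using le pos by (subst pos_le_divide_eq) (auto intro!: prod_pos)
  finally show ?thesis by simp
qed

lemma gibbs:
  fixes p q :: "'a \<Rightarrow> real"
  assumes "finite X" "\<And>x. x \<in> X \<Longrightarrow> 0 \<le> p x" "\<And>x. x \<in> X \<Longrightarrow> 0 < p x \<Longrightarrow> 0 < q x" "\<And>x. x \<in> X \<Longrightarrow> 0 \<le> q x"
    and "sum q X \<le> sum p X"
  shows "0 \<le> (\<Sum>x\<in>X. p x * log 2 (p x / q x))"
proof -
  have "(p x - q x) / ln 2 \<le> p x * log 2 (p x / q x)" if x: "x \<in> X" for x
  proof (cases "p x = 0")
    case True
    then show ?thesis using assms(4)[OF x] by (simp add: divide_le_0_iff)
  next
    case False
    then have p: "0 < p x" "0 < q x" using assms x by (auto simp: less_le)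
    have "ln (q x / p x) \<le> q x / p x - 1" using p by (intro ln_le_minus_one) auto
    then have "p x * ln (q x / p x) \<le> q x - p x" using mult_left_mono[of "ln (q x / p x)" "q x / p x - 1" "p x"] p
      by (simp add: right_diff_distrib)
    moreover have "ln (p x / q x) = - ln (q x / p x)" using p by (simp add: ln_div)
    ultimately have "p x - q x \<le> p x * ln (p x / q x)" by simp
    then show ?thesis unfolding log_def times_divide_eq_right by (intro divide_right_mono) auto
  qed
  then have "(\<Sum>x\<in>X. (p x - q x) / ln 2) \<le> (\<Sum>x\<in>X. p x * log 2 (p x / q x))" by (rule sum_mono)
  moreover have "0 \<le> (\<Sum>x\<in>X. (p x - q x) / ln 2)"
    using assms(5) by (simp add: sum_divide_distrib[symmetric] sum_subtractf)
  ultimately show ?thesis by linarith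
qed

locale aux_setting =
  fixes QS :: "'s::finite pmf" and PU :: "'u pmf" and PV :: "'v pmf" and PSV :: "'v \<Rightarrow> 's pmf"
    and xf :: "'u \<Rightarrow> 's \<Rightarrow> 'x"
  assumes finite_PU: "finite (set_pmf PU)" and finite_PV: "finite (set_pmf PV)"
    and QS: "bind_pmf PV PSV = QS"
begin

text \<open>\<open>out1\<close>, \<open>outV1\<close> and \<open>q1\<close> are the one-letter forms
  of \<open>out\<close>, \<open>outV\<close> and \<open>Qo\<close>, which over a block become their
  products.\<close>

definition out1 :: "('x \<Rightarrow> 's \<Rightarrow> 'b pmf) \<Rightarrow> 'u \<Rightarrow> 'b \<Rightarrow> real" where
  "out1 V u x = (\<Sum>s\<in>UNIV. pmf QS s * pmf (V (xf u s) s) x)"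

definition outV1 :: "('x \<Rightarrow> 's \<Rightarrow> 'b pmf) \<Rightarrow> 'u \<Rightarrow> 'v \<Rightarrow> 'b \<Rightarrow> real" where
  "outV1 V u v x = (\<Sum>s\<in>UNIV. pmf (PSV v) s * pmf (V (xf u s) s) x)"

definition q1 :: "('x \<Rightarrow> 's \<Rightarrow> 'b pmf) \<Rightarrow> 'b \<Rightarrow> real" where
  "q1 V x = fexp PU (\<lambda>u. out1 V u x)"

text \<open>I(U,V;output), written directly as the mean of the information density so that the tail
  bounds apply; \<open>mutual_info_UV\<close> identifies it.\<close>

definition info :: "('x \<Rightarrow> 's \<Rightarrow> 'b::finite pmf) \<Rightarrow> real" where
  "info V = (\<Sum>u\<in>set_pmf PU. \<Sum>v\<in>set_pmf PV. \<Sum>x\<in>UNIV.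
     pmf PU u * pmf PV v * outV1 V u v x * log 2 (outV1 V u v x / q1 V x))"

definition infoS :: real where
  "infoS = (\<Sum>v\<in>set_pmf PV. \<Sum>s\<in>UNIV. pmf PV v * pmf (PSV v) s * log 2 (pmf (PSV v) s / pmf QS s))"

definition PSn :: "nat \<Rightarrow> 'v list \<Rightarrow> 's list \<Rightarrow> real" where
  "PSn n v s = (\<Prod>i<n. pmf (PSV (v ! i)) (s ! i))"

definition Wn :: "('x \<Rightarrow> 's \<Rightarrow> 'b pmf) \<Rightarrow> nat \<Rightarrow> 'u list \<Rightarrow> 's list \<Rightarrow> 'b list \<Rightarrow> real" where
  "Wn V n u s x = (\<Prod>i<n. pmf (V (xf (u ! i) (s ! i)) (s ! i)) (x ! i))"

lemma sum_pmf_UNIV: "(\<Sum>x\<in>UNIV. pmf p x) = 1" for p :: "'b::finite pmf"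
  by (rule sum_pmf_eq_1) auto

lemma QS_eq: "pmf QS s = fexp PV (\<lambda>v. pmf (PSV v) s)"
  unfolding QS[symmetric] pmf_bind using finite_PV by (simp add: fexp_eq_expectation)

lemma out1_eq: "out1 V u x = fexp PV (\<lambda>v. outV1 V u v x)"
  unfolding out1_def outV1_def fexp_sum fexp_multc QS_eq ..

lemma outV1_nonneg: "0 \<le> outV1 V u v x"
  unfolding outV1_def by (intro sum_nonneg) auto

lemma sum_outV1: "(\<Sum>x\<in>UNIV. outV1 V u v x) = 1" for V :: "'x \<Rightarrow> 's \<Rightarrow> 'b::finite pmf"
  unfolding outV1_def
  by (subst sum.swap) (simp add: sum_distrib_left[symmetric] sum_pmf_UNIV)

lemma q1_eq: "q1 V x = (\<Sum>u\<in>set_pmf PU. \<Sum>v\<in>set_pmf PV. pmf PU u * pmf PV v * outV1 V u v x)"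
  unfolding q1_def out1_eq fexp_def by (simp add: sum_distrib_left mult.assoc)

lemma joint_le_q1:
  assumes "u \<in> set_pmf PU" "v \<in> set_pmf PV"
  shows "pmf PU u * pmf PV v * outV1 V u v x \<le> q1 V x"
proof -
  have "pmf PU u * pmf PV v * outV1 V u v x \<le> (\<Sum>v\<in>set_pmf PV. pmf PU u * pmf PV v * outV1 V u v x)"
    using assms finite_PV by (intro member_le_sum) (auto simp: outV1_nonneg)
  also have "\<dots> \<le> q1 V x" unfolding q1_eq
    using assms finite_PU by (intro member_le_sum) (auto simp: outV1_nonneg intro!: sum_nonneg)
  finally show ?thesis .
qed

lemma q1_pos:
  assumes "u \<in> set_pmf PU" "v \<in> set_pmf PV" "0 < pmf PU u * pmf PV v * outV1 V u v x"
  shows "0 < outV1 V u v x" "0 < q1 V x"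
proof -
  show "0 < q1 V x" using joint_le_q1[OF assms(1,2), of V x] assms(3) by linarith
  show "0 < outV1 V u v x" using assms(3) outV1_nonneg[of V u v x] by (auto simp: less_le)
qed

text \<open>Here a block of n channel uses becomes one letter of the one-shot setting.\<close>

lemma tree_channel_Wn:
  fixes V :: "'x \<Rightarrow> 's \<Rightarrow> 'b::finite pmf"
  assumes "0 < K" "0 < M" "0 < \<gamma>"
  shows "tree_channel (replicate_pmf n PU) (replicate_pmf n PV) (iid_prob QS n) (seqs n UNIV) (PSn n) K M \<gamma> (seqs n UNIV) (Wn V n)"
proof
  show "sum (iid_prob QS n) (seqs n UNIV) = 1"
    unfolding iid_prob_def sum_seqs_prod[where f = "\<lambda>i x. pmf QS x"] by (simp add: sum_pmf_UNIV)
  show "(\<Sum>x\<in>seqs n UNIV. Wn V n u s x) = 1" for u s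
    unfolding Wn_def sum_seqs_prod[where f = "\<lambda>i x. pmf (V (xf (u ! i) (s ! i)) (s ! i)) x"]
    by (simp add: sum_pmf_UNIV)
  show "fexp (replicate_pmf n PV) (\<lambda>v. PSn n v s) = iid_prob QS n s" for s
    unfolding PSn_def iid_prob_def fexp_replicate_pmf_prod[where f = "\<lambda>i v. pmf (PSV v) (s ! i)"]
    by (simp add: QS_eq)
qed (use assms finite_PU finite_PV in \<open>auto simp: set_replicate_pmf_eq_seqs iid_prob_def PSn_def Wn_def intro!: prod_nonneg\<close>)

context
  fixes V :: "'x \<Rightarrow> 's \<Rightarrow> 'b::finite pmf" and K M n :: nat and \<gamma> :: real
  assumes KM: "0 < K" "0 < M" "0 < \<gamma>"
begin

interpretation tree_channel "replicate_pmf n PU" "replicate_pmf n PV" "iid_prob QS n" "seqs n UNIV" "PSn n" K M \<gamma> "seqs n UNIV" "Wn V n"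
  by (rule tree_channel_Wn[OF KM])

lemma out_Wn: "out u x = (\<Prod>i<n. out1 V (u ! i) (x ! i))"
  unfolding out_def iid_prob_def Wn_def prod.distrib[symmetric] out1_def
  by (rule sum_seqs_prod[where f = "\<lambda>i s. pmf QS s * pmf (V (xf (u ! i) s) s) (x ! i)"])

lemma outV_Wn: "outV u v x = (\<Prod>i<n. outV1 V (u ! i) (v ! i) (x ! i))"
  unfolding outV_def PSn_def Wn_def prod.distrib[symmetric] outV1_def
  by (rule sum_seqs_prod[where f = "\<lambda>i s. pmf (PSV (v ! i)) s * pmf (V (xf (u ! i) s) s) (x ! i)"])

lemma Qo_Wn: "Qo x = (\<Prod>i<n. q1 V (x ! i))"
  unfolding Qo_def out_Wn q1_def by (rule fexp_replicate_pmf_prod[where f = "\<lambda>i u. out1 V u (x ! i)"])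

lemma atypical_Wn:
  "atypical T = (\<Sum>u\<in>seqs n (set_pmf PU). \<Sum>v\<in>seqs n (set_pmf PV). \<Sum>x\<in>seqs n UNIV.
     (\<Prod>i<n. pmf PU (u ! i) * pmf PV (v ! i) * outV1 V (u ! i) (v ! i) (x ! i)) * of_bool (\<not> T u v x))"
  unfolding atypical_def fexp_replicate_pmf outV_Wn
  by (simp only: sum_distrib_left prod.distrib mult.assoc)

lemmas Wn_simps = out_Wn outV_Wn Qo_Wn atypical_Wn

end

section \<open>Exponential decay of the atypicality probabilities\<close>

lemma joint_sum: "(\<Sum>u\<in>set_pmf PU. \<Sum>v\<in>set_pmf PV. \<Sum>x\<in>UNIV. pmf PU u * pmf PV v * outV1 V u v x) = 1"
  for V :: "'x \<Rightarrow> 's \<Rightarrow> 'b::finite pmf"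
  using finite_PU finite_PV
  by (simp add: sum_distrib_left[symmetric] sum_outV1 sum_pmf_eq_1)

text \<open>The test \<open>T\<close> is any property implied by typicality, so that the division
  form of the decoder's test fits as well.\<close>

lemma atypical_lower:
  fixes V :: "'x \<Rightarrow> 's \<Rightarrow> 'b::finite pmf"
  assumes \<delta>: "0 < \<delta>"
  shows "\<exists>\<rho>. 0 < \<rho> \<and> \<rho> < 1 \<and> (\<forall>n T. (\<forall>u v x. (\<forall>i<n. 0 < q1 V (x ! i)) \<longrightarrow>
      2 powr (n * (info V - \<delta>)) \<le> (\<Prod>i<n. outV1 V (u ! i) (v ! i) (x ! i)) / (\<Prod>i<n. q1 V (x ! i)) \<longrightarrow> T u v x) \<longrightarrow>
     (\<Sum>u\<in>seqs n (set_pmf PU). \<Sum>v\<in>seqs n (set_pmf PV). \<Sum>x\<in>seqs n UNIV.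
     (\<Prod>i<n. pmf PU (u ! i) * pmf PV (v ! i) * outV1 V (u ! i) (v ! i) (x ! i)) * of_bool (\<not> T u v x)) \<le> \<rho> ^ n)"
proof -
  let ?p = "\<lambda>u v x. pmf PU u * pmf PV v * outV1 V u v x"
  \<comment> \<open>The negated density: the exponential bound handles upper tails only.\<close>
  let ?g = "\<lambda>u v x. log 2 (q1 V x / outV1 V u v x)"
  have g: "?p u v x * ?g u v x = - (?p u v x * log 2 (outV1 V u v x / q1 V x))"
    if "u \<in> set_pmf PU" "v \<in> set_pmf PV" for u v x
  proof (cases "0 < ?p u v x")
    case True
    from q1_pos[OF that True] show ?thesis by (simp add: log_divide algebra_simps)
  next
    case False
    then have "?p u v x = 0" using outV1_nonneg[of V u v x]
      by (metis mult_nonneg_nonneg pmf_nonneg order_le_less)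
    then show ?thesis by (simp only: mult_zero_left minus_zero)
  qed
  have "(\<Sum>u\<in>set_pmf PU. \<Sum>v\<in>set_pmf PV. \<Sum>x\<in>UNIV. ?p u v x * ?g u v x) = - info V"
    unfolding info_def by (simp add: g sum_negf)
  also have "\<dots> < - (info V - \<delta>)" using \<delta> by simp
  finally have mean: "(\<Sum>u\<in>set_pmf PU. \<Sum>v\<in>set_pmf PV. \<Sum>x\<in>UNIV. ?p u v x * ?g u v x) < - (info V - \<delta>)" .
  have p0: "0 \<le> ?p u v x" for u v x by (simp add: outV1_nonneg)
  obtain \<rho> where \<rho>: "0 < \<rho>" "\<rho> < 1" "\<And>n E. (\<forall>u\<in>seqs n (set_pmf PU). \<forall>v\<in>seqs n (set_pmf PV). \<forall>x\<in>seqs n UNIV.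
      E u v x \<longrightarrow> (\<forall>i<n. 0 < ?p (u ! i) (v ! i) (x ! i)) \<longrightarrow>
      n * (- (info V - \<delta>)) \<le> (\<Sum>i<n. ?g (u ! i) (v ! i) (x ! i))) \<Longrightarrow>
    (\<Sum>u\<in>seqs n (set_pmf PU). \<Sum>v\<in>seqs n (set_pmf PV). \<Sum>x\<in>seqs n UNIV.
      (\<Prod>i<n. ?p (u ! i) (v ! i) (x ! i)) * of_bool (E u v x)) \<le> \<rho> ^ n"
    using chernoff_seqs[OF finite_PU finite_PV finite[of UNIV] p0 joint_sum mean] by blast
  have "(\<Sum>u\<in>seqs n (set_pmf PU). \<Sum>v\<in>seqs n (set_pmf PV). \<Sum>x\<in>seqs n UNIV.
     (\<Prod>i<n. ?p (u ! i) (v ! i) (x ! i)) * of_bool (\<not> T u v x)) \<le> \<rho> ^ n"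
    if T: "\<forall>u v x. (\<forall>i<n. 0 < q1 V (x ! i)) \<longrightarrow>
      2 powr (n * (info V - \<delta>)) \<le> (\<Prod>i<n. outV1 V (u ! i) (v ! i) (x ! i)) / (\<Prod>i<n. q1 V (x ! i)) \<longrightarrow> T u v x" for n T
  proof (rule \<rho>(3), intro ballI impI)
    fix u v x assume m: "u \<in> seqs n (set_pmf PU)" "v \<in> seqs n (set_pmf PV)" and nT: "\<not> T u v x"
      and pos: "\<forall>i<n. 0 < ?p (u ! i) (v ! i) (x ! i)"
    have a: "0 < outV1 V (u ! i) (v ! i) (x ! i)" "0 < q1 V (x ! i)" if "i < n" for i
      using q1_pos[OF seqs_nth[OF m(1) that] seqs_nth[OF m(2) that], of V "x ! i"] pos that by auto
    have P: "0 < (\<Prod>i<n. q1 V (x ! i))" using a by (intro prod_pos) auto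
    have "(\<Prod>i<n. outV1 V (u ! i) (v ! i) (x ! i)) / (\<Prod>i<n. q1 V (x ! i)) < 2 powr (n * (info V - \<delta>))"
      using T nT a(2) by (meson not_less)
    then have "(\<Prod>i<n. outV1 V (u ! i) (v ! i) (x ! i)) < 2 powr (n * (info V - \<delta>)) * (\<Prod>i<n. q1 V (x ! i))"
      using P by (simp add: pos_divide_less_eq)
    then have "2 powr (n * (- (info V - \<delta>))) * (\<Prod>i<n. outV1 V (u ! i) (v ! i) (x ! i))
       \<le> 2 powr (n * (- (info V - \<delta>))) * (2 powr (n * (info V - \<delta>)) * (\<Prod>i<n. q1 V (x ! i)))"
      by (intro mult_left_mono) auto
    also have "\<dots> = (\<Prod>i<n. q1 V (x ! i))"
      by (simp only: powr_cancel)
    finally show "n * (- (info V - \<delta>)) \<le> (\<Sum>i<n. ?g (u ! i) (v ! i) (x ! i))"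
      using a by (intro log_prod_ratio_le) auto
  qed
  then show ?thesis using \<rho>(1,2) by blast
qed

lemma atypical_upper:
  fixes V :: "'x \<Rightarrow> 's \<Rightarrow> 'b::finite pmf"
  assumes \<delta>: "0 < \<delta>"
  shows "\<exists>\<rho>. 0 < \<rho> \<and> \<rho> < 1 \<and> (\<forall>n T. (\<forall>u v x.
      (\<Prod>i<n. outV1 V (u ! i) (v ! i) (x ! i)) \<le> 2 powr (n * (info V + \<delta>)) * (\<Prod>i<n. q1 V (x ! i)) \<longrightarrow> T u v x) \<longrightarrow>
     (\<Sum>u\<in>seqs n (set_pmf PU). \<Sum>v\<in>seqs n (set_pmf PV). \<Sum>x\<in>seqs n UNIV.
     (\<Prod>i<n. pmf PU (u ! i) * pmf PV (v ! i) * outV1 V (u ! i) (v ! i) (x ! i)) * of_bool (\<not> T u v x)) \<le> \<rho> ^ n)"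
proof -
  let ?p = "\<lambda>u v x. pmf PU u * pmf PV v * outV1 V u v x"
  let ?g = "\<lambda>u v x. log 2 (outV1 V u v x / q1 V x)"
  have mean: "(\<Sum>u\<in>set_pmf PU. \<Sum>v\<in>set_pmf PV. \<Sum>x\<in>UNIV. ?p u v x * ?g u v x) < info V + \<delta>"
    using \<delta> by (simp add: info_def)
  have p0: "0 \<le> ?p u v x" for u v x by (simp add: outV1_nonneg)
  obtain \<rho> where \<rho>: "0 < \<rho>" "\<rho> < 1" "\<And>n E. (\<forall>u\<in>seqs n (set_pmf PU). \<forall>v\<in>seqs n (set_pmf PV). \<forall>x\<in>seqs n UNIV.
      E u v x \<longrightarrow> (\<forall>i<n. 0 < ?p (u ! i) (v ! i) (x ! i)) \<longrightarrow>
      n * (info V + \<delta>) \<le> (\<Sum>i<n. ?g (u ! i) (v ! i) (x ! i))) \<Longrightarrow>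
    (\<Sum>u\<in>seqs n (set_pmf PU). \<Sum>v\<in>seqs n (set_pmf PV). \<Sum>x\<in>seqs n UNIV.
      (\<Prod>i<n. ?p (u ! i) (v ! i) (x ! i)) * of_bool (E u v x)) \<le> \<rho> ^ n"
    using chernoff_seqs[OF finite_PU finite_PV finite[of UNIV] p0 joint_sum mean] by blast
  have "(\<Sum>u\<in>seqs n (set_pmf PU). \<Sum>v\<in>seqs n (set_pmf PV). \<Sum>x\<in>seqs n UNIV.
     (\<Prod>i<n. ?p (u ! i) (v ! i) (x ! i)) * of_bool (\<not> T u v x)) \<le> \<rho> ^ n"
    if T: "\<forall>u v x. (\<Prod>i<n. outV1 V (u ! i) (v ! i) (x ! i)) \<le> 2 powr (n * (info V + \<delta>)) * (\<Prod>i<n. q1 V (x ! i)) \<longrightarrow> T u v x" for n T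
  proof (rule \<rho>(3), intro ballI impI)
    fix u v x assume m: "u \<in> seqs n (set_pmf PU)" "v \<in> seqs n (set_pmf PV)" and nT: "\<not> T u v x"
      and pos: "\<forall>i<n. 0 < ?p (u ! i) (v ! i) (x ! i)"
    have a: "0 < outV1 V (u ! i) (v ! i) (x ! i)" "0 < q1 V (x ! i)" if "i < n" for i
      using q1_pos[OF seqs_nth[OF m(1) that] seqs_nth[OF m(2) that], of V "x ! i"] pos that by auto
    have "2 powr (n * (info V + \<delta>)) * (\<Prod>i<n. q1 V (x ! i)) \<le> (\<Prod>i<n. outV1 V (u ! i) (v ! i) (x ! i))"
      using T nT by (meson not_less less_imp_le)
    then show "n * (info V + \<delta>) \<le> (\<Sum>i<n. ?g (u ! i) (v ! i) (x ! i))"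
      using a by (intro log_prod_ratio_le) auto
  qed
  then show ?thesis using \<rho>(1,2) by blast
qed

lemma seqs_unit: "seqs n {()} = {replicate n ()}"
proof -
  have "xs = replicate (length xs) ()" for xs :: "unit list" by (induction xs) auto
  then show ?thesis by (auto simp: seqs_def)
qed

lemma cover_rate:
  assumes g: "(\<Sum>v\<in>set_pmf PV. \<Sum>s\<in>UNIV. pmf PV v * pmf (PSV v) s * g v s) < c"
  shows "\<exists>\<rho>. 0 < \<rho> \<and> \<rho> < 1 \<and> (\<forall>n E. (\<forall>v\<in>seqs n (set_pmf PV). \<forall>s\<in>seqs n UNIV. E v s \<longrightarrow>
      (\<forall>i<n. 0 < pmf (PSV (v ! i)) (s ! i) \<and> 0 < pmf QS (s ! i)) \<longrightarrow> n * c \<le> (\<Sum>i<n. g (v ! i) (s ! i))) \<longrightarrow>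
    fexp (replicate_pmf n PV) (\<lambda>v. \<Sum>s\<in>seqs n UNIV. PSn n v s * of_bool (E v s)) \<le> \<rho> ^ n)"
proof -
  \<comment> \<open>A one-point first alphabet lets the three-alphabet bound serve the pair
    (V,S).\<close>
  let ?p = "\<lambda>(a::unit) v s. pmf PV v * pmf (PSV v) s"
  have p0: "0 \<le> ?p a v s" for a v s by simp
  have p1: "(\<Sum>a\<in>{()}. \<Sum>v\<in>set_pmf PV. \<Sum>s\<in>UNIV. ?p a v s) = 1"
    using finite_PV by (simp add: sum_distrib_left[symmetric] sum_pmf_UNIV sum_pmf_eq_1)
  have mean: "(\<Sum>a\<in>{()}. \<Sum>v\<in>set_pmf PV. \<Sum>s\<in>UNIV. ?p a v s * g v s) < c" using g by simp
  obtain \<rho> where \<rho>: "0 < \<rho>" "\<rho> < 1" "\<And>n E. (\<forall>a\<in>seqs n {()}. \<forall>v\<in>seqs n (set_pmf PV). \<forall>s\<in>seqs n UNIV.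
      E a v s \<longrightarrow> (\<forall>i<n. 0 < ?p (a ! i) (v ! i) (s ! i)) \<longrightarrow>
      n * c \<le> (\<Sum>i<n. g (v ! i) (s ! i))) \<Longrightarrow>
    (\<Sum>a\<in>seqs n {()}. \<Sum>v\<in>seqs n (set_pmf PV). \<Sum>s\<in>seqs n UNIV.
      (\<Prod>i<n. ?p (a ! i) (v ! i) (s ! i)) * of_bool (E a v s)) \<le> \<rho> ^ n"
    using chernoff_seqs[OF _ finite_PV finite[of UNIV] p0 p1 mean] by blast
  have "fexp (replicate_pmf n PV) (\<lambda>v. \<Sum>s\<in>seqs n UNIV. PSn n v s * of_bool (E v s)) \<le> \<rho> ^ n"
    if E: "\<forall>v\<in>seqs n (set_pmf PV). \<forall>s\<in>seqs n UNIV. E v s \<longrightarrow>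
      (\<forall>i<n. 0 < pmf (PSV (v ! i)) (s ! i) \<and> 0 < pmf QS (s ! i)) \<longrightarrow> n * c \<le> (\<Sum>i<n. g (v ! i) (s ! i))" for n E
  proof -
    have "fexp (replicate_pmf n PV) (\<lambda>v. \<Sum>s\<in>seqs n UNIV. PSn n v s * of_bool (E v s))
      = (\<Sum>a\<in>seqs n {()}. \<Sum>v\<in>seqs n (set_pmf PV). \<Sum>s\<in>seqs n UNIV.
      (\<Prod>i<n. ?p (a ! i) (v ! i) (s ! i)) * of_bool (E v s))"
      unfolding seqs_unit fexp_replicate_pmf PSn_def prod.distrib
      by (simp only: sum_distrib_left mult.assoc sum.insert sum.empty finite.emptyI empty_iff not_False_eq_True add_0_right)
    also have "\<dots> \<le> \<rho> ^ n"
    proof (rule \<rho>(3), intro ballI impI)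
      fix a v s assume m: "v \<in> seqs n (set_pmf PV)" "s \<in> seqs n UNIV" "E v s"
        and pos: "\<forall>i<n. 0 < ?p (a ! i) (v ! i) (s ! i)"
      have "0 < pmf (PSV (v ! i)) (s ! i) \<and> 0 < pmf QS (s ! i)" if "i < n" for i
      proof -
        have p: "0 < pmf PV (v ! i) * pmf (PSV (v ! i)) (s ! i)" using pos that by auto
        also have "\<dots> \<le> pmf QS (s ! i)"
          unfolding QS_eq fexp_def using finite_PV seqs_nth[OF m(1) that] by (intro member_le_sum) auto
        finally show ?thesis using p by (auto simp: zero_less_mult_iff)
      qed
      then show "n * c \<le> (\<Sum>i<n. g (v ! i) (s ! i))" using E m by blast
    qed
    finally show ?thesis .
  qed
  then show ?thesis using \<rho>(1,2) by blast
qed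

text \<open>Both tails of the density of I(V;S) are needed: the lower one makes a pair good, the
  upper one bounds how many candidates covering takes.\<close>

lemma cover_exponent:
  assumes \<epsilon>: "0 < \<epsilon>"
  shows "\<exists>\<rho>. 0 < \<rho> \<and> \<rho> < 1 \<and> (\<forall>n.
    fexp (replicate_pmf n PV) (\<lambda>v. \<Sum>s\<in>seqs n UNIV. PSn n v s *
      of_bool (\<not> iid_prob QS n s * 2 powr (n * (infoS - \<epsilon>)) \<le> PSn n v s)) \<le> \<rho> ^ n \<and>
    fexp (replicate_pmf n PV) (\<lambda>v. \<Sum>s\<in>seqs n UNIV. PSn n v s *
      of_bool (\<not> PSn n v s \<le> 2 powr (n * (infoS + \<epsilon>)) * iid_prob QS n s)) \<le> \<rho> ^ n)"
proof -
  let ?p = "\<lambda>v s. pmf PV v * pmf (PSV v) s"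
  let ?g = "\<lambda>v s. log 2 (pmf (PSV v) s / pmf QS s)"
  let ?h = "\<lambda>v s. log 2 (pmf QS s / pmf (PSV v) s)"
  have h: "?p v s * ?h v s = - (?p v s * ?g v s)" if v: "v \<in> set_pmf PV" for v s
  proof (cases "pmf (PSV v) s = 0")
    case False
    have "?p v s \<le> pmf QS s" unfolding QS_eq fexp_def using finite_PV v by (intro member_le_sum) auto
    moreover have "0 < ?p v s" using False v by (simp add: set_pmf_iff less_le)
    ultimately have "0 < pmf QS s" by linarith
    then show ?thesis using False by (simp add: log_divide less_le algebra_simps)
  qed simp
  have "(\<Sum>v\<in>set_pmf PV. \<Sum>s\<in>UNIV. ?p v s * ?h v s) = - infoS"
    unfolding infoS_def by (simp add: h sum_negf)
  then have "(\<Sum>v\<in>set_pmf PV. \<Sum>s\<in>UNIV. ?p v s * ?h v s) < - (infoS - \<epsilon>)" using \<epsilon> by simp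
  from cover_rate[OF this] obtain \<rho>1 where \<rho>1: "0 < \<rho>1" "\<rho>1 < 1"
    "\<forall>n E. (\<forall>v\<in>seqs n (set_pmf PV). \<forall>s\<in>seqs n UNIV. E v s \<longrightarrow>
      (\<forall>i<n. 0 < pmf (PSV (v ! i)) (s ! i) \<and> 0 < pmf QS (s ! i)) \<longrightarrow> n * (- (infoS - \<epsilon>)) \<le> (\<Sum>i<n. ?h (v ! i) (s ! i))) \<longrightarrow>
    fexp (replicate_pmf n PV) (\<lambda>v. \<Sum>s\<in>seqs n UNIV. PSn n v s * of_bool (E v s)) \<le> \<rho>1 ^ n" by blast
  have "(\<Sum>v\<in>set_pmf PV. \<Sum>s\<in>UNIV. ?p v s * ?g v s) < infoS + \<epsilon>"
    using \<epsilon> by (simp add: infoS_def)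
  from cover_rate[OF this] obtain \<rho>2 where \<rho>2: "0 < \<rho>2" "\<rho>2 < 1"
    "\<forall>n E. (\<forall>v\<in>seqs n (set_pmf PV). \<forall>s\<in>seqs n UNIV. E v s \<longrightarrow>
      (\<forall>i<n. 0 < pmf (PSV (v ! i)) (s ! i) \<and> 0 < pmf QS (s ! i)) \<longrightarrow> n * (infoS + \<epsilon>) \<le> (\<Sum>i<n. ?g (v ! i) (s ! i))) \<longrightarrow>
    fexp (replicate_pmf n PV) (\<lambda>v. \<Sum>s\<in>seqs n UNIV. PSn n v s * of_bool (E v s)) \<le> \<rho>2 ^ n" by blast
  have 1: "fexp (replicate_pmf n PV) (\<lambda>v. \<Sum>s\<in>seqs n UNIV. PSn n v s *
      of_bool (\<not> iid_prob QS n s * 2 powr (n * (infoS - \<epsilon>)) \<le> PSn n v s)) \<le> \<rho>1 ^ n" for n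
  proof (rule \<rho>1(3)[THEN spec, THEN spec, THEN mp], intro ballI impI)
    fix v s assume nE: "\<not> iid_prob QS n s * 2 powr (n * (infoS - \<epsilon>)) \<le> PSn n v s"
      and pos: "\<forall>i<n. 0 < pmf (PSV (v ! i)) (s ! i) \<and> 0 < pmf QS (s ! i)"
    have "2 powr (n * (- (infoS - \<epsilon>))) * (\<Prod>i<n. pmf (PSV (v ! i)) (s ! i))
       \<le> 2 powr (n * (- (infoS - \<epsilon>))) * (2 powr (n * (infoS - \<epsilon>)) * (\<Prod>i<n. pmf QS (s ! i)))"
      using nE by (intro mult_left_mono) (auto simp: iid_prob_def PSn_def mult.commute)
    also have "\<dots> = (\<Prod>i<n. pmf QS (s ! i))"
      by (simp only: powr_cancel)
    finally show "n * (- (infoS - \<epsilon>)) \<le> (\<Sum>i<n. ?h (v ! i) (s ! i))"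
      using pos by (intro log_prod_ratio_le) auto
  qed
  have 2: "fexp (replicate_pmf n PV) (\<lambda>v. \<Sum>s\<in>seqs n UNIV. PSn n v s *
      of_bool (\<not> PSn n v s \<le> 2 powr (n * (infoS + \<epsilon>)) * iid_prob QS n s)) \<le> \<rho>2 ^ n" for n
  proof (rule \<rho>2(3)[THEN spec, THEN spec, THEN mp], intro ballI impI)
    fix v s assume nE: "\<not> PSn n v s \<le> 2 powr (n * (infoS + \<epsilon>)) * iid_prob QS n s"
      and pos: "\<forall>i<n. 0 < pmf (PSV (v ! i)) (s ! i) \<and> 0 < pmf QS (s ! i)"
    then have "2 powr (n * (infoS + \<epsilon>)) * (\<Prod>i<n. pmf QS (s ! i)) \<le> (\<Prod>i<n. pmf (PSV (v ! i)) (s ! i))"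
      by (simp add: iid_prob_def PSn_def)
    then show "n * (infoS + \<epsilon>) \<le> (\<Sum>i<n. ?g (v ! i) (s ! i))"
      using pos by (intro log_prod_ratio_le) auto
  qed
  have le: "\<rho>1 ^ n \<le> max \<rho>1 \<rho>2 ^ n" "\<rho>2 ^ n \<le> max \<rho>1 \<rho>2 ^ n" for n
    using \<rho>1(1) \<rho>2(1) by (auto intro!: power_mono)
  show ?thesis using \<rho>1(1,2) \<rho>2(1,2) order.trans[OF 1 le(1)] order.trans[OF 2 le(2)]
    by (intro exI[of _ "max \<rho>1 \<rho>2"]) auto
qed

text \<open>Keeps the target size of the index set at least 1, so that rounding it up at most
  doubles it.\<close>

lemma infoS_nonneg: "0 \<le> infoS"
proof -
  have "0 \<le> (\<Sum>s\<in>UNIV. pmf (PSV v) s * log 2 (pmf (PSV v) s / pmf QS s))" if v: "v \<in> set_pmf PV" for v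
  proof (rule gibbs)
    fix s assume "0 < pmf (PSV v) s"
    then have "0 < pmf PV v * pmf (PSV v) s" using v by (simp add: pmf_positive)
    also have "\<dots> \<le> pmf QS s" unfolding QS_eq fexp_def using finite_PV v by (intro member_le_sum) auto
    finally show "0 < pmf QS s" .
  qed (auto simp: sum_pmf_UNIV)
  then have "0 \<le> (\<Sum>v\<in>set_pmf PV. pmf PV v * (\<Sum>s\<in>UNIV. pmf (PSV v) s * log 2 (pmf (PSV v) s / pmf QS s)))"
    by (simp add: sum_nonneg)
  then show ?thesis by (simp add: infoS_def sum_distrib_left mult.assoc)
qed

end

section \<open>Choice of parameters for the block codes\<close>

context aux_setting
begin

definition code_cost :: "real \<Rightarrow> ('x \<Rightarrow> 's \<Rightarrow> 'y pmf) \<Rightarrow> ('x \<Rightarrow> 's \<Rightarrow> 'z pmf) \<Rightarrow> nat \<Rightarrow> nat \<Rightarrow> nat \<Rightarrow>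
    (nat \<Rightarrow> 's list list \<Rightarrow> 'u list) \<Rightarrow> ('y list list \<Rightarrow> nat) \<Rightarrow> real" where
  "code_cost w VY VZ L n M U dec =
     (1 / M) * (\<Sum>m<M. \<Sum>ss\<in>seqs L (seqs n UNIV). \<Sum>ys\<in>seqs L (seqs n UNIV).
        block_prob (iid_prob QS n) (Wn VY n) (U m) ss ys * of_bool (dec ys \<noteq> m))
     + w * (\<Sum>zs\<in>seqs L (seqs n UNIV). \<bar>(1 / M) * (\<Sum>m<M. \<Sum>ss\<in>seqs L (seqs n UNIV).
        block_prob (iid_prob QS n) (Wn VZ n) (U m) ss zs) - prod_list (map (\<lambda>z. \<Prod>i<n. q1 VZ (z ! i)) zs)\<bar>)"

lemma nat_ceiling_bounds:
  fixes x :: real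
  assumes "1 \<le> x"
  shows "x \<le> nat \<lceil>x\<rceil>" "nat \<lceil>x\<rceil> \<le> 2 * x" "0 < nat \<lceil>x\<rceil>"
proof -
  have "real (nat \<lceil>x\<rceil>) = of_int \<lceil>x\<rceil>" using assms by simp
  moreover have "x \<le> of_int \<lceil>x\<rceil>" "of_int \<lceil>x\<rceil> \<le> x + 1" by auto
  ultimately show "x \<le> nat \<lceil>x\<rceil>" "nat \<lceil>x\<rceil> \<le> 2 * x" using assms by linarith+
  show "0 < nat \<lceil>x\<rceil>" using assms by simp
qed

lemma num_msgs_bounds:
  assumes "0 \<le> R"
  shows "2 powr (real n * R) \<le> num_msgs R n" "num_msgs R n \<le> 2 * 2 powr (real n * R)" "0 < num_msgs R n"
proof -
  have "1 \<le> 2 powr (real n * R)" using assms by (simp add: ge_one_powr_ge_zero)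
  then show "2 powr (real n * R) \<le> num_msgs R n" "num_msgs R n \<le> 2 * 2 powr (real n * R)" "0 < num_msgs R n"
    unfolding num_msgs_def by (fact nat_ceiling_bounds)+
qed

text \<open>Instantiates the one-shot bound with \<gamma>, \<gamma>' = 2^{n(I(V;S) -+ \<epsilon>)}
  and with \<tau>, \<eta> just below and just above the typical likelihood ratios. \<open>L\<close>
  is still arbitrary; \<open>Mlow\<close> states what covertness asks of the number of
  messages.\<close>

lemma block_code_bound:
  fixes VY :: "'x \<Rightarrow> 's \<Rightarrow> 'y::finite pmf" and VZ :: "'x \<Rightarrow> 's \<Rightarrow> 'z::finite pmf"
  assumes pos: "\<And>z. 0 < q1 VZ z"
    and dm: "\<And>u z. out1 VZ u z \<le> 2 powr d * q1 VZ z"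
    and \<epsilon>: "0 < \<epsilon>" and M: "0 < M"
    and Mlow: "\<And>j::nat. j < L \<Longrightarrow> 2 powr (n * (d + j * (info VZ + \<delta> - infoS + \<epsilon>) + 2)) \<le> M"
    and \<rho>Y: "\<And>T. (\<forall>u v x. (\<forall>i<n. 0 < q1 VY (x ! i)) \<longrightarrow>
      2 powr (n * (info VY - \<delta>)) \<le> (\<Prod>i<n. outV1 VY (u ! i) (v ! i) (x ! i)) / (\<Prod>i<n. q1 VY (x ! i)) \<longrightarrow> T u v x) \<Longrightarrow>
     (\<Sum>u\<in>seqs n (set_pmf PU). \<Sum>v\<in>seqs n (set_pmf PV). \<Sum>x\<in>seqs n UNIV.
     (\<Prod>i<n. pmf PU (u ! i) * pmf PV (v ! i) * outV1 VY (u ! i) (v ! i) (x ! i)) * of_bool (\<not> T u v x)) \<le> rY"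
    and \<rho>Z: "\<And>T. (\<forall>u v x.
      (\<Prod>i<n. outV1 VZ (u ! i) (v ! i) (x ! i)) \<le> 2 powr (n * (info VZ + \<delta>)) * (\<Prod>i<n. q1 VZ (x ! i)) \<longrightarrow> T u v x) \<Longrightarrow>
     (\<Sum>u\<in>seqs n (set_pmf PU). \<Sum>v\<in>seqs n (set_pmf PV). \<Sum>x\<in>seqs n UNIV.
     (\<Prod>i<n. pmf PU (u ! i) * pmf PV (v ! i) * outV1 VZ (u ! i) (v ! i) (x ! i)) * of_bool (\<not> T u v x)) \<le> rZ"
    and cov: "fexp (replicate_pmf n PV) (\<lambda>v. \<Sum>s\<in>seqs n UNIV. PSn n v s *
      of_bool (\<not> iid_prob QS n s * 2 powr (n * (infoS - \<epsilon>)) \<le> PSn n v s)) \<le> rS"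
    "fexp (replicate_pmf n PV) (\<lambda>v. \<Sum>s\<in>seqs n UNIV. PSn n v s *
      of_bool (\<not> PSn n v s \<le> 2 powr (n * (infoS + \<epsilon>)) * iid_prob QS n s)) \<le> rS"
    and w: "0 \<le> w"
  defines "c \<equiv> 2 * rS + 2 powr (- (n * \<epsilon>))"
  shows "\<exists>U dec. code_cost w VY VZ L n M U dec \<le>
      L * (c + 2 * 2 powr (3 * \<epsilon> * n) * rY)
      + real M * 2 ^ L * 2 powr (n * (L * (infoS + 2 * \<epsilon> - info VY + \<delta>)))
      + w * (L * (2 * (L * (c + 2 * 2 powr (3 * \<epsilon> * n) * rZ)) + 2 powr (- real n)))"
proof -
  \<comment> \<open>The margin 2 \<epsilon> puts \<open>K\<close> a factor 2^{n \<epsilon>} above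
    \<gamma>', so covering succeeds, and only about 2^{3 n \<epsilon>} above \<gamma>, the price in
    \<open>K / \<gamma>\<close>.\<close>
  define K where "K = nat \<lceil>2 powr (n * (infoS + 2 * \<epsilon>))\<rceil>"
  have "1 \<le> 2 powr (n * (infoS + 2 * \<epsilon>))" using infoS_nonneg \<epsilon> by (intro ge_one_powr_ge_zero) auto
  then have K: "0 < K" "2 powr (n * (infoS + 2 * \<epsilon>)) \<le> K" "K \<le> 2 * 2 powr (n * (infoS + 2 * \<epsilon>))"
    unfolding K_def by (fact nat_ceiling_bounds)+
  define \<gamma> where "\<gamma> = 2 powr (n * (infoS - \<epsilon>))"
  define \<gamma>' where "\<gamma>' = 2 powr (n * (infoS + \<epsilon>))"
  define \<tau> where "\<tau> = 2 powr (n * (info VY - \<delta>))"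
  define \<eta> where "\<eta> = 2 powr (n * (info VZ + \<delta>))"
  have g: "0 < \<gamma>" "0 < \<gamma>'" "0 < \<tau>" "0 < \<eta>" by (auto simp: \<gamma>_def \<gamma>'_def \<tau>_def \<eta>_def)
  interpret tree_two_channels "replicate_pmf n PU" "replicate_pmf n PV" "iid_prob QS n" "seqs n UNIV" "PSn n" K M \<gamma>
    "seqs n UNIV" "Wn VY n" "seqs n UNIV" "Wn VZ n"
    by (intro tree_two_channels.intro tree_channel_Wn K(1) M g(1))
  note Ysimps = Wn_simps[OF K(1) M g(1), where V = VY and n = n]
  note Zsimps = Wn_simps[OF K(1) M g(1), where V = VZ and n = n]
  define TY where "TY u v y \<longleftrightarrow> \<tau> \<le> Y.outV u v y / Y.Qo y" for u v y
  define TZ where "TZ u v z \<longleftrightarrow> Z.outV u v z \<le> \<eta> * Z.Qo z" for u v z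
  have aY: "Y.atypical TY \<le> rY"
    unfolding Ysimps(4) by (rule \<rho>Y) (auto simp: TY_def Ysimps \<tau>_def)
  have aZ: "Z.atypical TZ \<le> rZ"
    unfolding Zsimps(4) by (rule \<rho>Z) (auto simp: TZ_def Zsimps \<eta>_def)
  have PSsum: "sum (PSn n v) (seqs n UNIV) = 1" for v
    unfolding PSn_def sum_seqs_prod[where f = "\<lambda>i. pmf (PSV (v ! i))"] by (simp add: sum_pmf_UNIV)
  have KG: "K / \<gamma> \<le> 2 * 2 powr (3 * \<epsilon> * n)"
  proof -
    have "K / \<gamma> \<le> 2 * 2 powr (n * (infoS + 2 * \<epsilon>)) / \<gamma>" using K(3) g by (intro divide_right_mono) auto
    also have "\<dots> = 2 * 2 powr (n * (infoS + 2 * \<epsilon>) - n * (infoS - \<epsilon>))" by (simp add: \<gamma>_def powr_diff)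
    also have "n * (infoS + 2 * \<epsilon>) - n * (infoS - \<epsilon>) = 3 * \<epsilon> * n" by (simp add: algebra_simps)
    finally show ?thesis .
  qed
  have cf: "Y.cover_fail \<le> c"
  proof -
    have "Y.cover_fail \<le> rS + rS + exp (- (K / \<gamma>'))"
      using Y.cover_fail_le[OF g(2) PSsum] cov unfolding Y.good_def \<gamma>_def[symmetric] \<gamma>'_def[symmetric] by linarith
    moreover have "exp (- (K / \<gamma>')) \<le> 2 powr (- (n * \<epsilon>))"
    proof -
      have "2 powr (n * \<epsilon>) = 2 powr (n * (infoS + 2 * \<epsilon>) - n * (infoS + \<epsilon>))" by (simp add: algebra_simps)
      also have "\<dots> = 2 powr (n * (infoS + 2 * \<epsilon>)) / \<gamma>'" by (simp add: powr_diff \<gamma>'_def)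
      also have "\<dots> \<le> K / \<gamma>'" using K(2) g by (intro divide_right_mono) auto
      \<comment> \<open>A doubly exponential decay is deliberately weakened to 2^{-n \<epsilon>},
        which is enough.\<close>
      also have "\<dots> \<le> exp (K / \<gamma>')" using exp_ge_add_one_self[of "K / \<gamma>'"] by linarith
      finally have "inverse (exp (K / \<gamma>')) \<le> inverse (2 powr (n * \<epsilon>))"
        by (intro le_imp_inverse_le) auto
      then show ?thesis by (simp add: exp_minus powr_minus)
    qed
    ultimately show ?thesis by (simp add: c_def)
  qed
  have D: "Z.out u z \<le> 2 powr (n * d) * Z.Qo z" for u z
  proof -
    have "Z.out u z \<le> (\<Prod>i<n. 2 powr d * q1 VZ (z ! i))"
      unfolding Zsimps using dm by (intro prod_mono) (auto simp: out1_def intro!: sum_nonneg)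
    also have "\<dots> = 2 powr (n * d) * Z.Qo z"
      unfolding Zsimps by (simp add: prod.distrib two_powr_power)
    finally show ?thesis .
  qed
  \<comment> \<open>The soft-covering error is set to 2^{-n}; its square 2^{-2n} is what the summand
    2 in \<open>Mlow\<close> pays for.\<close>
  have \<theta>: "2 powr (n * d) * ((\<eta> / \<gamma>) ^ j / M) \<le> (2 powr (- real n))\<^sup>2" if j: "j < L" for j
  proof -
    have "\<eta> / \<gamma> = 2 powr (n * (info VZ + \<delta> - infoS + \<epsilon>))"
      unfolding \<eta>_def \<gamma>_def powr_diff[symmetric] by (simp add: algebra_simps)
    then have "(\<eta> / \<gamma>) ^ j = 2 powr (n * (info VZ + \<delta> - infoS + \<epsilon>) * j)"
      by (simp add: two_powr_power mult.commute)
    then have "2 powr (n * d) * (\<eta> / \<gamma>) ^ j = 2 powr (n * (d + j * (info VZ + \<delta> - infoS + \<epsilon>) + 2)) * 2 powr (- 2 * real n)"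
      by (simp only: powr_add[symmetric]) (simp add: algebra_simps)
    also have "\<dots> \<le> M * 2 powr (- 2 * real n)" by (rule mult_right_mono[OF Mlow[OF j]]) simp
    also have "2 powr (- 2 * real n) = (2 powr (- real n))\<^sup>2"
      by (simp add: two_powr_power)
    finally have "2 powr (n * d) * (\<eta> / \<gamma>) ^ j / M \<le> (2 powr (- real n))\<^sup>2"
      using M by (simp only: pos_divide_le_eq of_nat_0_less_iff mult.commute)
    then show ?thesis by simp
  qed
  have posQ: "0 < Z.Qo z" for z unfolding Zsimps by (intro prod_pos) (auto simp: pos)
  have "\<exists>U dec. code_cost w VY VZ L n M U dec
    \<le> L * (Y.cover_fail + K / \<gamma> * Y.atypical TY) + real M * real K ^ L / \<tau> ^ L
      + w * (L * (2 * (L * (Y.cover_fail + K / \<gamma> * Z.atypical TZ)) + 2 powr (- real n)))"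
    unfolding code_cost_def Zsimps(3)[symmetric]
    by (rule good_code_exists[where D = "2 powr (n * d)" and \<eta> = \<eta>])
      (use g D posQ \<theta> w in \<open>auto simp: TY_def TZ_def\<close>)
  then obtain U dec where U: "code_cost w VY VZ L n M U dec
    \<le> L * (Y.cover_fail + K / \<gamma> * Y.atypical TY) + real M * real K ^ L / \<tau> ^ L
      + w * (L * (2 * (L * (Y.cover_fail + K / \<gamma> * Z.atypical TZ)) + 2 powr (- real n)))" by blast
  have bY: "Y.cover_fail + K / \<gamma> * Y.atypical TY \<le> c + 2 * 2 powr (3 * \<epsilon> * n) * rY"
    using Y.atypical_nonneg[of TY] g K by (intro add_mono cf mult_mono KG aY) auto
  have bZ: "Y.cover_fail + K / \<gamma> * Z.atypical TZ \<le> c + 2 * 2 powr (3 * \<epsilon> * n) * rZ"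
    using Z.atypical_nonneg[of TZ] g K by (intro add_mono cf mult_mono KG aZ) auto
  have "real M * real K ^ L / \<tau> ^ L \<le> real M * (2 * 2 powr (n * (infoS + 2 * \<epsilon>))) ^ L / \<tau> ^ L"
    using K(3) g by (intro divide_right_mono mult_left_mono power_mono) auto
  also have "\<dots> = real M * 2 ^ L * ((2 powr (n * (infoS + 2 * \<epsilon>)) / \<tau>) ^ L)"
    by (simp add: power_mult_distrib power_divide)
  also have "2 powr (n * (infoS + 2 * \<epsilon>)) / \<tau> = 2 powr (n * (infoS + 2 * \<epsilon> - info VY + \<delta>))"
    unfolding \<tau>_def powr_diff[symmetric] by (simp add: algebra_simps)
  also have "\<dots> ^ L = 2 powr (n * (L * (infoS + 2 * \<epsilon> - info VY + \<delta>)))"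
    by (simp add: two_powr_power mult_ac)
  finally have "real M * real K ^ L / \<tau> ^ L \<le> real M * 2 ^ L * 2 powr (n * (L * (infoS + 2 * \<epsilon> - info VY + \<delta>)))" .
  then have "code_cost w VY VZ L n M U dec \<le>
      L * (c + 2 * 2 powr (3 * \<epsilon> * n) * rY)
      + real M * 2 ^ L * 2 powr (n * (L * (infoS + 2 * \<epsilon> - info VY + \<delta>)))
      + w * (L * (2 * (L * (c + 2 * 2 powr (3 * \<epsilon> * n) * rZ)) + 2 powr (- real n)))"
    by (intro order.trans[OF U] add_mono mult_left_mono bY bZ w) auto
  then show ?thesis by blast
qed

lemma out1_le_q1:
  fixes V :: "'x \<Rightarrow> 's \<Rightarrow> 'z::finite pmf"
  assumes pos: "\<And>z. 0 < q1 V z"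
  shows "\<exists>d. \<forall>u z. out1 V u z \<le> 2 powr d * q1 V z"
proof -
  define D where "D = (\<Sum>z\<in>UNIV. 1 / q1 V z)"
  have D: "1 / q1 V z \<le> D" for z
    unfolding D_def using pos by (intro member_le_sum) (auto simp: less_imp_le)
  have "0 < 1 / q1 V undefined" using pos by simp
  with D[of undefined] have D0: "0 < D" by linarith
  have "out1 V u z \<le> D * q1 V z" for u z
  proof -
    have "out1 V u z \<le> (\<Sum>s\<in>UNIV. pmf QS s)"
      unfolding out1_def by (intro sum_mono mult_left_le pmf_le_1) auto
    also have "\<dots> = (1 / q1 V z) * q1 V z" using pos[of z] by (simp add: sum_pmf_UNIV)
    also have "\<dots> \<le> D * q1 V z" using D pos[of z] by (intro mult_right_mono) auto
    finally show ?thesis .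
  qed
  then show ?thesis using D0 by (intro exI[of _ "log 2 D"]) simp
qed

text \<open>The rate spends 3 \<delta>: one for decoder typicality, at most one for the surplus 2
  \<epsilon> of the index rate, and one left as decay. The gap of 5 \<delta> covers these 3
  \<delta>, the warden's typicality margin and \<epsilon>.\<close>

lemma block_codes:
  fixes VY :: "'x \<Rightarrow> 's \<Rightarrow> 'y::finite pmf" and VZ :: "'x \<Rightarrow> 's \<Rightarrow> 'z::finite pmf"
  assumes pos: "\<And>z. 0 < q1 VZ z"
    and \<delta>: "0 < \<delta>" "3 * \<delta> < info VY - infoS" "5 * \<delta> < info VY - info VZ"
  defines "R \<equiv> info VY - infoS - 3 * \<delta>"
  shows "\<exists>L B \<rho>. 0 < L \<and> 0 < \<rho> \<and> \<rho> < 1 \<and> (\<forall>n w. 0 \<le> w \<longrightarrow>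
    (\<exists>U dec. code_cost w VY VZ L (n div L) (num_msgs R n) U dec \<le> B * (1 + w) * \<rho> ^ (n div L)))"
proof -
  have R: "0 < R" using \<delta> by (simp add: R_def)
  obtain rY where rY: "0 < rY" "rY < 1" and HY: "\<And>n T. (\<forall>u v x. (\<forall>i<n. 0 < q1 VY (x ! i)) \<longrightarrow>
      2 powr (n * (info VY - \<delta>)) \<le> (\<Prod>i<n. outV1 VY (u ! i) (v ! i) (x ! i)) / (\<Prod>i<n. q1 VY (x ! i)) \<longrightarrow> T u v x) \<Longrightarrow>
     (\<Sum>u\<in>seqs n (set_pmf PU). \<Sum>v\<in>seqs n (set_pmf PV). \<Sum>x\<in>seqs n UNIV.
     (\<Prod>i<n. pmf PU (u ! i) * pmf PV (v ! i) * outV1 VY (u ! i) (v ! i) (x ! i)) * of_bool (\<not> T u v x)) \<le> rY ^ n"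
    using atypical_lower[OF \<delta>(1), of VY] by blast
  obtain rZ where rZ: "0 < rZ" "rZ < 1" and HZ: "\<And>n T. (\<forall>u v x.
      (\<Prod>i<n. outV1 VZ (u ! i) (v ! i) (x ! i)) \<le> 2 powr (n * (info VZ + \<delta>)) * (\<Prod>i<n. q1 VZ (x ! i)) \<longrightarrow> T u v x) \<Longrightarrow>
     (\<Sum>u\<in>seqs n (set_pmf PU). \<Sum>v\<in>seqs n (set_pmf PV). \<Sum>x\<in>seqs n UNIV.
     (\<Prod>i<n. pmf PU (u ! i) * pmf PV (v ! i) * outV1 VZ (u ! i) (v ! i) (x ! i)) * of_bool (\<not> T u v x)) \<le> rZ ^ n"
    using atypical_upper[OF \<delta>(1), of VZ] by blast
  define r where "r = max rY rZ"
  have r: "0 < r" "r < 1" "rY \<le> r" "rZ \<le> r" using rY rZ by (auto simp: r_def)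
  have lr: "log 2 r < 0" using r by simp
  \<comment> \<open>\<epsilon> is chosen after the atypicality rate \<open>r\<close>, small enough
    that the loss 2^{3 \<epsilon>} per letter does not cancel the gain \<open>r\<close>; the
    covering rate \<open>rS\<close> then depends on \<epsilon>.\<close>
  define \<epsilon> where "\<epsilon> = min (\<delta> / 2) (- log 2 r / 6)"
  have \<epsilon>: "0 < \<epsilon>" "\<epsilon> \<le> \<delta> / 2" "3 * \<epsilon> + log 2 r < 0" using \<delta>(1) lr by (auto simp: \<epsilon>_def)
  have re: "2 powr (3 * \<epsilon>) * r < 1"
  proof -
    have "2 powr (3 * \<epsilon>) * r = 2 powr (3 * \<epsilon> + log 2 r)" using r(1) by (simp add: powr_add)
    also have "\<dots> < 2 powr 0" using \<epsilon>(3) by (intro powr_less_mono) auto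
    finally show ?thesis by simp
  qed
  obtain rS where rS: "0 < rS" "rS < 1" and HS: "\<And>n.
    fexp (replicate_pmf n PV) (\<lambda>v. \<Sum>s\<in>seqs n UNIV. PSn n v s *
      of_bool (\<not> iid_prob QS n s * 2 powr (n * (infoS - \<epsilon>)) \<le> PSn n v s)) \<le> rS ^ n"
    "\<And>n. fexp (replicate_pmf n PV) (\<lambda>v. \<Sum>s\<in>seqs n UNIV. PSn n v s *
      of_bool (\<not> PSn n v s \<le> 2 powr (n * (infoS + \<epsilon>)) * iid_prob QS n s)) \<le> rS ^ n"
    using cover_exponent[OF \<epsilon>(1)] by blast
  obtain d where d: "\<And>u z. out1 VZ u z \<le> 2 powr d * q1 VZ z" using out1_le_q1[of VZ] pos by blast
  \<comment> \<open>With this margin the growth rate of the warden's likelihood bound is at most R -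
    c. The bound c <= R keeps R - c nonnegative, so replacing j by \<open>L\<close> in the estimate
    is monotone.\<close>
  define c where "c = min R (info VY - info VZ - 5 * \<delta>)"
  have c: "0 < c" "c \<le> R" "c \<le> info VY - info VZ - 5 * \<delta>" using R \<delta> by (auto simp: c_def)
  define L where "L = nat \<lceil>(d + 2) / c\<rceil> + 1"
  have L: "0 < L" by (simp add: L_def)
  have "(d + 2) / c \<le> L" unfolding L_def by linarith
  then have Lc: "d + 2 \<le> L * c" using c(1) by (simp add: field_simps)
  \<comment> \<open>The slowest of the five decays: covering tails, covering failure, atypicality
    after the loss 2^{3 \<epsilon>}, decoding, and 1/2 for the soft-covering error.\<close>
  define \<rho> where "\<rho> = Max {rS, 2 powr (- \<epsilon>), 2 powr (3 * \<epsilon>) * r, 2 powr (- \<delta>), 1 / 2}"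
  have \<rho>1: "\<rho> < 1" unfolding \<rho>_def using rS re \<epsilon>(1) \<delta>(1) by (simp add: powr_less_one)
  have \<rho>ge: "rS \<le> \<rho>" "2 powr (- \<epsilon>) \<le> \<rho>" "2 powr (3 * \<epsilon>) * r \<le> \<rho>" "2 powr (- \<delta>) \<le> \<rho>" "1 / 2 \<le> \<rho>"
    by (simp_all add: \<rho>_def)
  then have \<rho>0: "0 < \<rho>" by linarith
  \<comment> \<open>The summands collect atypicality and covering, the union bound over wrong
    histories, and the deviation. The factor 2^{LR} arises because up to \<open>L\<close> letters
    beyond the full blocks still count towards the number of messages.\<close>
  define B where "B = 5 * L + 2 * 2 ^ L * 2 powr (L * R) + L * (10 * L + 1)"
  have "\<exists>U dec. code_cost w VY VZ L (n div L) (num_msgs R n) U dec \<le> B * (1 + w) * \<rho> ^ (n div L)"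
    if w: "0 \<le> w" for n and w :: real
  proof -
    define N where "N = n div L"
    define M where "M = num_msgs R n"
    \<comment> \<open>The lower bound on n provides enough messages for covertness, the upper bound
      keeps them few enough for decoding.\<close>
    have "L * (n div L) + n mod L = n" "n mod L < L" using L by auto
    then have "L * N \<le> n" "n \<le> L * N + L" unfolding N_def by linarith+
    then have nN: "real L * real N \<le> real n" "real n \<le> real L * real N + L"
      by (metis of_nat_le_iff of_nat_mult, metis of_nat_le_iff of_nat_mult of_nat_add)
    note M = num_msgs_bounds[of R n, folded M_def, OF less_imp_le[OF R]]
    have Mlow: "2 powr (N * (d + j * (info VZ + \<delta> - infoS + \<epsilon>) + 2)) \<le> M" if j: "j < L" for j :: nat
    proof -
      have "info VZ + \<delta> - infoS + \<epsilon> \<le> R - c" using c \<epsilon> \<delta> by (simp add: R_def)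
      then have "j * (info VZ + \<delta> - infoS + \<epsilon>) \<le> j * (R - c)" by (intro mult_left_mono) auto
      also have "\<dots> \<le> L * (R - c)" using j c by (intro mult_right_mono) auto
      finally have "d + j * (info VZ + \<delta> - infoS + \<epsilon>) + 2 \<le> L * R" using Lc by (simp add: algebra_simps)
      then have "N * (d + j * (info VZ + \<delta> - infoS + \<epsilon>) + 2) \<le> N * (L * R)" by (intro mult_left_mono) auto
      also have "\<dots> \<le> n * R" using mult_right_mono[OF nN(1), of R] R by (simp add: mult_ac)
      finally have "2 powr (N * (d + j * (info VZ + \<delta> - infoS + \<epsilon>) + 2)) \<le> 2 powr (n * R)" by (intro powr_mono) auto
      then show ?thesis using M(1) by linarith
    qed
    let ?c = "2 * rS ^ N + 2 powr (- (N * \<epsilon>))"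
    obtain U dec where U: "code_cost w VY VZ L N M U dec \<le>
      L * (?c + 2 * 2 powr (3 * \<epsilon> * N) * rY ^ N)
      + real M * 2 ^ L * 2 powr (N * (L * (infoS + 2 * \<epsilon> - info VY + \<delta>)))
      + w * (L * (2 * (L * (?c + 2 * 2 powr (3 * \<epsilon> * N) * rZ ^ N)) + 2 powr (- real N)))"
      using block_code_bound[where n = N and M = M and L = L and rY = "rY ^ N" and rZ = "rZ ^ N" and rS = "rS ^ N",
          OF pos d \<epsilon>(1) M(3) Mlow HY HZ HS w] by blast
    let ?\<rho> = "\<rho> ^ N"
    have b1: "rS ^ N \<le> ?\<rho>" using \<rho>ge rS by (intro power_mono) auto
    have b2: "2 powr (- (N * \<epsilon>)) \<le> ?\<rho>"
      using power_mono[OF \<rho>ge(2), of N] by (simp add: two_powr_power)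
    have b3: "2 powr (3 * \<epsilon> * N) * x ^ N \<le> ?\<rho>" if "0 < x" "x \<le> r" for x
    proof -
      have "2 powr (3 * \<epsilon> * N) * x ^ N = (2 powr (3 * \<epsilon>) * x) ^ N"
        by (simp add: power_mult_distrib two_powr_power mult.commute)
      also have "\<dots> \<le> ?\<rho>"
        using that order.trans[OF mult_left_mono[OF that(2)] \<rho>ge(3)] by (intro power_mono) auto
      finally show ?thesis .
    qed
    have b4: "2 powr (- real N) \<le> ?\<rho>"
    proof -
      have "2 powr (- real N) = (2 powr (- 1)) ^ N" by (simp only: two_powr_power) simp
      also have "2 powr (- 1) = (1 / 2 :: real)" by simp
      finally show ?thesis using power_mono[OF \<rho>ge(5), of N] by simp
    qed
    have b5: "real M * 2 ^ L * 2 powr (N * (L * (infoS + 2 * \<epsilon> - info VY + \<delta>))) \<le> 2 * 2 ^ L * 2 powr (L * R) * ?\<rho>"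
    proof -
      have "n * R \<le> L * N * R + L * R" using mult_right_mono[OF nN(2), of R] R by (simp add: distrib_right)
      then have "n * R + N * (L * (infoS + 2 * \<epsilon> - info VY + \<delta>))
        \<le> L * R + N * (L * (R + infoS + 2 * \<epsilon> - info VY + \<delta>))" by (simp add: algebra_simps)
      \<comment> \<open>The inner exponent is 2 \<epsilon> - 2 \<delta>, at most - \<delta>.\<close>
      also have "\<dots> \<le> L * R + N * (L * (- \<delta>))"
        using \<epsilon>(2) by (intro add_left_mono mult_left_mono) (auto simp: R_def)
      also have "\<dots> \<le> L * R + N * (1 * (- \<delta>))"
        using L \<delta>(1) by (intro add_left_mono mult_left_mono mult_right_mono_neg) auto
      finally have e: "n * R + N * (L * (infoS + 2 * \<epsilon> - info VY + \<delta>)) \<le> L * R + - (N * \<delta>)" by simp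
      have "real M * 2 ^ L * 2 powr (N * (L * (infoS + 2 * \<epsilon> - info VY + \<delta>)))
        \<le> (2 * 2 powr (n * R)) * 2 ^ L * 2 powr (N * (L * (infoS + 2 * \<epsilon> - info VY + \<delta>)))"
        by (intro mult_right_mono M(2)) auto
      also have "\<dots> = 2 * 2 ^ L * 2 powr (n * R + N * (L * (infoS + 2 * \<epsilon> - info VY + \<delta>)))"
        by (simp add: powr_add)
      also have "\<dots> \<le> 2 * 2 ^ L * 2 powr (L * R + - (N * \<delta>))"
        by (intro mult_left_mono powr_mono e) auto
      also have "\<dots> = 2 * 2 ^ L * 2 powr (L * R) * 2 powr (- (N * \<delta>))" by (simp only: powr_add mult.assoc)
      also have "2 powr (- (N * \<delta>)) \<le> ?\<rho>" using power_mono[OF \<rho>ge(4), of N] by (simp add: two_powr_power)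
      finally show ?thesis by simp
    qed
    have c5: "?c + 2 * 2 powr (3 * \<epsilon> * N) * x ^ N \<le> 5 * ?\<rho>" if "0 < x" "x \<le> r" for x
      using b1 b2 b3[OF that] by linarith
    have "code_cost w VY VZ L N M U dec \<le> L * (5 * ?\<rho>) + 2 * 2 ^ L * 2 powr (L * R) * ?\<rho>
       + w * (L * (2 * (L * (5 * ?\<rho>)) + ?\<rho>))"
      by (intro order.trans[OF U] add_mono mult_left_mono b5 b4 w c5 rY(1) rZ(1) r) auto
    also have "\<dots> \<le> B * (1 + w) * ?\<rho>"
    proof -
      have "0 \<le> w * ?\<rho> * (5 * L + 2 * 2 ^ L * 2 powr (L * R)) + ?\<rho> * (L * (10 * L + 1))"
        using w \<rho>0 by (intro add_nonneg_nonneg mult_nonneg_nonneg) auto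
      then show ?thesis by (simp add: B_def algebra_simps)
    qed
    finally show ?thesis unfolding N_def M_def by blast
  qed
  then show ?thesis using L \<rho>0 \<rho>1 by blast
qed

end

section \<open>Mutual information of the auxiliary joint distribution\<close>

lemma pmf_bind_finite:
  fixes p :: "'a::finite pmf"
  shows "pmf (bind_pmf p f) x = (\<Sum>a\<in>UNIV. pmf p a * pmf (f a) x)"
  unfolding pmf_bind by (subst integral_measure_pmf_real[of UNIV]) (auto simp: mult.commute)

lemma pmf_bind_Pair: "pmf (bind_pmf p (\<lambda>a. map_pmf (Pair a) (k a))) (a, b) = pmf p a * pmf (k a) b"
proof -
  have "pmf (map_pmf (Pair a') (k a')) (a, b) = of_bool (a' = a) * pmf (k a) b" for a'
  proof (cases "a' = a")
    case True
    then show ?thesis using pmf_map_inj'[of "Pair a" "k a" b] by (simp add: inj_def)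
  next
    case False
    then have "(a, b) \<notin> set_pmf (map_pmf (Pair a') (k a'))" by auto
    then show ?thesis using False by (simp add: pmf_eq_0_set_pmf)
  qed
  then have "pmf (bind_pmf p (\<lambda>a. map_pmf (Pair a) (k a))) (a, b)
     = measure_pmf.expectation p (\<lambda>a'. of_bool (a' = a) * pmf (k a) b)"
    by (simp only: pmf_bind)
  also have "\<dots> = pmf p a * pmf (k a) b"
    by (subst integral_measure_pmf_real[of "{a}"]) auto
  finally show ?thesis .
qed

lemma fexp_superset:
  assumes "finite X" "set_pmf p \<subseteq> X"
  shows "fexp p F = (\<Sum>x\<in>X. pmf p x * F x)"
  unfolding fexp_def using assms by (intro sum.mono_neutral_left) (auto simp: set_pmf_iff)

lemma pmf_map_eq_fexp:
  assumes "finite (set_pmf p)"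
  shows "pmf (map_pmf f p) y = fexp p (\<lambda>x. of_bool (f x = y))"
proof -
  have "pmf (map_pmf f p) y = fexp (map_pmf f p) (\<lambda>x. of_bool (x = y))"
    unfolding fexp_def using assms
    by (auto simp: of_bool_def if_distrib[of "\<lambda>x. _ * x"] sum.delta' pmf_eq_0_set_pmf cong: if_cong)
  then show ?thesis using assms by (simp add: fexp_map)
qed

lemma mutual_info_eq_fexp:
  "mutual_info p = fexp p (\<lambda>ab. log 2 (pmf p ab / (pmf (map_pmf fst p) (fst ab) * pmf (map_pmf snd p) (snd ab))))"
  by (simp add: mutual_info_def fexp_def)

lemma cond_mutual_info_eq_fexp:
  "cond_mutual_info p = fexp p (\<lambda>(a, b, c). log 2 (pmf p (a, b, c) * pmf (map_pmf (\<lambda>(a,b,c). c) p) c /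
          (pmf (map_pmf (\<lambda>(a,b,c). (a,c)) p) (a, c) * pmf (map_pmf (\<lambda>(a,b,c). (b,c)) p) (b, c))))"
  by (auto simp: cond_mutual_info_def fexp_def intro!: sum.cong)

context aux_setting
begin

text \<open>Nesting \<open>Pair\<close> in this way lets \<open>pmf_bind_Pair\<close> read off the
  mass function factor by factor.\<close>

definition joint :: "('x \<Rightarrow> 's \<Rightarrow> 'b pmf) \<Rightarrow> ('u \<times> 'v \<times> 'b) pmf" where
  "joint V = bind_pmf PU (\<lambda>u. map_pmf (Pair u) (bind_pmf PV (\<lambda>v. map_pmf (Pair v)
     (bind_pmf (PSV v) (\<lambda>s. V (xf u s) s)))))"

context
  fixes V :: "'x \<Rightarrow> 's \<Rightarrow> 'b::finite pmf"
begin

abbreviation supp :: "('u \<times> 'v \<times> 'b) set" where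
  "supp \<equiv> set_pmf PU \<times> set_pmf PV \<times> UNIV"

lemma pmf_joint: "pmf (joint V) (u, v, x) = pmf PU u * pmf PV v * outV1 V u v x"
  unfolding joint_def pmf_bind_Pair by (simp add: pmf_bind_finite outV1_def)

lemma set_joint: "set_pmf (joint V) \<subseteq> supp"
  by (auto simp: joint_def)

lemma finite_joint: "finite (set_pmf (joint V))"
  by (rule finite_subset[OF set_joint]) (use finite_PU finite_PV in auto)

lemma fexp_joint: "fexp (joint V) F =
    (\<Sum>u\<in>set_pmf PU. \<Sum>v\<in>set_pmf PV. \<Sum>x\<in>UNIV. pmf PU u * pmf PV v * outV1 V u v x * F (u, v, x))"
  by (subst fexp_superset[OF _ set_joint])
    (use finite_PU finite_PV in \<open>auto simp: sum.cartesian_product pmf_joint intro!: sum.cong\<close>)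

lemma joint_marginals:
  assumes u: "u \<in> set_pmf PU" and v: "v \<in> set_pmf PV"
  shows "pmf (map_pmf (\<lambda>(u, v, x). u) (joint V)) u = pmf PU u"
    and "pmf (map_pmf (\<lambda>(u, v, x). x) (joint V)) x = q1 V x"
    and "pmf (map_pmf (\<lambda>(u, v, x). (u, v)) (joint V)) (u, v) = pmf PU u * pmf PV v"
    and "pmf (map_pmf (\<lambda>(u, v, x). (v, u)) (joint V)) (v, u) = pmf PU u * pmf PV v"
    and "pmf (map_pmf (\<lambda>(u, v, x). (u, x)) (joint V)) (u, x) = pmf PU u * out1 V u x"
    and "pmf (map_pmf (\<lambda>(u, v, x). (x, u)) (joint V)) (x, u) = pmf PU u * out1 V u x"
proof -
  note * = pmf_map_eq_fexp[OF finite_joint] fexp_joint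
  have e: "out1 V u x = (\<Sum>v\<in>set_pmf PV. pmf PV v * outV1 V u v x)" for u x
    by (simp add: out1_eq fexp_def)
  have PV1: "(\<Sum>v\<in>set_pmf PV. pmf PV v) = 1" using finite_PV by (intro sum_pmf_eq_1) auto
  have A: "(\<Sum>u'\<in>set_pmf PU. of_bool (u' = u) * f u') = f u" for f :: "'u \<Rightarrow> real"
    using u finite_PU by (simp add: of_bool_def if_distrib[of "\<lambda>x. x * _"] sum.delta cong: if_cong)
  have B: "(\<Sum>v'\<in>set_pmf PV. of_bool (v' = v) * f v') = f v" for f :: "'v \<Rightarrow> real"
    using v finite_PV by (simp add: of_bool_def if_distrib[of "\<lambda>x. x * _"] sum.delta cong: if_cong)
  have C: "(\<Sum>x'\<in>UNIV. of_bool (x' = x) * f x') = f x" for f :: "'b \<Rightarrow> real"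
    by (simp add: of_bool_def if_distrib[of "\<lambda>x. x * _"] sum.delta cong: if_cong)
  have "pmf (map_pmf (\<lambda>(u, v, x). u) (joint V)) u
      = (\<Sum>u'\<in>set_pmf PU. of_bool (u' = u) * (\<Sum>v\<in>set_pmf PV. \<Sum>x\<in>UNIV. pmf PU u' * pmf PV v * outV1 V u' v x))"
    unfolding * by (simp only: sum_distrib_left prod.case mult_ac)
  also have "\<dots> = pmf PU u"
    unfolding A by (simp add: sum_distrib_left[symmetric] sum_outV1 PV1)
  finally show "pmf (map_pmf (\<lambda>(u, v, x). u) (joint V)) u = pmf PU u" .
  have "pmf (map_pmf (\<lambda>(u, v, x). x) (joint V)) x
      = (\<Sum>u\<in>set_pmf PU. \<Sum>v\<in>set_pmf PV. \<Sum>x'\<in>UNIV. of_bool (x' = x) * (pmf PU u * pmf PV v * outV1 V u v x'))"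
    unfolding * by (simp only: prod.case mult_ac)
  then show "pmf (map_pmf (\<lambda>(u, v, x). x) (joint V)) x = q1 V x"
    unfolding C q1_eq .
  have uv: "fexp (joint V) (\<lambda>(u', v', x). of_bool (u' = u \<and> v' = v)) = pmf PU u * pmf PV v"
  proof -
    have "fexp (joint V) (\<lambda>(u', v', x). of_bool (u' = u \<and> v' = v))
      = (\<Sum>u'\<in>set_pmf PU. of_bool (u' = u) * (\<Sum>v'\<in>set_pmf PV. of_bool (v' = v) * (\<Sum>x\<in>UNIV. pmf PU u' * pmf PV v' * outV1 V u' v' x)))"
      unfolding fexp_joint by (simp only: sum_distrib_left prod.case mult_ac of_bool_conj)
    then show ?thesis unfolding A B by (simp add: sum_distrib_left[symmetric] sum_outV1)
  qed
  have ux: "fexp (joint V) (\<lambda>(u', v', x'). of_bool (u' = u \<and> x' = x)) = pmf PU u * out1 V u x"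
  proof -
    have "fexp (joint V) (\<lambda>(u', v', x'). of_bool (u' = u \<and> x' = x))
      = (\<Sum>u'\<in>set_pmf PU. of_bool (u' = u) * (\<Sum>v'\<in>set_pmf PV. (\<Sum>x'\<in>UNIV. of_bool (x' = x) * (pmf PU u' * pmf PV v' * outV1 V u' v' x'))))"
      unfolding fexp_joint by (simp only: sum_distrib_left prod.case mult_ac of_bool_conj)
    then show ?thesis unfolding A C e by (simp add: sum_distrib_left mult.assoc)
  qed
  show "pmf (map_pmf (\<lambda>(u, v, x). (u, v)) (joint V)) (u, v) = pmf PU u * pmf PV v"
    unfolding *(1) using uv by (simp add: case_prod_unfold)
  show "pmf (map_pmf (\<lambda>(u, v, x). (v, u)) (joint V)) (v, u) = pmf PU u * pmf PV v"
    unfolding *(1) using uv by (simp add: case_prod_unfold conj_commute)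
  show "pmf (map_pmf (\<lambda>(u, v, x). (u, x)) (joint V)) (u, x) = pmf PU u * out1 V u x"
    unfolding *(1) using ux by (simp add: case_prod_unfold)
  show "pmf (map_pmf (\<lambda>(u, v, x). (x, u)) (joint V)) (x, u) = pmf PU u * out1 V u x"
    unfolding *(1) using ux by (simp add: case_prod_unfold conj_commute)
qed

text \<open>On an atom of positive mass the averages \<open>out1\<close> and \<open>q1\<close>
  contain the positive term \<open>outV1\<close> with positive weight. Logarithms may therefore be
  manipulated as if all arguments were positive.\<close>

lemma fexp_joint_log_cong:
  assumes "\<And>u v x. u \<in> set_pmf PU \<Longrightarrow> v \<in> set_pmf PV \<Longrightarrow> 0 < pmf PU u \<Longrightarrow> 0 < pmf PV v \<Longrightarrow>
     0 < outV1 V u v x \<Longrightarrow> 0 < out1 V u x \<Longrightarrow> 0 < q1 V x \<Longrightarrow> F (u, v, x) = G (u, v, x)"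
  shows "fexp (joint V) F = fexp (joint V) G"
  unfolding fexp_joint
proof (intro sum.cong refl)
  fix u v x assume u: "u \<in> set_pmf PU" and v: "v \<in> set_pmf PV"
  have p: "0 < pmf PU u" "0 < pmf PV v" using u v by (auto simp: pmf_positive)
  show "pmf PU u * pmf PV v * outV1 V u v x * F (u, v, x) = pmf PU u * pmf PV v * outV1 V u v x * G (u, v, x)"
  proof (cases "outV1 V u v x = 0")
    case False
    then have o: "0 < outV1 V u v x" using outV1_nonneg[of V u v x] by simp
    then have q: "0 < q1 V x" using q1_pos[OF u v, of V x] p by simp
    have "pmf PV v * outV1 V u v x \<le> out1 V u x"
      unfolding out1_eq fexp_def using v finite_PV by (intro member_le_sum) (auto simp: outV1_nonneg)
    moreover have "0 < pmf PV v * outV1 V u v x" using o p by simp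
    ultimately have "0 < out1 V u x" by linarith
    then show ?thesis using assms[OF u v p o _ q] by simp
  qed simp
qed

lemma mutual_info_UV: "mutual_info (map_pmf (\<lambda>(u, v, x). ((u, v), x)) (joint V)) = info V"
proof -
  let ?f = "\<lambda>(u, v, x). ((u, v), x) :: ('u \<times> 'v) \<times> 'b"
  have m: "map_pmf fst (map_pmf ?f (joint V)) = map_pmf (\<lambda>(u, v, x). (u, v)) (joint V)"
    "map_pmf snd (map_pmf ?f (joint V)) = map_pmf (\<lambda>(u, v, x). x) (joint V)"
    by (simp_all add: map_pmf_comp case_prod_unfold)
  have J: "pmf (map_pmf ?f (joint V)) ((u, v), x) = pmf (joint V) (u, v, x)" for u v x
    using pmf_map_inj'[of ?f "joint V" "(u, v, x)"] by (auto simp: inj_def)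
  have "mutual_info (map_pmf ?f (joint V)) = fexp (joint V) (\<lambda>(u, v, x). log 2 (outV1 V u v x / q1 V x))"
    unfolding mutual_info_eq_fexp m fexp_map[OF finite_joint]
    by (rule fexp_joint_log_cong) (simp add: J joint_marginals pmf_joint)
  then show ?thesis by (simp add: info_def fexp_joint)
qed

text \<open>The chain rule, by adding densities: \<open>out1 / q1\<close> times
  \<open>outV1 / out1\<close> is \<open>outV1 / q1\<close>. It turns the conditional informations of
  the region into \<open>info\<close>.\<close>

lemma mutual_info_chain:
  "mutual_info (map_pmf (\<lambda>(u, v, x). (u, x)) (joint V)) +
   cond_mutual_info (map_pmf (\<lambda>(u, v, x). (v, x, u)) (joint V)) = info V"
proof -
  let ?f = "\<lambda>(u, v, x). (u, x) :: 'u \<times> 'b" and ?g = "\<lambda>(u, v, x). (v, x, u) :: 'v \<times> 'b \<times> 'u"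
  have m: "map_pmf fst (map_pmf ?f (joint V)) = map_pmf (\<lambda>(u, v, x). u) (joint V)"
    "map_pmf snd (map_pmf ?f (joint V)) = map_pmf (\<lambda>(u, v, x). x) (joint V)"
    "map_pmf (\<lambda>(a, b, c). c) (map_pmf ?g (joint V)) = map_pmf (\<lambda>(u, v, x). u) (joint V)"
    "map_pmf (\<lambda>(a, b, c). (a, c)) (map_pmf ?g (joint V)) = map_pmf (\<lambda>(u, v, x). (v, u)) (joint V)"
    "map_pmf (\<lambda>(a, b, c). (b, c)) (map_pmf ?g (joint V)) = map_pmf (\<lambda>(u, v, x). (x, u)) (joint V)"
    by (simp_all add: map_pmf_comp case_prod_unfold)
  have J: "pmf (map_pmf ?g (joint V)) (v, x, u) = pmf (joint V) (u, v, x)" for u v x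
    using pmf_map_inj'[of ?g "joint V" "(u, v, x)"] by (auto simp: inj_def)
  have "mutual_info (map_pmf ?f (joint V)) = fexp (joint V) (\<lambda>(u, v, x). log 2 (out1 V u x / q1 V x))"
    unfolding mutual_info_eq_fexp m fexp_map[OF finite_joint]
    by (rule fexp_joint_log_cong) (simp add: joint_marginals)
  moreover have "cond_mutual_info (map_pmf ?g (joint V)) = fexp (joint V) (\<lambda>(u, v, x). log 2 (outV1 V u v x / out1 V u x))"
    unfolding cond_mutual_info_eq_fexp m fexp_map[OF finite_joint]
    by (rule fexp_joint_log_cong) (simp add: joint_marginals J pmf_joint)
  moreover have "fexp (joint V) (\<lambda>(u, v, x). log 2 (out1 V u x / q1 V x)) + fexp (joint V) (\<lambda>(u, v, x). log 2 (outV1 V u v x / out1 V u x))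
     = fexp (joint V) (\<lambda>(u, v, x). log 2 (outV1 V u v x / q1 V x))"
    unfolding fexp_add[symmetric]
    by (rule fexp_joint_log_cong) (simp add: log_divide)
  ultimately show ?thesis by (simp add: info_def fexp_joint)
qed

end

lemma mutual_info_VS: "mutual_info (bind_pmf PV (\<lambda>v. map_pmf (Pair v) (PSV v))) = infoS"
proof -
  let ?p = "bind_pmf PV (\<lambda>v. map_pmf (Pair v) (PSV v))"
  have p: "pmf ?p (v, s) = pmf PV v * pmf (PSV v) s" for v s by (rule pmf_bind_Pair)
  have sub: "set_pmf ?p \<subseteq> set_pmf PV \<times> UNIV" by auto
  have m: "map_pmf fst ?p = PV" "map_pmf snd ?p = QS"
    by (simp_all add: map_bind_pmf map_pmf_comp map_pmf_const bind_return_pmf' QS)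
  have "mutual_info ?p = (\<Sum>v\<in>set_pmf PV. \<Sum>s\<in>UNIV. pmf ?p (v, s) * log 2 (pmf ?p (v, s) / (pmf PV v * pmf QS s)))"
    unfolding mutual_info_eq_fexp m
    by (subst fexp_superset[OF _ sub]) (use finite_PV in \<open>auto simp: sum.cartesian_product intro!: sum.cong\<close>)
  also have "\<dots> = infoS"
    unfolding infoS_def p by (intro sum.cong refl) (auto simp: set_pmf_iff)
  finally show ?thesis .
qed

end

section \<open>From blocks to causal codes\<close>

lemma sum_seqs_add:
  "(\<Sum>xs\<in>seqs (a + b) A. f xs) = (\<Sum>xs\<in>seqs a A. \<Sum>ys\<in>seqs b A. f (xs @ ys))"
proof (induction a arbitrary: f)
  case (Suc a)
  have "(\<Sum>xs\<in>seqs (Suc a + b) A. f xs) = (\<Sum>xs\<in>seqs a A. \<Sum>ys\<in>seqs b A. \<Sum>x\<in>A. f (x # xs @ ys))"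
    using Suc.IH[of "\<lambda>t. \<Sum>x\<in>A. f (x # t)"] by (simp add: sum_seqs_Suc)
  also have "\<dots> = (\<Sum>xs\<in>seqs a A. \<Sum>x\<in>A. \<Sum>ys\<in>seqs b A. f (x # xs @ ys))"
    by (intro sum.cong refl sum.swap)
  finally show ?case by (simp add: sum_seqs_Suc)
qed simp

text \<open>\<open>rev\<close> reconciles the two orders: block lists start with the newest block,
  flat sequences with the earliest letter.\<close>

lemma sum_seqs_blocks:
  "(\<Sum>xs\<in>seqs (L * n) A. f xs) = (\<Sum>xss\<in>seqs L (seqs n A). f (concat (rev xss)))"
proof (induction L arbitrary: f)
  case (Suc L)
  have "(\<Sum>xs\<in>seqs (Suc L * n) A. f xs) = (\<Sum>xs\<in>seqs (L * n) A. \<Sum>ys\<in>seqs n A. f (xs @ ys))"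
    by (subst sum_seqs_add[symmetric]) (simp add: add.commute)
  then show ?case by (simp add: Suc.IH sum_seqs_Suc)
qed simp

lemma length_blocks: "xss \<in> seqs L (seqs n A) \<Longrightarrow> length (concat (rev xss)) = L * n"
  by (induction L arbitrary: xss) (auto simp: seqs_Suc, simp add: seqs_def)

definition blk :: "nat \<Rightarrow> 'a list \<Rightarrow> nat \<Rightarrow> 'a list" where
  "blk n xs j = take n (drop (j * n) xs)"

text \<open>The free tail \<open>t\<close> absorbs the newest block in the induction and the
  leftover letters in use.\<close>

lemma blk_blocks:
  assumes "xss \<in> seqs L (seqs n A)"
  shows "map (blk n (concat (rev xss) @ t)) (rev [0..<L]) = xss"
  using assms
proof (induction L arbitrary: xss t)
  case (Suc L)
  then obtain x xs where x: "xss = x # xs" "x \<in> seqs n A" "xs \<in> seqs L (seqs n A)"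
    by (auto simp: seqs_Suc)
  have "blk n (concat (rev xss) @ t) L = x"
    using length_blocks[OF x(3)] x(1,2) by (simp add: blk_def seqs_def)
  moreover have "map (blk n (concat (rev xss) @ t)) (rev [0..<L]) = xs"
    using Suc.IH[OF x(3), of "x @ t"] x(1) by simp
  ultimately show ?case using x(1) by simp
qed simp

text \<open>Causality: when letter i is sent, every block before block \<open>i div n\<close> lies
  entirely in the past.\<close>

lemma blk_take:
  assumes "j < i div n"
  shows "blk n (take (Suc i) xs) j = blk n xs j"
proof -
  have "Suc j * n \<le> (i div n) * n" using assms by (intro mult_right_mono) auto
  also have "\<dots> \<le> i" by simp
  finally have "n \<le> Suc i - j * n" by simp
  then show ?thesis by (simp add: blk_def drop_take min_absorb1)
qed

lemma prod_lessThan_add: "(\<Prod>i<a + b. g i) = (\<Prod>i<a. g i) * (\<Prod>k<b. g (a + k))" for g :: "nat \<Rightarrow> real"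
  by (induction b) (simp_all add: mult.assoc)

lemma prod_blocks:
  fixes f :: "'a \<Rightarrow> real"
  assumes "xss \<in> seqs L (seqs n A)"
  shows "(\<Prod>i<L * n. f ((concat (rev xss) @ t) ! i)) = prod_list (map (\<lambda>x. \<Prod>i<n. f (x ! i)) xss)"
  using assms
proof (induction L arbitrary: xss t)
  case (Suc L)
  then obtain x xs where x: "xss = x # xs" "x \<in> seqs n A" "xs \<in> seqs L (seqs n A)"
    by (auto simp: seqs_Suc)
  have "(\<Prod>k<n. f ((concat (rev xss) @ t) ! (L * n + k))) = (\<Prod>k<n. f (x ! k))"
    using length_blocks[OF x(3)] x(1,2) by (intro prod.cong) (auto simp: nth_append seqs_def)
  then show ?case using Suc.IH[OF x(3), of "x @ t"] x(1)
    by (simp add: prod_lessThan_add add.commute[of n] mult.commute)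
qed simp

text \<open>Nonpositive for p <= q. Otherwise p is split as q + (p - q): log t <= (t - 1)/ln 2
  handles the first part, log(p/q) <= b the second. Summed over outputs this is a reverse Pinsker
  bound.\<close>

lemma entropy_term_le:
  fixes p q b :: real
  assumes p: "0 \<le> p" "p \<le> 1" and q: "2 powr (- b) \<le> q" and b: "0 \<le> b"
  shows "p * log 2 (p / q) \<le> \<bar>p - q\<bar> * (1 / ln 2 + b)"
proof (cases "p \<le> q")
  case True
  have q0: "0 < q" using q powr_gt_zero[of 2 "- b"] by linarith
  have "p * log 2 (p / q) \<le> 0"
  proof (cases "p = 0")
    case False
    then show ?thesis using p q0 True by (intro mult_nonneg_nonpos) auto
  qed simp
  also have "0 \<le> \<bar>p - q\<bar> * (1 / ln 2 + b)" using b by simp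
  finally show ?thesis .
next
  case False
  have q0: "0 < q" using q powr_gt_zero[of 2 "- b"] by linarith
  have l1: "log 2 (p / q) \<le> (p / q - 1) / ln 2"
    unfolding log_def using ln_le_minus_one[of "p / q"] False q0 p by (intro divide_right_mono) auto
  have "p / q \<le> 1 / 2 powr (- b)" using p q q0 by (intro frac_le) auto
  then have "log 2 (p / q) \<le> log 2 (2 powr b)"
    using False q0 p by (intro log_mono) (auto simp: powr_minus divide_inverse)
  then have l2: "log 2 (p / q) \<le> b" by simp
  have "p * log 2 (p / q) = q * log 2 (p / q) + (p - q) * log 2 (p / q)" by (simp add: algebra_simps)
  also have "\<dots> \<le> q * ((p / q - 1) / ln 2) + (p - q) * b"
    using l1 l2 q0 False by (intro add_mono mult_left_mono) auto
  also have "\<dots> = (p - q) * (1 / ln 2 + b)" using q0 by (simp add: field_simps)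
  finally show ?thesis using False by simp
qed

lemma lists_len_eq_seqs: "lists_len n = seqs n UNIV"
  by (auto simp: lists_len_def seqs_def)

lemma sum_iid_prob: "(\<Sum>xs\<in>lists_len n. iid_prob p n xs) = 1" for p :: "'a::finite pmf"
  unfolding lists_len_eq_seqs iid_prob_def sum_seqs_prod[where f = "\<lambda>i. pmf p"]
  by (simp add: sum_pmf_eq_1)

lemma sum_chan_prob: "(\<Sum>bs\<in>lists_len n. chan_prob V n xs ss bs) = 1" for V :: "'x \<Rightarrow> 's \<Rightarrow> 'b::finite pmf"
  unfolding lists_len_eq_seqs chan_prob_def sum_seqs_prod[where f = "\<lambda>i. pmf (V (xs ! i) (ss ! i))"]
  by (simp add: sum_pmf_eq_1)

lemma iid_prob_nonneg: "0 \<le> iid_prob p n xs"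
  unfolding iid_prob_def by (intro prod_nonneg) auto

lemma chan_prob_nonneg: "0 \<le> chan_prob V n xs ss bs"
  unfolding chan_prob_def by (intro prod_nonneg) auto

lemma warden_dist_nonneg: "0 \<le> warden_dist QS W n M enc zs"
  unfolding warden_dist_def
  by (intro mult_nonneg_nonneg sum_nonneg iid_prob_nonneg chan_prob_nonneg) auto

lemma error_prob_nonneg: "0 \<le> error_prob QS W n M enc dec"
  unfolding error_prob_def
  by (intro mult_nonneg_nonneg sum_nonneg iid_prob_nonneg chan_prob_nonneg) auto

lemma sum_warden_dist:
  fixes W :: "'x \<Rightarrow> 's::finite \<Rightarrow> ('y \<times> 'z::finite) pmf"
  assumes "0 < M"
  shows "(\<Sum>zs\<in>lists_len n. warden_dist QS W n M enc zs) = 1"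
proof -
  have "(\<Sum>zs\<in>lists_len n. \<Sum>m<M. \<Sum>ss\<in>lists_len n. iid_prob QS n ss * chan_prob (WZ W) n (code_inputs enc n m ss) ss zs)
     = (\<Sum>m<M. \<Sum>ss\<in>lists_len n. iid_prob QS n ss * (\<Sum>zs\<in>lists_len n. chan_prob (WZ W) n (code_inputs enc n m ss) ss zs))"
    unfolding sum_distrib_left by (subst sum.swap, intro sum.cong refl, rule sum.swap)
  then show ?thesis using assms
    unfolding warden_dist_def sum_distrib_left[symmetric] by (simp add: sum_chan_prob sum_iid_prob)
qed

text \<open>Full support gives \<open>Q0\<close> a letterwise lower bound 2^{-b}, hence 2^{-nb} on
  sequences. The resulting factor linear in \<open>n\<close> is why the deviation carries the weight
  \<open>n\<close> in the cost.\<close>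

lemma warden_divergence_bounds:
  fixes W :: "'x \<Rightarrow> 's::finite \<Rightarrow> ('y \<times> 'z::finite) pmf"
  assumes M: "0 < M" and b: "0 \<le> b" "\<And>z. 2 powr (- b) \<le> pmf (Q0 QS W x0) z"
  shows "0 \<le> warden_divergence QS W x0 n M enc"
    "warden_divergence QS W x0 n M enc \<le>
      (\<Sum>zs\<in>lists_len n. \<bar>warden_dist QS W n M enc zs - iid_prob (Q0 QS W x0) n zs\<bar>) * (1 / ln 2 + n * b)"
proof -
  let ?P = "warden_dist QS W n M enc" and ?Q = "iid_prob (Q0 QS W x0) n"
  have D: "warden_divergence QS W x0 n M enc = (\<Sum>zs\<in>lists_len n. ?P zs * log 2 (?P zs / ?Q zs))"
    unfolding warden_divergence_def by (intro sum.cong) (auto simp: Let_def)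
  have fin: "finite (lists_len n :: 'z list set)" by (simp add: lists_len_eq_seqs)
  have Qlow: "2 powr (- (n * b)) \<le> ?Q zs" for zs
  proof -
    have "2 powr (- (n * b)) = (\<Prod>i<n. 2 powr (- b))" by (simp add: two_powr_power)
    also have "\<dots> \<le> ?Q zs" unfolding iid_prob_def using b by (intro prod_mono) auto
    finally show ?thesis .
  qed
  have Q0: "0 < ?Q zs" for zs using Qlow[of zs] powr_gt_zero[of 2 "- (n * b)"] by linarith
  have P1: "?P zs \<le> 1" if "zs \<in> lists_len n" for zs
    unfolding sum_warden_dist[OF M, symmetric, where n = n and QS = QS and W = W and enc = enc]
    using that fin by (intro member_le_sum) (auto simp: warden_dist_nonneg)
  show "0 \<le> warden_divergence QS W x0 n M enc"
    unfolding D using fin Q0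
    by (intro gibbs) (auto simp: warden_dist_nonneg less_imp_le sum_warden_dist[OF M] sum_iid_prob)
  show "warden_divergence QS W x0 n M enc \<le>
      (\<Sum>zs\<in>lists_len n. \<bar>?P zs - ?Q zs\<bar>) * (1 / ln 2 + n * b)"
    unfolding D sum_distrib_right
    using b by (intro sum_mono entropy_term_le warden_dist_nonneg P1 Qlow) auto
qed

section \<open>From block codes to causal codes of arbitrary length\<close>

context aux_setting
begin

text \<open>Within a block the input uses the completed earlier blocks, newest first, and the
  current state through \<open>xf\<close>. Leftover letters get the innocent symbol, so the warden
  sees exactly \<open>Q0\<close> there.\<close>

definition input :: "nat \<Rightarrow> nat \<Rightarrow> 'x \<Rightarrow> (nat \<Rightarrow> 's list list \<Rightarrow> 'u list) \<Rightarrow> nat \<Rightarrow> nat \<Rightarrow> 's list \<Rightarrow> 'x" where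
  "input L n x0 U i m ss = (if i < L * n
     then xf (U m (map (blk n ss) (rev [0..<i div n])) ! (i mod n)) (ss ! i) else x0)"

lemma input_take: "input L n x0 U i m (take (Suc i) ss) = input L n x0 U i m ss"
proof -
  have "map (blk n (take (Suc i) ss)) (rev [0..<i div n]) = map (blk n ss) (rev [0..<i div n])"
    by (intro map_cong refl blk_take) auto
  then show ?thesis unfolding input_def by (simp only: nth_take lessI)
qed

text \<open>The newest block stands last in the flat sequence, so peeling it off moves it into the
  free tails \<open>t\<close> and \<open>tz\<close>.\<close>

lemma block_prob_flat:
  assumes "ss \<in> seqs L (seqs n UNIV)" "zs \<in> seqs L (seqs n UNIV)"
  shows "(\<Prod>i<L * n. pmf QS ((concat (rev ss) @ t) ! i) *
      pmf (V (xf (U m (map (blk n (concat (rev ss) @ t)) (rev [0..<i div n])) ! (i mod n)) ((concat (rev ss) @ t) ! i)) ((concat (rev ss) @ t) ! i))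
        ((concat (rev zs) @ tz) ! i)) = block_prob (iid_prob QS n) (Wn V n) (U m) ss zs"
  using assms
proof (induction L arbitrary: ss zs t tz)
  case (Suc L)
  from Suc.prems obtain s ss' z zs' where s: "ss = s # ss'" "s \<in> seqs n UNIV" "ss' \<in> seqs L (seqs n UNIV)"
    and z: "zs = z # zs'" "z \<in> seqs n UNIV" "zs' \<in> seqs L (seqs n UNIV)"
    by (auto simp: seqs_Suc)
  let ?g = "\<lambda>i. pmf QS ((concat (rev ss) @ t) ! i) *
      pmf (V (xf (U m (map (blk n (concat (rev ss) @ t)) (rev [0..<i div n])) ! (i mod n)) ((concat (rev ss) @ t) ! i)) ((concat (rev ss) @ t) ! i))
        ((concat (rev zs) @ tz) ! i)"
  have "(\<Prod>k<n. ?g (L * n + k)) = (\<Prod>k<n. pmf QS (s ! k) * pmf (V (xf (U m ss' ! k) (s ! k)) (s ! k)) (z ! k))"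
  proof (intro prod.cong refl)
    fix k assume k: "k \<in> {..<n}"
    then have [simp]: "(L * n + k) div n = L" "k mod n = k" by auto
    have "(concat (rev ss) @ t) ! (L * n + k) = s ! k" "(concat (rev zs) @ tz) ! (L * n + k) = z ! k"
      using length_blocks[OF s(3)] length_blocks[OF z(3)] s z k by (auto simp: nth_append seqs_def)
    moreover have "map (blk n (concat (rev ss) @ t)) (rev [0..<L]) = ss'"
      using blk_blocks[OF s(3), of "s @ t"] s(1) by simp
    ultimately show "?g (L * n + k) = pmf QS (s ! k) * pmf (V (xf (U m ss' ! k) (s ! k)) (s ! k)) (z ! k)"
      by simp
  qed
  moreover have "(\<Prod>i<L * n. ?g i) = block_prob (iid_prob QS n) (Wn V n) (U m) ss' zs'"
    using Suc.IH[OF s(3) z(3), of "s @ t" "z @ tz"] s(1) z(1) by simp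
  moreover have "(\<Prod>i<Suc L * n. ?g i) = (\<Prod>i<L * n. ?g i) * (\<Prod>k<n. ?g (L * n + k))"
    by (subst prod_lessThan_add[symmetric]) (simp add: add.commute)
  moreover have "block_prob (iid_prob QS n) (Wn V n) (U m) ss zs = block_prob (iid_prob QS n) (Wn V n) (U m) ss' zs' *
      (\<Prod>k<n. pmf QS (s ! k) * pmf (V (xf (U m ss' ! k) (s ! k)) (s ! k)) (z ! k))"
    unfolding prod.distrib s(1) z(1) block_prob.simps list.sel iid_prob_def[of QS n s] Wn_def[of V n "U m ss'" s z] ..
  ultimately show ?case by (simp only:)
qed (simp add: seqs_def)

lemma joint_prob_flat:
  assumes ss: "ss \<in> seqs L (seqs n UNIV)" and zs: "zs \<in> seqs L (seqs n UNIV)"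
    and t: "t \<in> seqs r UNIV" and tz: "tz \<in> seqs r UNIV"
  shows "iid_prob QS (L * n + r) (concat (rev ss) @ t) *
     chan_prob V (L * n + r) (code_inputs (input L n x0 U) (L * n + r) m (concat (rev ss) @ t)) (concat (rev ss) @ t) (concat (rev zs) @ tz)
   = block_prob (iid_prob QS n) (Wn V n) (U m) ss zs * (\<Prod>k<r. pmf QS (t ! k) * pmf (V x0 (t ! k)) (tz ! k))"
proof -
  let ?s = "concat (rev ss) @ t" and ?z = "concat (rev zs) @ tz"
  let ?g = "\<lambda>i. pmf QS (?s ! i) * pmf (V (input L n x0 U i m ?s) (?s ! i)) (?z ! i)"
  have "iid_prob QS (L * n + r) ?s * chan_prob V (L * n + r) (code_inputs (input L n x0 U) (L * n + r) m ?s) ?s ?z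
    = (\<Prod>i<L * n + r. ?g i)"
    unfolding iid_prob_def chan_prob_def prod.distrib[symmetric] code_inputs_def
    by (intro prod.cong refl) (simp add: input_take del: take_append)
  also have "\<dots> = (\<Prod>i<L * n. ?g i) * (\<Prod>k<r. ?g (L * n + k))" by (rule prod_lessThan_add)
  also have "(\<Prod>i<L * n. ?g i) = block_prob (iid_prob QS n) (Wn V n) (U m) ss zs"
    unfolding block_prob_flat[OF ss zs, of t V U m tz, symmetric] by (intro prod.cong refl) (simp add: input_def)
  also have "(\<Prod>k<r. ?g (L * n + k)) = (\<Prod>k<r. pmf QS (t ! k) * pmf (V x0 (t ! k)) (tz ! k))"
    using length_blocks[OF ss] length_blocks[OF zs]
    by (intro prod.cong refl) (simp add: input_def nth_append)
  finally show ?thesis .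
qed

text \<open>The padding contributes a factor free of message and codebook. For the warden it is the
  same factor as in the target law, so padding leaves the L1 distance unchanged.\<close>

lemma output_dist_flat:
  assumes zs: "zs \<in> seqs L (seqs n UNIV)" and tz: "tz \<in> seqs r UNIV"
  shows "(\<Sum>ss\<in>lists_len (L * n + r). iid_prob QS (L * n + r) ss *
     chan_prob V (L * n + r) (code_inputs (input L n x0 U) (L * n + r) m ss) ss (concat (rev zs) @ tz))
   = (\<Sum>ss\<in>seqs L (seqs n UNIV). block_prob (iid_prob QS n) (Wn V n) (U m) ss zs)
     * (\<Prod>k<r. pmf (bind_pmf QS (V x0)) (tz ! k))"
proof -
  have "(\<Sum>t\<in>seqs r UNIV. \<Prod>k<r. pmf QS (t ! k) * pmf (V x0 (t ! k)) (tz ! k))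
      = (\<Prod>k<r. pmf (bind_pmf QS (V x0)) (tz ! k))"
    by (subst sum_seqs_prod[where f = "\<lambda>k s. pmf QS s * pmf (V x0 s) (tz ! k)"]) (simp add: pmf_bind_finite)
  note tail = this
  show ?thesis
    unfolding lists_len_eq_seqs sum_seqs_add sum_seqs_blocks sum_distrib_right
    by (intro sum.cong refl) (simp add: joint_prob_flat[OF _ zs _ tz] sum_distrib_left[symmetric] tail)
qed

text \<open>The decoder discards the padding and regroups the outputs into blocks. The cost is taken
  with weight \<open>n\<close>, so \<open>n\<close> times the L1 distance is at most
  \<open>c\<close>, which pays for the factor \<open>n\<close> in the divergence.\<close>

lemma code_from_blocks:
  fixes W :: "'x \<Rightarrow> 's \<Rightarrow> ('y::finite \<times> 'z::finite) pmf"
  assumes n: "n = L * N + r" and M: "0 < M"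
    and q1: "\<And>z. q1 (WZ W) z = pmf (Q0 QS W x0) z"
    and b: "0 \<le> b" "\<And>z. 2 powr (- b) \<le> pmf (Q0 QS W x0) z"
    and cost: "code_cost n (WY W) (WZ W) L N M U dec \<le> c" and n0: "0 < n"
  shows "\<exists>enc dec'. error_prob QS W n M enc dec' \<le> c \<and> warden_divergence QS W x0 n M enc \<le> c * (1 / ln 2 + b)"
proof -
  let ?enc = "input L N x0 U"
  let ?dec = "\<lambda>ys. dec (map (blk N ys) (rev [0..<L]))"
  let ?err = "(1 / M) * (\<Sum>m<M. \<Sum>ss\<in>seqs L (seqs N UNIV). \<Sum>ys\<in>seqs L (seqs N UNIV).
        block_prob (iid_prob QS N) (Wn (WY W) N) (U m) ss ys * of_bool (dec ys \<noteq> m))"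
  let ?tv = "\<Sum>zs\<in>seqs L (seqs N UNIV). \<bar>(1 / M) * (\<Sum>m<M. \<Sum>ss\<in>seqs L (seqs N UNIV).
        block_prob (iid_prob QS N) (Wn (WZ W) N) (U m) ss zs) - prod_list (map (\<lambda>z. \<Prod>i<N. q1 (WZ W) (z ! i)) zs)\<bar>"
  have one: "(\<Sum>t\<in>seqs r UNIV. \<Prod>k<r. pmf p (t ! k)) = 1" for p :: "'b::finite pmf"
    using sum_iid_prob[of p r] by (simp add: iid_prob_def lists_len_eq_seqs)
  have err: "error_prob QS W n M ?enc ?dec = ?err"
  proof -
    have "(\<Sum>ss\<in>lists_len n. iid_prob QS n ss * (\<Sum>ys\<in>lists_len n. chan_prob (WY W) n (code_inputs ?enc n m ss) ss ys *
           (if ?dec ys \<noteq> m then 1 else 0)))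
       = (\<Sum>ss\<in>seqs L (seqs N UNIV). \<Sum>ys\<in>seqs L (seqs N UNIV).
        block_prob (iid_prob QS N) (Wn (WY W) N) (U m) ss ys * of_bool (dec ys \<noteq> m))" for m
    proof -
      have "(\<Sum>ss\<in>lists_len n. iid_prob QS n ss * (\<Sum>ys\<in>lists_len n. chan_prob (WY W) n (code_inputs ?enc n m ss) ss ys *
           (if ?dec ys \<noteq> m then 1 else 0)))
        = (\<Sum>ys\<in>lists_len n. (\<Sum>ss\<in>lists_len n. iid_prob QS n ss * chan_prob (WY W) n (code_inputs ?enc n m ss) ss ys) * of_bool (?dec ys \<noteq> m))"
        unfolding sum_distrib_left sum_distrib_right by (subst sum.swap) (simp add: of_bool_def mult.assoc)
      also have "\<dots> = (\<Sum>ys\<in>seqs L (seqs N UNIV). \<Sum>ty\<in>seqs r UNIV.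
          (\<Sum>ss\<in>lists_len n. iid_prob QS n ss * chan_prob (WY W) n (code_inputs ?enc n m ss) ss (concat (rev ys) @ ty)) * of_bool (?dec (concat (rev ys) @ ty) \<noteq> m))"
        unfolding n lists_len_eq_seqs[of "L * N + r", where 'a = 'y] sum_seqs_add sum_seqs_blocks ..
      also have "\<dots> = (\<Sum>ys\<in>seqs L (seqs N UNIV). \<Sum>ty\<in>seqs r UNIV.
          (\<Sum>ss\<in>seqs L (seqs N UNIV). block_prob (iid_prob QS N) (Wn (WY W) N) (U m) ss ys) * (\<Prod>k<r. pmf (bind_pmf QS (WY W x0)) (ty ! k)) * of_bool (dec ys \<noteq> m))"
        unfolding n by (intro sum.cong refl) (simp add: output_dist_flat blk_blocks)
      also have "\<dots> = (\<Sum>ys\<in>seqs L (seqs N UNIV). (\<Sum>ss\<in>seqs L (seqs N UNIV). block_prob (iid_prob QS N) (Wn (WY W) N) (U m) ss ys) * of_bool (dec ys \<noteq> m))"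
        by (simp only: sum_distrib_left[symmetric] sum_distrib_right[symmetric] one mult_1_right)
      also have "\<dots> = (\<Sum>ss\<in>seqs L (seqs N UNIV). \<Sum>ys\<in>seqs L (seqs N UNIV).
        block_prob (iid_prob QS N) (Wn (WY W) N) (U m) ss ys * of_bool (dec ys \<noteq> m))"
        unfolding sum_distrib_right by (rule sum.swap)
      finally show ?thesis .
    qed
    then show ?thesis unfolding error_prob_def by simp
  qed
  have tv: "(\<Sum>zs\<in>lists_len n. \<bar>warden_dist QS W n M ?enc zs - iid_prob (Q0 QS W x0) n zs\<bar>) = ?tv"
  proof -
    have "(\<Sum>zs\<in>lists_len n. \<bar>warden_dist QS W n M ?enc zs - iid_prob (Q0 QS W x0) n zs\<bar>)
      = (\<Sum>zs\<in>seqs L (seqs N UNIV). \<Sum>tz\<in>seqs r UNIV. \<bar>warden_dist QS W n M ?enc (concat (rev zs) @ tz) - iid_prob (Q0 QS W x0) n (concat (rev zs) @ tz)\<bar>)"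
      unfolding n lists_len_eq_seqs sum_seqs_add sum_seqs_blocks ..
    also have "\<dots> = (\<Sum>zs\<in>seqs L (seqs N UNIV). \<Sum>tz\<in>seqs r UNIV. \<bar>(1 / M) * (\<Sum>m<M. \<Sum>ss\<in>seqs L (seqs N UNIV).
        block_prob (iid_prob QS N) (Wn (WZ W) N) (U m) ss zs) - prod_list (map (\<lambda>z. \<Prod>i<N. q1 (WZ W) (z ! i)) zs)\<bar> * (\<Prod>k<r. pmf (Q0 QS W x0) (tz ! k)))"
    proof (intro sum.cong refl)
      fix zs :: "'z list list" and tz :: "'z list" assume zs: "zs \<in> seqs L (seqs N UNIV)" and tz: "tz \<in> seqs r UNIV"
      let ?t = "\<Prod>k<r. pmf (Q0 QS W x0) (tz ! k)"
      have w: "warden_dist QS W n M ?enc (concat (rev zs) @ tz) = (1 / M) * (\<Sum>m<M. \<Sum>ss\<in>seqs L (seqs N UNIV).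
        block_prob (iid_prob QS N) (Wn (WZ W) N) (U m) ss zs) * ?t"
        unfolding warden_dist_def n
        by (simp add: output_dist_flat[OF zs tz] Q0_def sum_distrib_right[symmetric])
      have "(\<Prod>k<r. pmf (Q0 QS W x0) ((concat (rev zs) @ tz) ! (L * N + k))) = ?t"
        using length_blocks[OF zs] by (intro prod.cong refl) (simp add: nth_append)
      then have i: "iid_prob (Q0 QS W x0) n (concat (rev zs) @ tz) = prod_list (map (\<lambda>z. \<Prod>i<N. q1 (WZ W) (z ! i)) zs) * ?t"
        unfolding iid_prob_def n prod_lessThan_add prod_blocks[OF zs] q1 by simp
      have "0 \<le> ?t" by (intro prod_nonneg) auto
      then show "\<bar>warden_dist QS W n M ?enc (concat (rev zs) @ tz) - iid_prob (Q0 QS W x0) n (concat (rev zs) @ tz)\<bar>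
        = \<bar>(1 / M) * (\<Sum>m<M. \<Sum>ss\<in>seqs L (seqs N UNIV).
        block_prob (iid_prob QS N) (Wn (WZ W) N) (U m) ss zs) - prod_list (map (\<lambda>z. \<Prod>i<N. q1 (WZ W) (z ! i)) zs)\<bar> * ?t"
        unfolding w i left_diff_distrib[symmetric] abs_mult by simp
    qed
    also have "\<dots> = ?tv" by (simp only: sum_distrib_left[symmetric] one mult_1_right)
    finally show ?thesis .
  qed
  have c: "?err + n * ?tv \<le> c" using cost by (simp add: code_cost_def)
  have tv0: "0 \<le> ?tv" by (intro sum_nonneg) auto
  have err0: "0 \<le> ?err" using error_prob_nonneg err by metis
  have ntv: "n * ?tv \<le> c" using c err0 by linarith
  \<comment> \<open>Uses n >= 1, so the part of the divergence bound without the factor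
    \<open>n\<close> is covered as well.\<close>
  have tv_le: "?tv \<le> n * ?tv" using mult_right_mono[of 1 "real n" ?tv] n0 tv0 by simp
  have "error_prob QS W n M ?enc ?dec \<le> c"
    unfolding err using c mult_nonneg_nonneg[OF of_nat_0_le_iff[of n] tv0] by linarith
  moreover have "warden_divergence QS W x0 n M ?enc \<le> ?tv * (1 / ln 2 + n * b)"
    using warden_divergence_bounds(2)[OF M b, of n ?enc] unfolding tv .
  moreover have "?tv * (1 / ln 2 + n * b) = ?tv * (1 / ln 2) + (n * ?tv) * b" by (simp add: algebra_simps)
  moreover have "?tv * (1 / ln 2) + (n * ?tv) * b \<le> c * (1 / ln 2) + c * b"
    using b ntv order.trans[OF tv_le ntv] by (intro add_mono mult_right_mono) auto
  moreover have "c * (1 / ln 2) + c * b = c * (1 / ln 2 + b)" by (simp add: distrib_left)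
  ultimately show ?thesis by (intro exI[of _ ?enc] exI[of _ ?dec]) linarith
qed

section \<open>Limits and achievability\<close>

lemma full_support_lower_bound:
  fixes p :: "'b::finite pmf"
  assumes pos: "\<And>z. 0 < pmf p z"
  shows "\<exists>b\<ge>0. \<forall>z. 2 powr (- b) \<le> pmf p z"
proof -
  define b where "b = (\<Sum>z\<in>UNIV. - log 2 (pmf p z))"
  have nn: "0 \<le> - log 2 (pmf p z)" for z using pos[of z] pmf_le_1[of p z] by simp
  have "- log 2 (pmf p z) \<le> b" for z unfolding b_def using nn by (intro member_le_sum) auto
  then have "- b \<le> log 2 (pmf p z)" for z by (simp add: minus_le_iff)
  then have "2 powr (- b) \<le> 2 powr (log 2 (pmf p z))" for z by (intro powr_mono) simp_all
  moreover have "2 powr (log 2 (pmf p z)) = pmf p z" for z using pos[of z] by simp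
  ultimately have "2 powr (- b) \<le> pmf p z" for z by metis
  moreover have "0 \<le> b" unfolding b_def using nn by (intro sum_nonneg) auto
  ultimately show ?thesis by blast
qed

lemma geometric_div_tendsto_0:
  fixes \<rho> :: real
  assumes \<rho>: "0 < \<rho>" "\<rho> < 1" and L: "0 < L"
  shows "(\<lambda>n. (1 + real n) * \<rho> ^ (n div L)) \<longlonglongrightarrow> 0"
proof -
  \<comment> \<open>A block rate \<rho> is a letter rate \<sigma> with \<sigma>^L = \<rho>; the
    extra factor 1/\<rho> below pays for the incomplete last block.\<close>
  define \<sigma> where "\<sigma> = \<rho> powr (1 / L)"
  have \<sigma>: "0 < \<sigma>" "\<sigma> < 1" using \<rho> L powr_less_mono2[of "1 / L" \<rho> 1] by (auto simp: \<sigma>_def)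
  have le: "\<rho> ^ (n div L) \<le> \<sigma> ^ n / \<rho>" for n
  proof -
    have "n = L * (n div L) + n mod L" "n mod L \<le> L" using L by (auto simp: less_imp_le)
    then have "real n \<le> real L * real (n div L) + real L" by (metis add_left_mono of_nat_add of_nat_mono of_nat_mult)
    then have "real n / L - 1 \<le> real (n div L)" using L by (simp add: field_simps)
    then have "\<rho> powr (n div L) \<le> \<rho> powr (n / L - 1)" using \<rho> by (intro powr_mono') auto
    also have "\<dots> = \<rho> powr ((1 / L) * n) / \<rho>" using \<rho> by (simp add: powr_diff)
    also have "\<rho> powr ((1 / L) * n) = \<sigma> ^ n"
      using \<sigma> unfolding \<sigma>_def by (subst powr_powr[symmetric]) (simp add: powr_realpow)
    finally show ?thesis using \<rho> by (simp add: powr_realpow)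
  qed
  have "(\<lambda>n. \<sigma> ^ n / \<rho> + real n * \<sigma> ^ n / \<rho>) \<longlonglongrightarrow> 0 / \<rho> + 0 / \<rho>"
    using \<sigma> \<rho> by (intro tendsto_intros LIMSEQ_power_zero powser_times_n_limit_0) auto
  then have lim: "(\<lambda>n. \<sigma> ^ n / \<rho> + real n * \<sigma> ^ n / \<rho>) \<longlonglongrightarrow> 0" by simp
  show ?thesis
  proof (rule tendsto_sandwich[OF _ _ tendsto_const lim])
    show "\<forall>\<^sub>F n in sequentially. 0 \<le> (1 + real n) * \<rho> ^ (n div L)" using \<rho> by auto
    have "(1 + real n) * \<rho> ^ (n div L) \<le> \<sigma> ^ n / \<rho> + real n * \<sigma> ^ n / \<rho>" for n
      using mult_left_mono[OF le, of "1 + real n" n] by (simp add: distrib_right add_divide_distrib)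
    then show "\<forall>\<^sub>F n in sequentially. (1 + real n) * \<rho> ^ (n div L) \<le> \<sigma> ^ n / \<rho> + real n * \<sigma> ^ n / \<rho>" by simp
  qed
qed

lemma covert_achievableI:
  fixes W :: "'x \<Rightarrow> 's \<Rightarrow> ('y::finite \<times> 'z::finite) pmf"
  assumes pos: "\<And>z. 0 < pmf (Q0 QS W x0) z" and R: "0 \<le> R"
    and q1: "\<And>z. q1 (WZ W) z = pmf (Q0 QS W x0) z"
    and cost: "\<And>n. \<exists>U dec. code_cost n (WY W) (WZ W) L (N n) (num_msgs R n) U dec \<le> c n"
    and N: "\<And>n. L * N n \<le> n" and c: "c \<longlonglongrightarrow> 0"
  shows "covert_achievable QS W x0 R"
proof -
  obtain b where b: "0 \<le> b" "\<And>z. 2 powr (- b) \<le> pmf (Q0 QS W x0) z"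
    using full_support_lower_bound[OF pos] by blast
  \<comment> \<open>Length 0 is exempt, since the weight \<open>n\<close> would erase the deviation;
    limits ignore it.\<close>
  have "\<exists>enc dec'. 0 < n \<longrightarrow> error_prob QS W n (num_msgs R n) enc dec' \<le> c n \<and>
      warden_divergence QS W x0 n (num_msgs R n) enc \<le> c n * (1 / ln 2 + b)" for n
  proof (cases "0 < n")
    case True
    obtain U dec where "code_cost n (WY W) (WZ W) L (N n) (num_msgs R n) U dec \<le> c n" using cost by blast
    from code_from_blocks[where L = L and N = "N n" and r = "n - L * N n" and n = n, OF _ num_msgs_bounds(3)[OF R] q1 b this True]
    show ?thesis using N[of n] by auto
  qed simp
  then obtain enc dec where E: "\<And>n. 0 < n \<Longrightarrow> error_prob QS W n (num_msgs R n) (enc n) (dec n) \<le> c n"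
    "\<And>n. 0 < n \<Longrightarrow> warden_divergence QS W x0 n (num_msgs R n) (enc n) \<le> c n * (1 / ln 2 + b)"
    by metis
  have c': "(\<lambda>n. c n * (1 / ln 2 + b)) \<longlonglongrightarrow> 0" using tendsto_mult_right[OF c] by simp
  have "(\<lambda>n. error_prob QS W n (num_msgs R n) (enc n) (dec n)) \<longlonglongrightarrow> 0"
    by (rule tendsto_sandwich[OF _ _ tendsto_const c])
      (auto simp: error_prob_nonneg intro!: eventually_mono[OF eventually_gt_at_top[of 0]] E)
  moreover have "(\<lambda>n. warden_divergence QS W x0 n (num_msgs R n) (enc n)) \<longlonglongrightarrow> 0"
    by (rule tendsto_sandwich[OF _ _ tendsto_const c'])
      (auto simp: warden_divergence_bounds(1)[OF num_msgs_bounds(3)[OF R] b] intro!: eventually_mono[OF eventually_gt_at_top[of 0]] E)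
  ultimately show ?thesis unfolding covert_achievable_def by blast
qed

text \<open>At rate 0 there is one message, and with no blocks every letter is padding by the
  innocent symbol: no error and exact agreement with the target law. The block construction itself
  needs a positive rate.\<close>

lemma covert_achievable_zero:
  fixes W :: "'x \<Rightarrow> 's \<Rightarrow> ('y::finite \<times> 'z::finite) pmf"
  assumes pos: "\<And>z. 0 < pmf (Q0 QS W x0) z" and q1: "\<And>z. q1 (WZ W) z = pmf (Q0 QS W x0) z"
  shows "covert_achievable QS W x0 0"
proof (rule covert_achievableI[OF pos _ q1, where L = 0 and N = "\<lambda>_. 0" and c = "\<lambda>_. 0"])
  show "\<exists>U dec. code_cost n (WY W) (WZ W) 0 0 (num_msgs 0 n) U dec \<le> 0" for n
    by (intro exI[of _ "\<lambda>_ _. []"] exI[of _ "\<lambda>_. 0"]) (simp add: code_cost_def num_msgs_def)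
qed auto

lemma covert_achievable_rate:
  fixes W :: "'x \<Rightarrow> 's \<Rightarrow> ('y::finite \<times> 'z::finite) pmf"
  assumes pos: "\<And>z. 0 < pmf (Q0 QS W x0) z" and q1: "\<And>z. q1 (WZ W) z = pmf (Q0 QS W x0) z"
    and \<delta>: "0 < \<delta>" "3 * \<delta> < info (WY W) - infoS" "5 * \<delta> < info (WY W) - info (WZ W)"
  shows "covert_achievable QS W x0 (info (WY W) - infoS - 3 * \<delta>)"
proof -
  let ?R = "info (WY W) - infoS - 3 * \<delta>"
  have "0 < q1 (WZ W) z" for z using pos q1 by simp
  from block_codes[OF this \<delta>] obtain L B \<rho> where L: "0 < L" and \<rho>: "0 < \<rho>" "\<rho> < 1"
    and H: "\<And>n w. 0 \<le> w \<Longrightarrow> \<exists>U dec. code_cost w (WY W) (WZ W) L (n div L) (num_msgs ?R n) U dec \<le> B * (1 + w) * \<rho> ^ (n div L)"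
    by blast
  have "(\<lambda>n. B * ((1 + real n) * \<rho> ^ (n div L))) \<longlonglongrightarrow> B * 0"
    by (intro tendsto_mult_left geometric_div_tendsto_0 \<rho> L)
  then have c: "(\<lambda>n. B * (1 + real n) * \<rho> ^ (n div L)) \<longlonglongrightarrow> 0" by (simp add: mult.assoc)
  show ?thesis
    by (rule covert_achievableI[OF pos _ q1 H _ c]) (use \<delta> in auto)
qed

end

section \<open>Identification of the region and the capacity bound\<close>

lemma aux_joint_marginals:
  fixes QS :: "'s::finite pmf" and W :: "'x \<Rightarrow> 's \<Rightarrow> ('y \<times> 'z) pmf"
  assumes "aux_setting QS PU PV PSV"
  shows "map_pmf (\<lambda>(u, v, s, x, y, z). (u, v, y)) (aux_joint PU PV PSV xf W) = aux_setting.joint PU PV PSV xf (WY W)"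
    and "map_pmf (\<lambda>(u, v, s, x, y, z). (u, v, z)) (aux_joint PU PV PSV xf W) = aux_setting.joint PU PV PSV xf (WZ W)"
    and "map_pmf (\<lambda>(u, v, s, x, y, z). (v, s)) (aux_joint PU PV PSV xf W) = bind_pmf PV (\<lambda>v. map_pmf (Pair v) (PSV v))"
  unfolding aux_joint_def aux_setting.joint_def[OF assms] WY_def WZ_def
  by (simp_all add: map_bind_pmf map_pmf_comp case_prod_unfold bind_pmf_const, simp add: map_pmf_def)

theorem theorem7:
  fixes QS :: "'s::finite pmf"
    and W :: "'x::finite \<Rightarrow> 's \<Rightarrow> ('y::finite \<times> 'z::finite) pmf"
    and x0 :: 'x
  assumes "\<forall>z. pmf (Q0 QS W x0) z > 0"
  shows "\<forall>R \<in> region_S QS W x0. ereal R \<le> covert_capacity_CT QS W x0"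
proof
  fix R assume "R \<in> region_S QS W x0"
  then obtain PU PV PSV xf where R0: "0 \<le> R" and D: "in_D QS W x0 PU PV PSV xf"
    and R: "R \<le> rate_bound W PU PV PSV xf"
    by (auto simp: region_S_def)
  interpret aux_setting QS PU PV PSV xf
  proof
    have "set_pmf PU \<subseteq> {..<CARD('x) + 2}" "set_pmf PV \<subseteq> {..<CARD('x) + 3}" and eq: "bind_pmf PV PSV = QS"
      using D unfolding in_D_def Let_def by simp_all
    then show "finite (set_pmf PU)" "finite (set_pmf PV)"
      by (auto intro: finite_subset[OF _ finite_lessThan])
    show "bind_pmf PV PSV = QS" by (rule eq)
  qed
  let ?P = "aux_joint PU PV PSV xf W"
  note marg = aux_joint_marginals[OF aux_setting_axioms, of xf W]
  have comp: "map_pmf (\<lambda>(u,v,s,x,y,z). (v, y, u)) ?P = map_pmf (\<lambda>(u, v, x). (v, x, u)) (joint (WY W))"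
    "map_pmf (\<lambda>(u,v,s,x,y,z). (u, y)) ?P = map_pmf (\<lambda>(u, v, x). (u, x)) (joint (WY W))"
    "map_pmf (\<lambda>(u,v,s,x,y,z). ((u, v), z)) ?P = map_pmf (\<lambda>(u, v, x). ((u, v), x)) (joint (WZ W))"
    "map_pmf (\<lambda>(u,v,s,x,y,z). z) ?P = map_pmf (\<lambda>(u, v, x). x) (joint (WZ W))"
    unfolding marg(1,2)[symmetric] by (simp_all add: map_pmf_comp case_prod_unfold)
  have q1: "q1 (WZ W) z = pmf (Q0 QS W x0) z" for z
  proof -
    obtain u v where uv: "u \<in> set_pmf PU" "v \<in> set_pmf PV" using set_pmf_not_empty[of PU] set_pmf_not_empty[of PV] by auto
    have "map_pmf (\<lambda>(u,v,s,x,y,z). z) ?P = Q0 QS W x0" using D unfolding in_D_def Let_def by (elim conjE)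
    then show ?thesis using joint_marginals(2)[OF uv, of "WZ W" z] unfolding comp(4) by simp
  qed
  have pos: "0 < pmf (Q0 QS W x0) z" for z using assms by simp
  \<comment> \<open>Adding I(U;Y) to both sides of the condition I(V;Y|U) > I(U,V;Z) - I(U;Y) and
    applying the chain rule gives I(U,V;Y) > I(U,V;Z).\<close>
  have gap: "info (WZ W) < info (WY W)"
    using D unfolding in_D_def Let_def comp mutual_info_UV mutual_info_chain[of "WY W", symmetric] by linarith
  \<comment> \<open>The second argument of the minimum, combined with the chain rule.\<close>
  have R: "R \<le> info (WY W) - infoS"
    using R unfolding rate_bound_def Let_def comp marg(3) mutual_info_VS mutual_info_chain[of "WY W", symmetric] by linarith
  have cap: "ereal r \<le> covert_capacity_CT QS W x0" if "covert_achievable QS W x0 r" for r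
    unfolding covert_capacity_CT_def using that by (intro Sup_upper) auto
  show "ereal R \<le> covert_capacity_CT QS W x0"
  proof (cases "R = 0")
    case True
    then show ?thesis using cap[OF covert_achievable_zero[OF pos q1]] by simp
  next
    case False
    show ?thesis
    proof (rule ccontr)
      assume "\<not> ?thesis"
      then have "covert_capacity_CT QS W x0 < ereal R" by simp
      then obtain r where r: "covert_capacity_CT QS W x0 < ereal r" "r < R"
        using ereal_dense2[of "covert_capacity_CT QS W x0" "ereal R"] by auto
      \<comment> \<open>The three bounds make 3 \<delta> < R, keep the achieved rate at least r, and
        make 5 \<delta> smaller than the gap. Rates strictly below the target suffice because
        capacity is a supremum.\<close>
      define \<delta> where "\<delta> = Min {R / 4, (R - r) / 3, (info (WY W) - info (WZ W)) / 6}"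
      have "0 < \<delta>" using R0 False r(2) gap by (simp add: \<delta>_def)
      moreover have "\<delta> \<le> R / 4" "\<delta> \<le> (R - r) / 3" "\<delta> \<le> (info (WY W) - info (WZ W)) / 6"
        unfolding \<delta>_def by (intro Min_le; simp)+
      ultimately have \<delta>: "0 < \<delta>" "\<delta> \<le> R / 4" "\<delta> \<le> (R - r) / 3" "\<delta> \<le> (info (WY W) - info (WZ W)) / 6" .
      have "ereal (info (WY W) - infoS - 3 * \<delta>) \<le> covert_capacity_CT QS W x0"
        by (intro cap covert_achievable_rate pos q1) (use \<delta> R R0 False gap in auto)
      also have "\<dots> < ereal r" by (rule r(1))
      finally show False using R \<delta>(3) by simp
    qed
  qed
qed

end
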